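(* Let $n\ge 1$ and $k\ge 3$ be integers and let $G=B(n,n,2P_k)$. Then $$adern(G)=\begin{cases}5 & \text{if } n=1 \text{ and } k\ge 4,\\ 2 & \text{if } n\in\{2,3\} \text{ and } k=3, \text{ or if } n\ge 3 \text{ and } k=4,\\ 1 & \text{if } n\ge 4 \text{ and } k=3,\\ 3 & \text{otherwise.}\end{cases}$$
   Context: All graphs are finite, simple and undirected. For an edge $e$ of a graph $G$, $d(e)$ is the number of edges of $G$ adjacent to $e$. A da-ecard of $G$ is the pair $(d(e),G-e)$ with $G-e$ unlabeled; the da-edeck is the multiset of all da-ecards. The adversary degree associated edge reconstruction number $adern(G)$ is the minimum number $k$ such that every sub-multiset of $k$ da-ecards of $G$ is not contained in the da-edeck of any graph $H\not\cong G$. $B(n,n,mP_k)$ denotes the strong double broom obtained from $m$ internally vertex disjoint paths on $k$ vertices with common ends $u$ and $v$ by attaching $n$ leaves to $u$ and $n$ leaves to $v$. *)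

theory Defs
  imports "HOL-Library.Multiset" "HOL-Library.Ramsey"
begin

type_synonym 'v ugraph = "'v set \<times> 'v set set"

definition verts :: "'v ugraph \<Rightarrow> 'v set" where
  "verts G = fst G"

definition edges :: "'v ugraph \<Rightarrow> 'v set set" where
  "edges G = snd G"

definition simple_graph :: "'v ugraph \<Rightarrow> bool" where
  "simple_graph G \<longleftrightarrow> finite (verts G) \<and> edges G \<subseteq> [verts G]\<^bsup>2\<^esup>"

definition graph_iso :: "'v ugraph \<Rightarrow> 'w ugraph \<Rightarrow> bool" where
  "graph_iso G H \<longleftrightarrow>
     (\<exists>f. bij_betw f (verts G) (verts H) \<and> (\<lambda>e. f ` e) ` edges G = edges H)"

definition adjacent_edges :: "'v set \<Rightarrow> 'v set \<Rightarrow> bool" where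
  "adjacent_edges e f \<longleftrightarrow> e \<noteq> f \<and> e \<inter> f \<noteq> {}"

definition edge_degree :: "'v ugraph \<Rightarrow> 'v set \<Rightarrow> nat" where
  "edge_degree G e = card {f \<in> edges G. adjacent_edges e f}"

definition delete_edge :: "'v ugraph \<Rightarrow> 'v set \<Rightarrow> 'v ugraph" where
  "delete_edge G e = (verts G, edges G - {e})"

text \<open>
  An unlabeled graph is an isomorphism class.  So that graphs with different vertex types can be
  compared, the class is taken among the finite simple graphs with vertices in \<^typ>\<open>nat\<close>; by
  \<open>ex_nat_copy\<close> and \<open>unlabeled_eq_iff\<close> below this loses nothing.
\<close>

definition unlabeled :: "'v ugraph \<Rightarrow> nat ugraph set" where
  "unlabeled G = {H. simple_graph H \<and> graph_iso G H}"

definition da_ecard :: "'v ugraph \<Rightarrow> 'v set \<Rightarrow> nat \<times> nat ugraph set" where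
  "da_ecard G e = (edge_degree G e, unlabeled (delete_edge G e))"

definition da_edeck :: "'v ugraph \<Rightarrow> (nat \<times> nat ugraph set) multiset" where
  "da_edeck G = image_mset (da_ecard G) (mset_set (edges G))"

text \<open>
  The graph \<open>H\<close> ranges over all finite simple graphs up to isomorphism, with no restriction on its
  number of vertices or edges.  For \<open>k\<close> larger than the number of edges of \<open>G\<close> the condition is
  vacuous, so the minimum always exists; it exceeds the number of edges exactly when the whole
  da-edeck does not determine \<open>G\<close>.
\<close>

definition adern :: "'v ugraph \<Rightarrow> nat" where
  "adern G = (LEAST k. \<forall>S. S \<subseteq># da_edeck G \<and> size S = k \<longrightarrow>
     (\<forall>H :: nat ugraph. simple_graph H \<and> \<not> graph_iso G H \<longrightarrow> \<not> S \<subseteq># da_edeck H))"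

text \<open>
  \<open>Inner i j\<close> is the \<open>j\<close>-th vertex of the \<open>i\<close>-th path, where positions on a path run from
  \<open>0\<close> (the common end \<open>u\<close>) to \<open>k - 1\<close> (the common end \<open>v\<close>).
\<close>

datatype broom_vertex = EndU | EndV | Inner nat nat | LeafU nat | LeafV nat

definition path_vertex :: "nat \<Rightarrow> nat \<Rightarrow> nat \<Rightarrow> broom_vertex" where
  "path_vertex k i j = (if j = 0 then EndU else if j = k - 1 then EndV else Inner i j)"

text \<open>
  \<open>strong_double_broom a b m k\<close> is $B(a,b,mP_k)$: there are \<open>m\<close> paths on \<open>k\<close> vertices each, \<open>a\<close>
  leaves at \<open>u\<close> and \<open>b\<close> leaves at \<open>v\<close>.  It is meant for \<open>m \<ge> 1\<close> and \<open>k \<ge> 3\<close>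
  (for \<open>k = 2\<close> the \<open>m\<close> paths would collapse to a single edge).
\<close>

definition strong_double_broom :: "nat \<Rightarrow> nat \<Rightarrow> nat \<Rightarrow> nat \<Rightarrow> broom_vertex ugraph" where
  "strong_double_broom a b m k =
     ({path_vertex k i j | i j. i < m \<and> j < k} \<union> LeafU ` {..<a} \<union> LeafV ` {..<b},
      {{path_vertex k i j, path_vertex k i (Suc j)} | i j. i < m \<and> Suc j < k}
        \<union> {{EndU, LeafU i} | i. i < a} \<union> {{EndV, LeafV i} | i. i < b})"

lemma graph_iso_refl: "graph_iso G G"
  unfolding graph_iso_def by (rule exI[of _ id]) auto

lemma graph_iso_sym:
  assumes "simple_graph G" "graph_iso G H"
  shows "graph_iso H G"
proof -
  obtain f where f: "bij_betw f (verts G) (verts H)" "(\<lambda>e. f ` e) ` edges G = edges H"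
    using assms(2) unfolding graph_iso_def by blast
  let ?g = "inv_into (verts G) f"
  have g: "?g ` f ` e = e" if "e \<in> edges G" for e
  proof -
    have "e \<subseteq> verts G"
      using assms(1) that by (auto simp: simple_graph_def nsets_def)
    then show ?thesis
      by (rule inv_into_image_cancel[OF bij_betw_imp_inj_on[OF f(1)]])
  qed
  have "(\<lambda>e. ?g ` e) ` edges H = (\<lambda>e. ?g ` f ` e) ` edges G"
    unfolding f(2)[symmetric] image_image ..
  also have "\<dots> = edges G"
    by (simp add: g cong: image_cong_simp)
  finally show ?thesis
    unfolding graph_iso_def using bij_betw_inv_into[OF f(1)] by blast
qed

lemma graph_iso_trans:
  assumes "graph_iso G H" "graph_iso H K"
  shows "graph_iso G K"
proof -
  obtain f where f: "bij_betw f (verts G) (verts H)" "(\<lambda>e. f ` e) ` edges G = edges H"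
    using assms(1) unfolding graph_iso_def by blast
  obtain g where g: "bij_betw g (verts H) (verts K)" "(\<lambda>e. g ` e) ` edges H = edges K"
    using assms(2) unfolding graph_iso_def by blast
  have "(\<lambda>e. (g \<circ> f) ` e) ` edges G = (\<lambda>e. g ` e) ` (\<lambda>e. f ` e) ` edges G"
    unfolding image_image comp_apply ..
  then show ?thesis
    unfolding graph_iso_def f(2) g(2) using bij_betw_trans[OF f(1) g(1)] by blast
qed

lemma ex_nat_copy:
  assumes "simple_graph G"
  shows "\<exists>H :: nat ugraph. simple_graph H \<and> graph_iso G H"
proof -
  obtain f :: "'a \<Rightarrow> nat" and n where f: "bij_betw f (verts G) {..<n}"
    using assms ex_bij_betw_finite_nat[of "verts G"]
    by (auto simp: simple_graph_def atLeast0LessThan)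
  let ?H = "({..<n}, (\<lambda>e. f ` e) ` edges G)"
  have "f ` e \<in> [{..<n}]\<^bsup>2\<^esup>" if "e \<in> edges G" for e
  proof -
    have "e \<subseteq> verts G" "finite e" "card e = 2"
      using assms that by (auto simp: simple_graph_def nsets_def)
    then show ?thesis
      using f by (auto simp: nsets_def bij_betw_def card_image inj_on_subset)
  qed
  then have "simple_graph ?H"
    by (auto simp: simple_graph_def verts_def edges_def)
  moreover have "graph_iso G ?H"
    using f by (auto simp: graph_iso_def verts_def edges_def)
  ultimately show ?thesis by blast
qed

lemma unlabeled_eq_iff:
  assumes "simple_graph G" "simple_graph H"
  shows "unlabeled G = unlabeled H \<longleftrightarrow> graph_iso G H"
proof
  assume eq: "unlabeled G = unlabeled H"
  obtain K :: "nat ugraph" where K: "simple_graph K" "graph_iso G K"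
    using ex_nat_copy[OF assms(1)] by blast
  then have "K \<in> unlabeled H"
    unfolding eq[symmetric] by (simp add: unlabeled_def)
  then have "graph_iso K H"
    by (auto simp: unlabeled_def intro: graph_iso_sym[OF assms(2)])
  with K(2) show "graph_iso G H"
    by (rule graph_iso_trans)
next
  assume GH: "graph_iso G H"
  have "graph_iso G K \<longleftrightarrow> graph_iso H K" for K :: "nat ugraph"
  proof
    show "graph_iso G K \<Longrightarrow> graph_iso H K"
      by (rule graph_iso_trans[OF graph_iso_sym[OF assms(1) GH]])
    show "graph_iso H K \<Longrightarrow> graph_iso G K"
      by (rule graph_iso_trans[OF GH])
  qed
  then show "unlabeled G = unlabeled H"
    by (simp only: unlabeled_def)
qed

lemma simple_graph_strong_double_broom:
  assumes "k \<ge> 3" "m \<ge> 1"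
  shows "simple_graph (strong_double_broom a b m k)"
proof -
  let ?P = "{path_vertex k i j | i j. i < m \<and> j < k}"
  let ?V = "?P \<union> LeafU ` {..<a} \<union> LeafV ` {..<b}"
  have U: "EndU \<in> ?P"
  proof (intro CollectI exI conjI)
    show "EndU = path_vertex k 0 0" "0 < m" "0 < k"
      using assms by (simp_all add: path_vertex_def)
  qed
  have V: "EndV \<in> ?P"
  proof (intro CollectI exI conjI)
    show "EndV = path_vertex k 0 (k - 1)" "0 < m" "k - 1 < k"
      using assms by (simp_all add: path_vertex_def)
  qed
  have ne: "path_vertex k i j \<noteq> path_vertex k i (Suc j)" for i j
    using assms by (auto simp: path_vertex_def)
  have "?P = (\<lambda>(i, j). path_vertex k i j) ` ({..<m} \<times> {..<k})"
    by auto
  then have fin: "finite ?V"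
    by simp
  have 1: "{path_vertex k i j, path_vertex k i (Suc j)} \<in> [?V]\<^bsup>2\<^esup>"
    if "i < m" "Suc j < k" for i j
  proof -
    have "j < k"
      using that by simp
    then have "path_vertex k i j \<in> ?P"
      using that(1) by (intro CollectI exI conjI) (rule refl)
    moreover have "path_vertex k i (Suc j) \<in> ?P"
      using that by (intro CollectI exI conjI) (rule refl)
    ultimately show ?thesis
      using ne[of i j] by (simp add: nsets_def)
  qed
  have 2: "{EndU, LeafU i} \<in> [?V]\<^bsup>2\<^esup>" if "i < a" for i
    using U that by (simp add: nsets_def)
  have 3: "{EndV, LeafV i} \<in> [?V]\<^bsup>2\<^esup>" if "i < b" for i
    using V that by (simp add: nsets_def)
  have "{{path_vertex k i j, path_vertex k i (Suc j)} | i j. i < m \<and> Suc j < k}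
      \<subseteq> [?V]\<^bsup>2\<^esup>"
  proof
    fix e assume "e \<in> {{path_vertex k i j, path_vertex k i (Suc j)} | i j. i < m \<and> Suc j < k}"
    then obtain i j where "e = {path_vertex k i j, path_vertex k i (Suc j)}" "i < m" "Suc j < k"
      by (elim CollectE exE conjE)
    with 1 show "e \<in> [?V]\<^bsup>2\<^esup>" by simp
  qed
  moreover have "{{EndU, LeafU i} | i. i < a} \<subseteq> [?V]\<^bsup>2\<^esup>"
    by (rule subsetI, elim CollectE exE conjE) (use 2 in simp)
  moreover have "{{EndV, LeafV i} | i. i < b} \<subseteq> [?V]\<^bsup>2\<^esup>"
    by (rule subsetI, elim CollectE exE conjE) (use 3 in simp)
  ultimately show ?thesis
    using fin
    unfolding simple_graph_def strong_double_broom_def verts_def edges_def fst_conv snd_conv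
    by (intro conjI Un_least)
qed

end

theory Submission
  imports Defs "HOL-Combinatorics.Transposition"
begin

text \<open>
  Write \<open>L = k - 1\<close>. A graph sharing a da-ecard with the broom \<open>G\<close> is, up to isomorphism, \<open>G\<close> with
  an edge \<open>e\<close> exchanged for a non-edge \<open>f\<close> of the same edge degree, and by the symmetries of \<open>G\<close>
  the edge \<open>e\<close> may be taken to be a leaf edge at \<open>u\<close> or an edge of the first path. The edge degree
  leaves few choices for \<open>f\<close>. In each card both branch vertices have at least about \<open>n\<close> leaves, so a
  branch vertex \<open>h\<close> of the new graph \<open>K\<close> with fewer leaves must gain one in every card of \<open>K\<close> shared
  with \<open>G\<close>: the deleted edge is the second edge at a neighbour \<open>x\<close> of \<open>h\<close> of degree 2, and \<open>hx\<close> is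
  not a bridge. As \<open>K\<close> is unicyclic, at most two edges at \<open>h\<close> are not bridges, which
  bounds the number of shared cards. The exchanges not covered by this argument are distinguished by
  vertex degrees and by the distance \<open>L\<close> of the branch vertices.
\<close>

subsection \<open>Degrees, leaves and edge exchange\<close>

text \<open>Everything rests on counting, for one exchanged graph, the edges whose da-ecards occur
  in \<open>G\<close> at all (\<open>goods\<close>). Multiplicities are dropped, and the bound is
  still attained. Leaf cards are tried first: a graph that shares none of them with \<open>G\<close>
  shares only connected cards, so only its non-bridges matter. The obstacle is that a deficient
  branch vertex must be recognisable in the card, that is, keep degree at least 3. From degree 4 on
  this is automatic, and at most two shared cards remain. For n = 1 the degree is 3, so the deleted
  edge may also lie at the branch vertex, which allows two more cards. The value 5 = 4 + 1 is
  attained by a cycle with two pendant edges whose ends are at distance L - 2: two shared cards,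
  doubled by a reflection. The value 1 for L = 2 and n at least 4 arises because no exchange is
  left: for a leaf edge the edge degree forces n to be at most 3, and for a path edge it forces n =
  1 or a new edge between twins of the old ends, which gives \<open>G\<close> back.\<close>

definition nb :: "'v ugraph \<Rightarrow> 'v \<Rightarrow> 'v set" where
  "nb K x = {y. {x, y} \<in> edges K}"

definition deg :: "'v ugraph \<Rightarrow> 'v \<Rightarrow> nat" where
  "deg K x = card (nb K x)"

definition leaves :: "'v ugraph \<Rightarrow> 'v \<Rightarrow> 'v set" where
  "leaves K x = {y \<in> nb K x. deg K y = 1}"

definition swap_edge :: "'v ugraph \<Rightarrow> 'v set \<Rightarrow> 'v set \<Rightarrow> 'v ugraph" where
  "swap_edge K e f = (verts K, insert f (edges K - {e}))"

lemma verts_delete_edge [simp]: "verts (delete_edge K e) = verts K"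
  and edges_delete_edge [simp]: "edges (delete_edge K e) = edges K - {e}"
  by (auto simp: delete_edge_def verts_def edges_def)

lemma verts_swap_edge [simp]: "verts (swap_edge K e f) = verts K"
  and edges_swap_edge [simp]: "edges (swap_edge K e f) = insert f (edges K - {e})"
  by (auto simp: swap_edge_def verts_def edges_def)

lemma ugraph_eqI: "verts A = verts B \<Longrightarrow> edges A = edges B \<Longrightarrow> A = B"
  by (auto simp: verts_def edges_def intro: prod_eqI)

lemma simple_edge:
  assumes "simple_graph K" "e \<in> edges K"
  obtains x y where "e = {x, y}" "x \<noteq> y" "x \<in> verts K" "y \<in> verts K"
  using assms by (fastforce simp: simple_graph_def nsets_def card_2_iff)

lemma simple_edge_mem:
  assumes "simple_graph K" "{x, y} \<in> edges K"
  shows "x \<noteq> y" "x \<in> verts K" "y \<in> verts K"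
  using assms by (auto elim!: simple_edge simp: doubleton_eq_iff)

lemma simple_delete_edge: "simple_graph K \<Longrightarrow> simple_graph (delete_edge K e)"
  by (auto simp: simple_graph_def)

lemma simple_swap_edge:
  "simple_graph K \<Longrightarrow> f \<in> [verts K]\<^bsup>2\<^esup> \<Longrightarrow> simple_graph (swap_edge K e f)"
  by (auto simp: simple_graph_def)

lemma finite_verts: "simple_graph K \<Longrightarrow> finite (verts K)"
  by (simp add: simple_graph_def)

lemma finite_edges: "simple_graph K \<Longrightarrow> finite (edges K)"
  by (rule finite_subset[of _ "Pow (verts K)"]) (auto simp: simple_graph_def nsets_def)

lemma nb_sym: "y \<in> nb K x \<longleftrightarrow> x \<in> nb K y"
  by (simp add: nb_def insert_commute)

lemma nb_subset_verts: "simple_graph K \<Longrightarrow> nb K x \<subseteq> verts K"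
  by (auto simp: nb_def dest: simple_edge_mem)

lemma finite_nb: "simple_graph K \<Longrightarrow> finite (nb K x)"
  using nb_subset_verts finite_verts finite_subset by metis

lemma finite_leaves: "simple_graph K \<Longrightarrow> finite (leaves K x)"
  unfolding leaves_def by (rule finite_subset[OF _ finite_nb]) auto

lemma nb_delete_edge:
  "nb (delete_edge K e) x = {y \<in> nb K x. {x, y} \<noteq> e}"
  by (auto simp: nb_def)

lemma deg_delete_edge:
  assumes "simple_graph K" "g \<in> edges K"
  shows "deg K x = deg (delete_edge K g) x + (if x \<in> g then 1 else 0)"
proof -
  obtain a b where g: "g = {a, b}" "a \<noteq> b"
    using assms by (elim simple_edge)
  have *: "deg K x = deg (delete_edge K g) x + 1" if "{x, y} = g" for y
  proof -
    have "nb (delete_edge K g) x = nb K x - {y}"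
      unfolding nb_delete_edge that[symmetric] by (auto simp: doubleton_eq_iff)
    moreover have "y \<in> nb K x" using assms(2) that by (simp add: nb_def)
    ultimately show ?thesis
      using card_Suc_Diff1[OF finite_nb[OF assms(1)]] by (simp add: deg_def)
  qed
  show ?thesis
  proof (cases "x \<in> g")
    case True
    then obtain y where "{x, y} = g" using g by auto
    then show ?thesis using * True by simp
  next
    case False
    then have "nb (delete_edge K g) x = nb K x" by (auto simp: nb_delete_edge)
    then show ?thesis using False by (simp add: deg_def)
  qed
qed

lemma delete_swap_edge: "f \<notin> edges K - {e} \<Longrightarrow> delete_edge (swap_edge K e f) f = delete_edge K e"
  by (rule ugraph_eqI) auto

text \<open>Deleting \<open>f\<close> from the exchanged graph and deleting \<open>e\<close> from
  \<open>K\<close> leave the same graph. Adding the indicators on both sides avoids truncated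
  subtraction.\<close>

lemma deg_swap_edge:
  assumes "simple_graph K" "e \<in> edges K" "f \<in> [verts K]\<^bsup>2\<^esup>" "f \<notin> edges K - {e}"
  shows "deg (swap_edge K e f) x + (if x \<in> e then 1 else 0) = deg K x + (if x \<in> f then 1 else 0)"
  using deg_delete_edge[OF assms(1,2), of x]
    deg_delete_edge[OF simple_swap_edge[OF assms(1,3)], of f e x] delete_swap_edge[OF assms(4)]
  by simp

text \<open>The adjacent edges split into the star at \<open>x\<close> and the star at
  \<open>y\<close>; each star omits the edge \<open>xy\<close> itself, hence the 2.\<close>

lemma edge_degree_eq:
  assumes "simple_graph K" "{x, y} \<in> edges K"
  shows "edge_degree K {x, y} + 2 = deg K x + deg K y"
proof -
  have ne: "x \<noteq> y" using simple_edge_mem[OF assms] by simp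
  let ?A = "(\<lambda>z. {x, z}) ` (nb K x - {y})" and ?B = "(\<lambda>z. {y, z}) ` (nb K y - {x})"
  have "{f \<in> edges K. adjacent_edges {x, y} f} = ?A \<union> ?B"
  proof (intro equalityI subsetI)
    fix f assume "f \<in> {f \<in> edges K. adjacent_edges {x, y} f}"
    then have f: "f \<in> edges K" "f \<noteq> {x, y}" "f \<inter> {x, y} \<noteq> {}" by (auto simp: adjacent_edges_def)
    then obtain a b where "f = {a, b}" using assms(1) by (elim simple_edge)
    then show "f \<in> ?A \<union> ?B" using f by (auto simp: nb_def insert_commute image_iff)
  next
    fix f assume "f \<in> ?A \<union> ?B"
    then show "f \<in> {f \<in> edges K. adjacent_edges {x, y} f}"
      using ne simple_edge_mem(1)[OF assms(1)] by (auto simp: adjacent_edges_def nb_def doubleton_eq_iff)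
  qed
  moreover have "?A \<inter> ?B = {}" using ne by (auto simp: doubleton_eq_iff)
  moreover have "card ?A = card (nb K x - {y})" "card ?B = card (nb K y - {x})"
    by (auto intro!: card_image simp: inj_on_def doubleton_eq_iff)
  moreover have "y \<in> nb K x" "x \<in> nb K y" using assms(2) by (auto simp: nb_def insert_commute)
  moreover from this have "Suc (card (nb K x - {y})) = deg K x" "Suc (card (nb K y - {x})) = deg K y"
    using card_Suc_Diff1[OF finite_nb[OF assms(1)]] by (simp_all add: deg_def)
  moreover have "finite ?A" "finite ?B" using finite_nb[OF assms(1)] by simp_all
  ultimately show ?thesis
    unfolding edge_degree_def by (simp add: card_Un_disjoint)
qed

subsection \<open>Isomorphism invariance\<close>

definition iso_map :: "('v \<Rightarrow> 'w) \<Rightarrow> 'v ugraph \<Rightarrow> 'w ugraph \<Rightarrow> bool" where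
  "iso_map f G H \<longleftrightarrow> bij_betw f (verts G) (verts H) \<and> (\<lambda>e. f ` e) ` edges G = edges H"

lemma graph_iso_iff: "graph_iso G H \<longleftrightarrow> (\<exists>f. iso_map f G H)"
  by (simp add: graph_iso_def iso_map_def)

lemma iso_map_inj: "iso_map f G H \<Longrightarrow> inj_on f (verts G)"
  and iso_map_image: "iso_map f G H \<Longrightarrow> f ` verts G = verts H"
  by (auto simp: iso_map_def bij_betw_def)

lemma iso_map_edge: "iso_map f G H \<Longrightarrow> e \<in> edges G \<Longrightarrow> f ` e \<in> edges H"
  unfolding iso_map_def by blast

lemma iso_map_inj_edges:
  assumes "simple_graph G" "iso_map f G H"
  shows "inj_on ((`) f) (edges G)"
  using inj_on_image_Pow[OF iso_map_inj[OF assms(2)]] assms(1)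
  by (auto simp: simple_graph_def nsets_def elim!: inj_on_subset)

lemma iso_map_edge_iff:
  assumes "simple_graph G" "iso_map f G H" "e \<subseteq> verts G"
  shows "f ` e \<in> edges H \<longleftrightarrow> e \<in> edges G"
proof
  assume "f ` e \<in> edges H"
  then have "f ` e \<in> (\<lambda>e. f ` e) ` edges G" using assms(2) by (simp add: iso_map_def)
  then obtain e' where e': "e' \<in> edges G" "f ` e = f ` e'" by blast
  then have "e' \<subseteq> verts G" using assms(1) by (auto simp: simple_graph_def nsets_def)
  then have "e = e'"
    using inj_on_image_eq_iff[OF iso_map_inj[OF assms(2)]] assms(3) e'(2) by blast
  then show "e \<in> edges G" using e' by simp
qed (rule iso_map_edge[OF assms(2)])

lemma iso_map_nb:
  assumes "simple_graph G" "simple_graph H" "iso_map f G H" "x \<in> verts G"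
  shows "nb H (f x) = f ` nb G x"
proof (intro equalityI subsetI)
  fix y assume y: "y \<in> nb H (f x)"
  then have "y \<in> verts H" using nb_subset_verts[OF assms(2)] by blast
  then obtain z where z: "z \<in> verts G" "y = f z" using iso_map_image[OF assms(3)] by blast
  then have "f ` {x, z} \<in> edges H" using y by (simp add: nb_def)
  then show "y \<in> f ` nb G x"
    using iso_map_edge_iff[OF assms(1,3), of "{x, z}"] z assms(4) by (auto simp: nb_def)
next
  fix y assume "y \<in> f ` nb G x"
  then obtain z where z: "y = f z" "{x, z} \<in> edges G" by (auto simp: nb_def)
  then have "f ` {x, z} \<in> edges H" by (intro iso_map_edge[OF assms(3)])
  then show "y \<in> nb H (f x)" using z by (simp add: nb_def)
qed

lemma iso_map_deg:
  assumes "simple_graph G" "simple_graph H" "iso_map f G H" "x \<in> verts G"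
  shows "deg H (f x) = deg G x"
  unfolding deg_def iso_map_nb[OF assms]
  by (rule card_image, rule inj_on_subset[OF iso_map_inj[OF assms(3)] nb_subset_verts[OF assms(1)]])

lemma iso_map_leaves:
  assumes "simple_graph G" "simple_graph H" "iso_map f G H" "x \<in> verts G"
  shows "leaves H (f x) = f ` leaves G x"
  using iso_map_deg[OF assms(1-3)] nb_subset_verts[OF assms(1)]
  unfolding leaves_def iso_map_nb[OF assms] by fastforce

lemma iso_map_card_leaves:
  assumes "simple_graph G" "simple_graph H" "iso_map f G H" "x \<in> verts G"
  shows "card (leaves H (f x)) = card (leaves G x)"
  unfolding iso_map_leaves[OF assms]
  by (rule card_image, rule inj_on_subset[OF iso_map_inj[OF assms(3)]])
    (use nb_subset_verts[OF assms(1)] in \<open>auto simp: leaves_def\<close>)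

lemma iso_map_edge_degree:
  assumes "simple_graph G" "simple_graph H" "iso_map f G H" "e \<in> edges G"
  shows "edge_degree H (f ` e) = edge_degree G e"
proof -
  obtain x y where e: "e = {x, y}" "x \<in> verts G" "y \<in> verts G"
    using assms(1,4) by (elim simple_edge)
  have "f ` {x, y} \<in> edges H" using iso_map_edge[OF assms(3,4)] unfolding e(1) .
  then have "{f x, f y} \<in> edges H" by simp
  from edge_degree_eq[OF assms(2) this] edge_degree_eq[OF assms(1), of x y] assms(4) e
  show ?thesis using iso_map_deg[OF assms(1-3)] by simp
qed

lemma iso_map_delete_edge:
  assumes "simple_graph G" "iso_map f G H" "e \<in> edges G"
  shows "iso_map f (delete_edge G e) (delete_edge H (f ` e))"
proof -
  have "(`) f ` (edges G - {e}) = (`) f ` edges G - (`) f ` {e}"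
    using inj_on_image_set_diff[OF iso_map_inj_edges[OF assms(1,2)], of "edges G" "{e}"] assms(3)
    by auto
  then show ?thesis using assms(2) by (simp add: iso_map_def)
qed

lemma iso_map_da_ecard:
  assumes "simple_graph G" "simple_graph H" "iso_map f G H" "e \<in> edges G"
  shows "da_ecard H (f ` e) = da_ecard G e"
proof -
  have "graph_iso (delete_edge G e) (delete_edge H (f ` e))"
    using iso_map_delete_edge[OF assms(1,3,4)] graph_iso_iff by blast
  then have "unlabeled (delete_edge G e) = unlabeled (delete_edge H (f ` e))"
    using unlabeled_eq_iff[OF simple_delete_edge[OF assms(1)] simple_delete_edge[OF assms(2)]] by blast
  then show ?thesis using iso_map_edge_degree[OF assms] by (simp add: da_ecard_def)
qed

lemma iso_map_inv:
  assumes "simple_graph G" "iso_map f G H"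
  shows "iso_map (inv_into (verts G) f) H G"
proof -
  let ?g = "inv_into (verts G) f"
  have "?g ` f ` e = e" if "e \<in> edges G" for e
  proof (rule inv_into_image_cancel[OF iso_map_inj[OF assms(2)]])
    show "e \<subseteq> verts G" using assms(1) that by (auto simp: simple_graph_def nsets_def)
  qed
  moreover have "edges H = (`) f ` edges G" using assms(2) by (simp add: iso_map_def)
  ultimately have "(`) ?g ` edges H = edges G" by (simp add: image_image)
  then show ?thesis using assms(2) by (simp add: iso_map_def bij_betw_inv_into)
qed

lemma da_edeck_iso:
  assumes "simple_graph G" "simple_graph H" "graph_iso G H"
  shows "da_edeck G = da_edeck H"
proof -
  obtain f where f: "iso_map f G H" using assms(3) graph_iso_iff by blast
  have "mset_set (edges H) = image_mset ((`) f) (mset_set (edges G))"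
    using f iso_map_inj_edges[OF assms(1) f] by (simp add: iso_map_def image_mset_mset_set)
  then have "da_edeck H = image_mset (\<lambda>e. da_ecard H (f ` e)) (mset_set (edges G))"
    by (simp add: da_edeck_def image_mset.compositionality comp_def)
  also have "\<dots> = da_edeck G"
    unfolding da_edeck_def
    by (rule image_mset_cong) (use iso_map_da_ecard[OF assms(1,2) f] finite_edges[OF assms(1)] in auto)
  finally show ?thesis ..
qed

text \<open>An injection between finite edge sets of the same size is onto, so it is enough that
  edges go to edges.\<close>

lemma graph_isoI:
  assumes "simple_graph A" "simple_graph B" "card (edges A) = card (edges B)"
    and "inj_on f (verts A)" "f ` verts A = verts B"
    and "\<And>e. e \<in> edges A \<Longrightarrow> f ` e \<in> edges B"
  shows "iso_map f A B"
proof -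
  have "inj_on ((`) f) (edges A)"
    using inj_on_image_Pow[OF assms(4)] assms(1)
    by (auto simp: simple_graph_def nsets_def elim!: inj_on_subset)
  then have "card ((`) f ` edges A) = card (edges B)" using assms(3) by (simp add: card_image)
  then have "(`) f ` edges A = edges B"
    using assms(6) finite_edges[OF assms(2)] by (intro card_subset_eq) auto
  then show ?thesis using assms(4,5) by (simp add: iso_map_def bij_betw_def)
qed

lemma card_edges_swap_edge:
  assumes "simple_graph K" "e \<in> edges K" "f \<notin> edges K - {e}"
  shows "card (edges (swap_edge K e f)) = card (edges K)"
proof -
  have "finite (edges K - {e})" using finite_edges[OF assms(1)] by simp
  then show ?thesis
    using card_Suc_Diff1[OF finite_edges[OF assms(1)] assms(2)] assms(3) by simp
qed

text \<open>Without loops, vertices with equal neighbourhoods are not adjacent. So an edge meets at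
  most one of them, and the transposition only renames that end.\<close>

lemma iso_map_twins:
  assumes K: "simple_graph K" and tw: "nb K x = nb K y" and xy: "x \<in> verts K" "y \<in> verts K"
  shows "iso_map (transpose x y) K K"
proof (rule graph_isoI[OF K K refl])
  show "inj_on (transpose x y) (verts K)" by (rule inj_on_inverseI[of _ "transpose x y"]) simp
  show "transpose x y ` verts K = verts K" using xy by (simp add: transpose_image_eq)
  fix e assume e: "e \<in> edges K"
  have *: "{x, z} \<in> edges K \<longleftrightarrow> {y, z} \<in> edges K" for z
  proof -
    have "z \<in> nb K x \<longleftrightarrow> z \<in> nb K y" by (simp only: tw)
    then show ?thesis by (simp add: nb_def)
  qed
  have n: "{x, y} \<notin> edges K" using *[of y] simple_edge_mem(1)[OF K, of y y] by auto
  obtain a b where ab: "e = {a, b}" "a \<noteq> b" using K e by (rule simple_edge)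
  have "e \<noteq> {x, y}" using n e by blast
  then consider "x \<notin> e" "y \<notin> e" | z where "e = {x, z}" "z \<noteq> x" "z \<noteq> y" | z where "e = {y, z}" "z \<noteq> x" "z \<noteq> y"
    using ab by (cases "a = x"; cases "a = y"; cases "b = x"; cases "b = y") (auto simp: insert_commute)
  then show "transpose x y ` e \<in> edges K"
  proof cases
    case 1
    then have "transpose x y ` e = e" by (force simp: transpose_def image_iff)
    then show ?thesis using e by simp
  next
    case (2 z)
    then show ?thesis using e *[of z] by simp
  next
    case (3 z)
    then show ?thesis using e *[of z] by simp
  qed
qed

text \<open>The twins are taken in the graph without \<open>e\<close>, to which the new edge is then
  added: there either twin may serve as an end of the new edge.\<close>

lemma graph_iso_swap_twins:
  assumes G: "simple_graph G" "e \<in> edges G" and tw: "nb (delete_edge G e) x = nb (delete_edge G e) y"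
    and xy: "x \<in> verts G" "y \<in> verts G"
  shows "graph_iso (swap_edge G e f) (swap_edge G e (transpose x y ` f))"
proof -
  have "iso_map (transpose x y) (delete_edge G e) (delete_edge G e)"
    using iso_map_twins[OF simple_delete_edge[OF G(1)] tw] xy by simp
  then have "iso_map (transpose x y) (swap_edge G e f) (swap_edge G e (transpose x y ` f))"
    by (simp add: iso_map_def)
  then show ?thesis using graph_iso_iff by blast
qed

subsection \<open>Reconstruction numbers via shared edges\<close>

text \<open>The multiplicity of a card in the deck of \<open>G\<close> is ignored, so the
  cardinality is an upper bound for the size of a common sub-multiset of the two decks.\<close>

definition goods :: "'v ugraph \<Rightarrow> 'w ugraph \<Rightarrow> 'w set set" where
  "goods G H = {g \<in> edges H. da_ecard H g \<in> da_ecard G ` edges G}"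

lemma finite_goods: "simple_graph H \<Longrightarrow> finite (goods G H)"
  by (simp add: goods_def finite_edges)

lemma goods_iso:
  assumes "simple_graph H" "simple_graph K" "graph_iso H K"
  shows "card (goods G H) = card (goods G K)"
proof -
  obtain f where f: "iso_map f H K" using assms(3) graph_iso_iff by blast
  have "edges K = (`) f ` edges H" using f by (simp add: iso_map_def)
  then have "goods G K = {g' \<in> (`) f ` edges H. da_ecard K g' \<in> da_ecard G ` edges G}"
    by (simp add: goods_def)
  also have "\<dots> = (`) f ` {g \<in> edges H. da_ecard K (f ` g) \<in> da_ecard G ` edges G}" by blast
  also have "{g \<in> edges H. da_ecard K (f ` g) \<in> da_ecard G ` edges G} = goods G H"
    unfolding goods_def by (rule Collect_cong) (use iso_map_da_ecard[OF assms(1,2) f] in \<open>metis (full_types)\<close>)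
  finally have "goods G K = (`) f ` goods G H" .
  moreover have "inj_on ((`) f) (goods G H)"
    using iso_map_inj_edges[OF assms(1) f] by (rule inj_on_subset) (auto simp: goods_def)
  ultimately show ?thesis by (simp add: card_image)
qed

text \<open>A common sub-multiset of size M + 1 comes from M + 1 distinct edges of \<open>H\<close>,
  all of them in \<open>goods\<close>, against the bound. Conversely the parts of the single witness
  \<open>S\<close> refute every smaller number.\<close>

lemma adern_eqI:
  fixes G :: "'v ugraph" and K :: "'w ugraph"
  assumes G: "simple_graph G"
    and K: "simple_graph K" "\<not> graph_iso G K" "S \<subseteq># da_edeck G" "S \<subseteq># da_edeck K" "size S = M"
    and ub: "\<And>H :: nat ugraph. simple_graph H \<Longrightarrow> \<not> graph_iso G H \<Longrightarrow> card (goods G H) \<le> M"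
  shows "adern G = M + 1"
proof -
  obtain H :: "nat ugraph" where H: "simple_graph H" "graph_iso K H" using ex_nat_copy[OF K(1)] by blast
  have nH: "\<not> graph_iso G H" using K(2) graph_iso_trans graph_iso_sym[OF K(1) H(2)] by blast
  have SH: "S \<subseteq># da_edeck H" using da_edeck_iso[OF K(1) H] K(4) by simp
  show ?thesis
    unfolding adern_def
  proof (rule Least_equality)
    show "\<forall>S. S \<subseteq># da_edeck G \<and> size S = M + 1 \<longrightarrow>
      (\<forall>H :: nat ugraph. simple_graph H \<and> \<not> graph_iso G H \<longrightarrow> \<not> S \<subseteq># da_edeck H)"
    proof (intro allI impI notI, elim conjE)
      fix S and H :: "nat ugraph"
      assume S: "S \<subseteq># da_edeck G" "size S = M + 1" "S \<subseteq># da_edeck H" and H: "simple_graph H" "\<not> graph_iso G H"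
      obtain T where T: "S = image_mset (da_ecard H) T" "T \<subseteq># mset_set (edges H)"
      proof -
        obtain C where "image_mset (da_ecard H) (mset_set (edges H)) = S + C"
          using S(3) by (auto simp: da_edeck_def subset_mset.le_iff_add)
        then obtain B' C' where "mset_set (edges H) = B' + C'" "S = image_mset (da_ecard H) B'"
          by (auto dest!: image_mset_eq_plusD)
        then show thesis using that by simp
      qed
      have "set_mset T \<subseteq> goods G H"
      proof
        fix g assume g: "g \<in> set_mset T"
        then have "g \<in> edges H" using T(2) finite_edges[OF H(1)] mset_subset_eqD by fastforce
        moreover have "da_ecard H g \<in># da_edeck G" using g T(1) S(1) mset_subset_eqD by fastforce
        ultimately show "g \<in> goods G H" using finite_edges[OF G] by (auto simp: goods_def da_edeck_def)
      qed
      \<comment> \<open>Each edge of \<open>H\<close> is listed once before cards are taken, so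
        \<open>T\<close> has no repetitions and its size counts edges.\<close>
      moreover have "T = mset_set (set_mset T)"
      proof (rule multiset_eqI)
        fix x
        have "count T x \<le> count (mset_set (edges H)) x" using T(2) by (simp add: mset_subset_eq_count)
        then show "count T x = count (mset_set (set_mset T)) x"
          by (auto simp: count_mset_set' not_in_iff split: if_splits intro: le_antisym dest: count_greater_zero_iff[THEN iffD2])
      qed
      then have "size T = card (set_mset T)" by (metis size_mset_set)
      moreover have "size T = M + 1" using S(2) T(1) by simp
      ultimately have "M + 1 \<le> card (goods G H)"
        using card_mono[OF finite_goods[OF H(1)], of "set_mset T" G] by linarith
      then show False using ub[OF H] by simp
    qed
  next
    fix k assume k: "\<forall>S. S \<subseteq># da_edeck G \<and> size S = k \<longrightarrow>
      (\<forall>H :: nat ugraph. simple_graph H \<and> \<not> graph_iso G H \<longrightarrow> \<not> S \<subseteq># da_edeck H)"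
    show "M + 1 \<le> k"
    proof (rule ccontr)
      assume "\<not> M + 1 \<le> k"
      then have "k \<le> size S" using K(5) by simp
      moreover obtain xs where xs: "S = mset xs" using ex_mset by metis
      moreover have "mset xs = mset (take k xs) + mset (drop k xs)"
        unfolding mset_append[symmetric] by simp
      ultimately have "mset (take k xs) \<subseteq># S" "size (mset (take k xs)) = k" by simp_all
      then obtain S' where "S' \<subseteq># S" "size S' = k" by blast
      then show False using k H(1) nH SH K(3) subset_mset.order_trans by blast
    qed
  qed
qed

lemma common_subset_of_edges:
  assumes G: "simple_graph G" "simple_graph K"
    and es: "distinct es" "set es \<subseteq> edges G" and gs: "distinct gs" "set gs \<subseteq> edges K"
    and eq: "map (da_ecard G) es = map (da_ecard K) gs"
  obtains S where "S \<subseteq># da_edeck G" "S \<subseteq># da_edeck K" "size S = length es"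
proof
  have sub: "mset (map h xs) \<subseteq># image_mset h (mset_set X)" if "distinct xs" "set xs \<subseteq> X" "finite X"
    for h :: "'x \<Rightarrow> 'y" and xs X
  proof -
    have "mset (map h xs) = image_mset h (mset_set (set xs))" using that(1) by (simp add: mset_set_set)
    then show ?thesis using that(2,3) by (simp add: image_mset_subseteq_mono)
  qed
  show "mset (map (da_ecard G) es) \<subseteq># da_edeck G"
    unfolding da_edeck_def by (rule sub[OF es finite_edges[OF G(1)]])
  show "mset (map (da_ecard G) es) \<subseteq># da_edeck K"
    unfolding da_edeck_def eq by (rule sub[OF gs finite_edges[OF G(2)]])
  show "size (mset (map (da_ecard G) es)) = length es" by simp
qed

text \<open>The isomorphism of the two cards carries the pair \<open>g\<close> to a pair
  \<open>f\<close> of vertices of \<open>G\<close>, and adding \<open>f\<close> to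
  \<open>G - e\<close> rebuilds \<open>H\<close>. The case \<open>f = e\<close> is possible, which
  is why \<open>f\<close> is only kept away from the other edges.\<close>

lemma shared_card_swap_edge:
  fixes G :: "'v ugraph" and H :: "'w ugraph"
  assumes G: "simple_graph G" and H: "simple_graph H" and e: "e \<in> edges G" and g: "g \<in> edges H"
    and c: "da_ecard H g = da_ecard G e"
  obtains f where "f \<in> [verts G]\<^bsup>2\<^esup>" "f \<notin> edges G - {e}" "graph_iso (swap_edge G e f) H"
    "edge_degree (swap_edge G e f) f = edge_degree G e"
proof -
  have "unlabeled (delete_edge H g) = unlabeled (delete_edge G e)" and d: "edge_degree H g = edge_degree G e"
    using c by (simp_all add: da_ecard_def)
  then have "graph_iso (delete_edge H g) (delete_edge G e)"
    using unlabeled_eq_iff[OF simple_delete_edge[OF H] simple_delete_edge[OF G]] by blast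
  then obtain s where s: "iso_map s (delete_edge H g) (delete_edge G e)" using graph_iso_iff by blast
  obtain x y where xy: "g = {x, y}" "x \<noteq> y" "x \<in> verts H" "y \<in> verts H"
    using H g by (elim simple_edge)
  let ?f = "s ` g"
  have inj: "inj_on s (verts H)" using iso_map_inj[OF s] by simp
  have im: "s ` verts H = verts G" using iso_map_image[OF s] by simp
  have f2: "?f \<in> [verts G]\<^bsup>2\<^esup>"
    using xy im inj by (auto simp: nsets_def card_2_iff dest: inj_onD)
  have fn: "?f \<notin> edges G - {e}"
    using iso_map_edge_iff[OF simple_delete_edge[OF H] s, of g] xy by simp
  have iso: "iso_map s H (swap_edge G e ?f)"
    unfolding iso_map_def
  proof
    show "bij_betw s (verts H) (verts (swap_edge G e ?f))" using inj im by (simp add: bij_betw_def)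
    have "(`) s ` edges H = insert ?f ((`) s ` (edges H - {g}))" using g by blast
    then show "(`) s ` edges H = edges (swap_edge G e ?f)" using s by (simp add: iso_map_def)
  qed
  have sim: "simple_graph (swap_edge G e ?f)" using simple_swap_edge[OF G f2] .
  have "graph_iso (swap_edge G e ?f) H"
    by (rule graph_iso_sym[OF H]) (use iso graph_iso_iff in blast)
  then show ?thesis
    using that[OF f2 fn] iso_map_edge_degree[OF H sim iso g] d by simp
qed

subsection \<open>Connectivity and bridges\<close>

text \<open>Connectedness in terms of cuts instead of paths: a two-sided labelling that no edge
  crosses is constant. Bridge arguments then amount to changing a labelling at one vertex or
  combining two labellings.\<close>

definition conn :: "'v ugraph \<Rightarrow> bool" where
  "conn K \<longleftrightarrow> (\<forall>p. (\<forall>x y. {x, y} \<in> edges K \<longrightarrow> (p x \<longleftrightarrow> p y)) \<longrightarrow>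
     (\<forall>x \<in> verts K. \<forall>y \<in> verts K. p x \<longleftrightarrow> p y))"

lemma connD:
  assumes "conn K" "\<And>x y. {x, y} \<in> edges K \<Longrightarrow> p x \<Longrightarrow> p y" "x \<in> verts K" "y \<in> verts K" "p x"
  shows "p y"
  using assms unfolding conn_def by (metis insert_commute)

lemma conn_iso:
  assumes "iso_map f G H" "conn G"
  shows "conn H"
  unfolding conn_def
proof (intro allI impI ballI)
  fix p x y assume p: "\<forall>x y. {x, y} \<in> edges H \<longrightarrow> (p x \<longleftrightarrow> p y)" and xy: "x \<in> verts H" "y \<in> verts H"
  have "p (f a) \<longleftrightarrow> p (f b)" if "{a, b} \<in> edges G" for a b
  proof -
    have "f ` {a, b} \<in> edges H" by (rule iso_map_edge[OF assms(1) that])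
    then show ?thesis using p by simp
  qed
  then have "\<forall>a\<in>verts G. \<forall>b\<in>verts G. p (f a) \<longleftrightarrow> p (f b)"
    using assms(2)[unfolded conn_def, rule_format, of "\<lambda>a. p (f a)"] by blast
  moreover obtain a b where ab: "a \<in> verts G" "x = f a" "b \<in> verts G" "y = f b"
    using xy iso_map_image[OF assms(1)] by blast
  ultimately have "p (f a) \<longleftrightarrow> p (f b)" by blast
  then show "p x \<longleftrightarrow> p y" by (simp only: ab)
qed

text \<open>A vertex set grown along edges that leave it acquires one new edge with each new
  vertex.\<close>

lemma conn_card:
  assumes K: "simple_graph K" and c: "conn K"
  shows "card (verts K) \<le> card (edges K) + 1"
proof -
  have "\<exists>X F. X \<subseteq> verts K \<and> F \<subseteq> edges K \<and> card X = m + 1 \<and> card F = m \<and> \<Union>F \<subseteq> X"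
    if "m < card (verts K)" for m
    using that
  proof (induction m)
    case 0
    then obtain v where "v \<in> verts K" by (metis card.empty equals0I less_irrefl)
    then show ?case by (intro exI[of _ "{v}"] exI[of _ "{}"]) auto
  next
    case (Suc m)
    then obtain X F where XF: "X \<subseteq> verts K" "F \<subseteq> edges K" "card X = m + 1" "card F = m" "\<Union>F \<subseteq> X"
      by auto
    have fX: "finite X" "finite F"
      using XF finite_verts[OF K] finite_edges[OF K] by (auto intro: finite_subset)
    obtain x where x: "x \<in> X" using XF(3) by fastforce
    obtain y where y: "y \<in> verts K" "y \<notin> X"
      using XF Suc.prems by (metis Suc_eq_plus1 card_mono fX(1) leD subsetI)
    have "\<exists>a b. {a, b} \<in> edges K \<and> a \<in> X \<and> b \<notin> X"
      using connD[OF c, of "\<lambda>z. z \<in> X" x y] x y XF(1) by blast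
    then obtain a b where ab: "{a, b} \<in> edges K" "a \<in> X" "b \<notin> X" by blast
    have "b \<in> verts K" using simple_edge_mem[OF K ab(1)] by simp
    moreover have "{a, b} \<notin> F" using ab(3) XF(5) by auto
    ultimately show ?case
      using XF ab fX by (intro exI[of _ "insert b X"] exI[of _ "insert {a, b} F"]) auto
  qed
  note ex = this
  show ?thesis
  proof (cases "card (verts K) = 0")
    case False
    then obtain F where "F \<subseteq> edges K" "card F = card (verts K) - 1"
      using ex[of "card (verts K) - 1"] by auto
    then have "card (verts K) - 1 \<le> card (edges K)" using card_mono[OF finite_edges[OF K]] by metis
    then show ?thesis by linarith
  qed simp
qed

lemma not_connE:
  assumes "\<not> conn K"
  obtains p x y where "\<And>x y. {x, y} \<in> edges K \<Longrightarrow> p x \<longleftrightarrow> p y" "x \<in> verts K" "y \<in> verts K" "p x" "\<not> p y"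
proof -
  obtain p x y where p: "\<And>x y. {x, y} \<in> edges K \<longrightarrow> (p x \<longleftrightarrow> p y)" "x \<in> verts K" "y \<in> verts K" "p x \<noteq> p y"
    using assms unfolding conn_def by blast
  show ?thesis
  proof (cases "p x")
    case True
    then show ?thesis using that[of p x y] p by blast
  next
    case False
    then show ?thesis using that[of p y x] p by blast
  qed
qed

text \<open>Removing two of the edges at \<open>h\<close> leaves too few edges for a connected
  graph, so those two edges form a cut. Two such cuts with \<open>x1\<close> in common are
  intersected; only the edge to \<open>x1\<close> leaves the intersection, so it would be a
  bridge.\<close>

lemma three_non_bridges:
  assumes K: "simple_graph K" "card (edges K) = card (verts K)"
    and e: "x1 \<in> nb K h" "x2 \<in> nb K h" "x3 \<in> nb K h" "x1 \<noteq> x2" "x1 \<noteq> x3" "x2 \<noteq> x3"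
    and c: "conn (delete_edge K {h, x1})" "conn (delete_edge K {h, x2})" "conn (delete_edge K {h, x3})"
  shows False
proof -
  \<comment> \<open>The side of the cut is normalised to be the one without \<open>h\<close>. Both
    removed edges cross it, since putting back either of them alone restores connectedness.\<close>
  have cut: "\<exists>p. (\<forall>a b. {a, b} \<in> edges K \<longrightarrow> {a, b} \<noteq> {h, x1} \<longrightarrow> {a, b} \<noteq> {h, y} \<longrightarrow> (p a \<longleftrightarrow> p b)) \<and> p x1 \<and> p y \<and> \<not> p h"
    if y: "y \<in> nb K h" "x1 \<noteq> y" "conn (delete_edge K {h, y})" for y
  proof -
    let ?D = "delete_edge (delete_edge K {h, x1}) {h, y}"
    have E: "{h, x1} \<in> edges K" "{h, y} \<in> edges K" using e y by (auto simp: nb_def)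
    have V: "h \<in> verts K" "x1 \<in> verts K" "y \<in> verts K"
      using E simple_edge_mem[OF K(1)] by blast+
    have ne: "{h, x1} \<noteq> {h, y}" using y(2) by (auto simp: doubleton_eq_iff)
    have "card (edges ?D) + 2 = card (verts ?D)"
    proof -
      have "Suc (card (edges K - {{h, x1}})) = card (edges K)"
        by (rule card_Suc_Diff1[OF finite_edges[OF K(1)] E(1)])
      moreover have "Suc (card (edges K - {{h, x1}} - {{h, y}})) = card (edges K - {{h, x1}})"
        by (rule card_Suc_Diff1) (use finite_edges[OF K(1)] E(2) ne in auto)
      ultimately show ?thesis using K(2) by simp
    qed
    then have "\<not> conn ?D"
      using conn_card[of ?D] simple_delete_edge[OF simple_delete_edge[OF K(1)]] by fastforce
    then obtain p u w where p: "\<And>a b. {a, b} \<in> edges ?D \<Longrightarrow> p a \<longleftrightarrow> p b" "u \<in> verts ?D" "w \<in> verts ?D" "p u" "\<not> p w"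
      by (rule not_connE) blast
    have p': "p a \<longleftrightarrow> p b" if "{a, b} \<in> edges K" "{a, b} \<noteq> {h, x1}" "{a, b} \<noteq> {h, y}" for a b
      using p(1)[of a b] that by simp
    have 1: "p h \<noteq> p y"
    proof
      assume eq: "p h = p y"
      have "p b" if "{a, b} \<in> edges (delete_edge K {h, x1})" "p a" for a b
        using p'[of a b] that eq by (cases "{a, b} = {h, y}") (auto simp: doubleton_eq_iff)
      then have "p w" using connD[OF c(1), of p u w] p(2-4) by auto
      then show False using p(5) by simp
    qed
    have 2: "p h \<noteq> p x1"
    proof
      assume eq: "p h = p x1"
      have "p b" if "{a, b} \<in> edges (delete_edge K {h, y})" "p a" for a b
        using p'[of a b] that eq by (cases "{a, b} = {h, x1}") (auto simp: doubleton_eq_iff)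
      then have "p w" using connD[OF y(3), of p u w] p(2-4) by auto
      then show False using p(5) by simp
    qed
    show ?thesis
      by (rule exI[of _ "\<lambda>a. p a \<noteq> p h"]) (use p' 1 2 in auto)
  qed
  obtain p where p: "\<And>a b. {a, b} \<in> edges K \<Longrightarrow> {a, b} \<noteq> {h, x1} \<Longrightarrow> {a, b} \<noteq> {h, x2} \<Longrightarrow> p a \<longleftrightarrow> p b"
    "p x1" "p x2" "\<not> p h"
    using cut[OF e(2,4) c(2)] by blast
  obtain q where q: "\<And>a b. {a, b} \<in> edges K \<Longrightarrow> {a, b} \<noteq> {h, x1} \<Longrightarrow> {a, b} \<noteq> {h, x3} \<Longrightarrow> q a \<longleftrightarrow> q b"
    "q x1" "q x3" "\<not> q h"
    using cut[OF e(3,5) c(3)] by blast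
  have E: "{h, x1} \<in> edges K" "{h, x2} \<in> edges K" "{h, x3} \<in> edges K" using e by (auto simp: nb_def)
  have V: "h \<in> verts K" "x1 \<in> verts K"
    using E simple_edge_mem[OF K(1)] by blast+
  have q2: "\<not> q x2" using q(1)[OF E(2)] q(4) e by (auto simp: doubleton_eq_iff)
  have p3: "\<not> p x3" using p(1)[OF E(3)] p(4) e by (auto simp: doubleton_eq_iff)
  \<comment> \<open>The edge to \<open>x2\<close> does not cross the cut \<open>q\<close> and the
    edge to \<open>x3\<close> does not cross \<open>p\<close>, so neither leaves the intersection of
    the two sides.\<close>
  have "p b \<and> q b" if ab: "{a, b} \<in> edges (delete_edge K {h, x1})" "p a \<and> q a" for a b
  proof (cases "{a, b} = {h, x2} \<or> {a, b} = {h, x3}")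
    case True
    then have "a \<in> {h, x2, x3}" by (auto simp: doubleton_eq_iff)
    then show ?thesis using ab(2) p(4) q2 p3 by auto
  next
    case False
    then show ?thesis using p(1)[of a b] q(1)[of a b] ab by auto
  qed
  then have "p h \<and> q h"
    using connD[OF c(1), of "\<lambda>a. p a \<and> q a" x1 h] V p(2) q(2) by simp
  then show False using p(4) by simp
qed

lemma card_le_2I:
  assumes "finite A" "\<And>x y z. x \<in> A \<Longrightarrow> y \<in> A \<Longrightarrow> z \<in> A \<Longrightarrow> x \<noteq> y \<Longrightarrow> x \<noteq> z \<Longrightarrow> y \<noteq> z \<Longrightarrow> False"
  shows "card A \<le> 2"
proof (rule ccontr)
  assume "\<not> card A \<le> 2"
  then obtain B where B: "B \<subseteq> A" "card B = 3" using obtain_subset_with_card_n[of 3 A] by auto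
  then obtain x y z where "B = {x, y, z}" "x \<noteq> y" "x \<noteq> z" "y \<noteq> z" by (auto simp: card_3_iff)
  then show False using assms(2) B(1) by auto
qed

lemma card_non_bridges_le:
  assumes K: "simple_graph K" "card (edges K) = card (verts K)"
  shows "card {x \<in> nb K h. conn (delete_edge K {h, x})} \<le> 2"
  by (rule card_le_2I) (use three_non_bridges[OF K] finite_nb[OF K(1)] in auto)

lemma card_non_bridges_at_le:
  assumes K: "simple_graph K" "card (edges K) = card (verts K)"
  shows "card {g \<in> edges K. h \<in> g \<and> conn (delete_edge K g)} \<le> 2"
proof -
  have "{g \<in> edges K. h \<in> g \<and> conn (delete_edge K g)}
      \<subseteq> (\<lambda>x. {h, x}) ` {x \<in> nb K h. conn (delete_edge K {h, x})}"
  proof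
    fix g assume g: "g \<in> {g \<in> edges K. h \<in> g \<and> conn (delete_edge K g)}"
    then obtain x y where "g = {x, y}" using K(1) by (blast elim: simple_edge)
    then obtain z where "g = {h, z}" using g by auto
    then show "g \<in> (\<lambda>x. {h, x}) ` {x \<in> nb K h. conn (delete_edge K {h, x})}" using g by (auto simp: nb_def)
  qed
  from surj_card_le[OF _ this] show ?thesis
    using card_non_bridges_le[OF K, of h] finite_nb[OF K(1), of h] by fastforce
qed

text \<open>A cut of the graph without \<open>hx\<close> becomes a cut of the graph without
  \<open>xy\<close> when \<open>x\<close> is moved to the side of \<open>h\<close>, the only other
  neighbour of \<open>x\<close>.\<close>

lemma non_bridge_degree_two:
  assumes K: "simple_graph K" and x: "nb K x = {h, y}" "h \<noteq> y" and c: "conn (delete_edge K {x, y})"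
  shows "conn (delete_edge K {h, x})"
proof (rule ccontr)
  assume "\<not> conn (delete_edge K {h, x})"
  then obtain p u w where p: "\<And>a b. {a, b} \<in> edges (delete_edge K {h, x}) \<Longrightarrow> p a \<longleftrightarrow> p b"
    "u \<in> verts K" "w \<in> verts K" "p u" "\<not> p w"
    by (rule not_connE) (unfold verts_delete_edge, blast)
  have E: "{x, h} \<in> edges K" "{x, y} \<in> edges K" using x by (auto simp: nb_def)
  note m = simple_edge_mem[OF K E(1)] simple_edge_mem[OF K E(2)]
  have pxy: "p x \<longleftrightarrow> p y" using p(1)[of x y] E(2) m x(2) by (auto simp: doubleton_eq_iff)
  have p': "p a \<longleftrightarrow> p b" if "{a, b} \<in> edges K" "a \<noteq> x" "b \<noteq> x" for a b
    using p(1)[of a b] that by (auto simp: doubleton_eq_iff)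
  have out: "b = h \<or> b = y" if "{x, b} \<in> edges K" for b using that x by (auto simp: nb_def)
  define r where "r a = (if a = x then p h else p a)" for a
  have r: "r b" if ab: "{a, b} \<in> edges (delete_edge K {x, y})" "r a" for a b
  proof -
    have abK: "{a, b} \<in> edges K" "{a, b} \<noteq> {x, y}" using ab(1) by auto
    consider "a = x" | "b = x" "a \<noteq> x" | "a \<noteq> x" "b \<noteq> x" by blast
    then show ?thesis
    proof cases
      case 1
      then have "b = h" using out[of b] abK by auto
      then show ?thesis using 1 ab(2) m by (simp add: r_def)
    next
      case 2
      then have "a = h" using out[of a] abK by (auto simp: insert_commute)
      then show ?thesis using 2 ab(2) by (simp add: r_def)
    next
      case 3
      then show ?thesis using p'[OF abK(1)] ab(2) by (simp add: r_def)
    qed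
  qed
  have ruw: "r w" if "r u"
    by (rule connD[where p = r and x = u and y = w, OF c r]) (use p(2,3) that in simp_all)
  have rwu: "r u" if "r w"
    by (rule connD[where p = r and x = w and y = u, OF c r]) (use p(2,3) that in simp_all)
  have rhy: "r y" if "r h"
    by (rule connD[where p = r and x = h and y = y, OF c r]) (use m that in simp_all)
  have ryh: "r h" if "r y"
    by (rule connD[where p = r and x = y and y = h, OF c r]) (use m that in simp_all)
  show False
  proof (cases "p h = p x")
    case True
    then have "r a = p a" for a by (simp add: r_def)
    then show False using ruw p(4,5) by simp
  next
    case False
    have "r h = p h" "r y = p y" using m by (simp_all add: r_def)
    then show False using False pxy rhy ryh by blast
  qed
qed

text \<open>The edge \<open>hx\<close> survives in the card, so \<open>x\<close> can only have
  become a leaf by losing the one other edge that it had.\<close>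

lemma leaf_gained:
  assumes K: "simple_graph K" and g: "g \<in> edges K" and l: "x \<in> leaves (delete_edge K g) h" "x \<notin> leaves K h"
  obtains y where "g = {x, y}" "x \<in> nb K h" "nb K x = {h, y}" "h \<noteq> y" "deg K x = 2"
proof -
  have xn: "x \<in> nb K h" using l(1) by (auto simp: leaves_def nb_delete_edge)
  have x1: "deg (delete_edge K g) x = 1" using l(1) by (simp add: leaves_def)
  have "x \<in> g" using l xn deg_delete_edge[OF K g, of x] x1 by (auto simp: leaves_def split: if_splits)
  then obtain y where y: "g = {x, y}" using K g by (metis simple_edge doubleton_eq_iff insertE singletonD)
  have d2: "deg K x = 2" using deg_delete_edge[OF K g, of x] x1 y by simp
  have "{h, x} \<noteq> g" using l(1) by (auto simp: leaves_def nb_delete_edge)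
  then have hy: "h \<noteq> y" using y by (auto simp: insert_commute)
  have sub: "{h, y} \<subseteq> nb K x" using xn g y by (auto simp: nb_def insert_commute)
  have "nb K x = {h, y}"
    by (rule sym, rule card_subset_eq[OF finite_nb[OF K] sub]) (use d2 hy in \<open>simp add: deg_def\<close>)
  then show ?thesis using that y xn hy d2 by blast
qed

lemma leaf_gainedE:
  assumes K: "simple_graph K" and g: "g \<in> edges K"
    and l: "card (leaves K h) < card (leaves (delete_edge K g) h)"
  obtains x y where "g = {x, y}" "x \<in> nb K h" "nb K x = {h, y}" "h \<noteq> y" "deg K x = 2"
proof -
  have "\<not> leaves (delete_edge K g) h \<subseteq> leaves K h"
    using l card_mono[OF finite_leaves[OF K]] by (metis leD)
  then obtain x where "x \<in> leaves (delete_edge K g) h" "x \<notin> leaves K h" by blast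
  from leaf_gained[OF K g this] that show ?thesis by metis
qed

text \<open>Each new leaf at \<open>h\<close> is an end of the deleted edge; with two of them,
  \<open>g\<close> is the side opposite to \<open>h\<close> of a triangle.\<close>

lemma two_leaves_gainedE:
  assumes K: "simple_graph K" and g: "g \<in> edges K"
    and l: "card (leaves K h) + 2 \<le> card (leaves (delete_edge K g) h)"
  obtains x y where "g = {x, y}" "x \<noteq> y" "x \<in> nb K h" "y \<in> nb K h" "nb K x = {h, y}" "nb K y = {h, x}"
proof -
  let ?N = "leaves (delete_edge K g) h - leaves K h"
  have fin: "finite (leaves (delete_edge K g) h)" using finite_leaves[OF simple_delete_edge[OF K]] .
  have "card (leaves (delete_edge K g) h) \<le> card ?N + card (leaves K h)"
    using card_Un_le[of ?N "leaves K h"] card_mono[of "?N \<union> leaves K h" "leaves (delete_edge K g) h"]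
      fin finite_leaves[OF K] by fastforce
  then have "2 \<le> card ?N" using l by simp
  then obtain B where "B \<subseteq> ?N" "card B = 2" by (rule obtain_subset_with_card_n)
  then obtain x z where xz: "x \<in> ?N" "z \<in> ?N" "x \<noteq> z"
    by (auto simp: card_2_iff)
  obtain y where y: "g = {x, y}" "x \<in> nb K h" "nb K x = {h, y}"
    using leaf_gained[OF K g, of x h] xz by blast
  obtain y' where y': "g = {z, y'}" "z \<in> nb K h" "nb K z = {h, y'}"
    using leaf_gained[OF K g, of z h] xz by blast
  have "z = y" "y' = x" using y(1) y'(1) xz(3) by (auto simp: doubleton_eq_iff)
  then show ?thesis using that y y' xz(3) by metis
qed

text \<open>
  Deleting \<open>g\<close> creates a new leaf at \<open>h\<close> only if \<open>g\<close> is the second edge at a neighbour \<open>x\<close> of \<open>h\<close> of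
  degree 2; then \<open>g\<close> is a bridge iff \<open>hx\<close> is, and in a connected unicyclic graph at most two
  edges at \<open>h\<close> are not bridges.
\<close>

lemma card_leaf_gaining_non_bridges_le:
  assumes K: "simple_graph K" "card (edges K) = card (verts K)"
  shows "card {g \<in> edges K. conn (delete_edge K g) \<and> card (leaves K h) < card (leaves (delete_edge K g) h)} \<le> 2"
    (is "card ?F \<le> 2")
proof -
  let ?X = "{x \<in> nb K h. conn (delete_edge K {h, x})}"
  \<comment> \<open>The second neighbour of \<open>x\<close> is unique, so the edge \<open>g\<close>
    is a function of \<open>x\<close> and the bound on non-bridges at \<open>h\<close> carries over
    to these edges.\<close>
  let ?y = "\<lambda>x. SOME y. nb K x = {h, y} \<and> h \<noteq> y"
  have "?F \<subseteq> (\<lambda>x. {x, ?y x}) ` ?X"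
  proof
    fix g assume "g \<in> ?F"
    then have g: "g \<in> edges K" "conn (delete_edge K g)" "card (leaves K h) < card (leaves (delete_edge K g) h)"
      by auto
    obtain x y where xy: "g = {x, y}" "x \<in> nb K h" "nb K x = {h, y}" "h \<noteq> y"
      by (rule leaf_gainedE[OF K(1) g(1,3)])
    have "?y x = y" by (rule some_equality) (use xy in \<open>auto simp: doubleton_eq_iff\<close>)
    moreover have "conn (delete_edge K {h, x})"
      using non_bridge_degree_two[OF K(1) xy(3,4)] g(2) xy(1) by simp
    ultimately show "g \<in> (\<lambda>x. {x, ?y x}) ` ?X" using xy by force
  qed
  from surj_card_le[OF _ this] show ?thesis
    using card_non_bridges_le[OF K, of h] finite_nb[OF K(1), of h] by fastforce
qed

lemma graph_isoI_involution:
  assumes "simple_graph A" "simple_graph B" "card (edges A) = card (edges B)" "verts A = verts B"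
    and inv: "\<And>x. x \<in> verts A \<Longrightarrow> f x \<in> verts A" "\<And>x. x \<in> verts A \<Longrightarrow> f (f x) = x"
    and "\<And>e. e \<in> edges A \<Longrightarrow> f ` e \<in> edges B"
  shows "iso_map f A B"
proof (rule graph_isoI[OF assms(1-3) _ _ assms(7)])
  show "inj_on f (verts A)" by (rule inj_on_inverseI[of _ f]) (rule inv(2))
  show "f ` verts A = verts B"
    unfolding assms(4)[symmetric]
  proof (intro equalityI subsetI)
    fix x assume "x \<in> verts A"
    then have "x = f (f x)" "f x \<in> verts A" using inv by simp_all
    then show "x \<in> f ` verts A" by (rule image_eqI)
  qed (use inv(1) in auto)
qed

lemma iso_map_comp:
  assumes "iso_map s A B" "iso_map t B C"
  shows "iso_map (t \<circ> s) A C"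
proof -
  have "(`) (t \<circ> s) ` edges A = (`) t ` (`) s ` edges A" by (simp add: image_image image_comp)
  then show ?thesis using assms bij_betw_trans[of s "verts A" "verts B" t "verts C"]
    by (simp add: iso_map_def)
qed

lemma iso_map_id: "iso_map id A A"
  by (simp add: iso_map_def)

lemma da_ecard_eqE:
  assumes "simple_graph G" "simple_graph K" "da_ecard K g = da_ecard G e"
  obtains s where "iso_map s (delete_edge G e) (delete_edge K g)" "edge_degree K g = edge_degree G e"
proof -
  have "unlabeled (delete_edge G e) = unlabeled (delete_edge K g)" "edge_degree K g = edge_degree G e"
    using assms(3) by (simp_all add: da_ecard_def)
  then show thesis
    using that unlabeled_eq_iff[OF simple_delete_edge[OF assms(1)] simple_delete_edge[OF assms(2)]] graph_iso_iff
    by blast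
qed

subsection \<open>Walks\<close>

primrec walk :: "'v ugraph \<Rightarrow> nat \<Rightarrow> 'v \<Rightarrow> 'v \<Rightarrow> bool" where
  "walk K 0 x y \<longleftrightarrow> x = y"
| "walk K (Suc m) x y \<longleftrightarrow> (\<exists>z \<in> nb K x. walk K m z y)"

lemma walk_iso:
  assumes "simple_graph G" "simple_graph H" "iso_map f G H"
  shows "x \<in> verts G \<Longrightarrow> walk G m x y \<Longrightarrow> walk H m (f x) (f y)"
proof (induction m arbitrary: x)
  case (Suc m)
  then obtain z where z: "z \<in> nb G x" "walk G m z y" by auto
  then have "z \<in> verts G" using nb_subset_verts[OF assms(1)] by blast
  then have "walk H m (f z) (f y)" using Suc.IH z by simp
  moreover have "f z \<in> nb H (f x)" using iso_map_nb[OF assms Suc.prems(1)] z by simp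
  ultimately show ?case by auto
qed simp

text \<open>A function that grows by at most 1 along edges bounds distances from below; all lower
  bounds on distances are obtained in this way.\<close>

lemma walk_potential:
  fixes \<phi> :: "'v \<Rightarrow> int"
  assumes "\<And>x y. y \<in> nb K x \<Longrightarrow> \<phi> y \<le> \<phi> x + 1"
  shows "walk K m x y \<Longrightarrow> \<phi> y \<le> \<phi> x + int m"
proof (induction m arbitrary: x)
  case (Suc m)
  then obtain z where "z \<in> nb K x" "walk K m z y" by auto
  then show ?case using Suc.IH[of z] assms[of z x] by simp
qed simp

lemma walk_snoc:
  assumes "walk K m x y" "z \<in> nb K y"
  shows "walk K (Suc m) x z"
  using assms
proof (induction m arbitrary: x)
  case (Suc m)
  then obtain w where "w \<in> nb K x" "walk K m w y" by auto
  then show ?case using Suc.IH[of w] Suc.prems(2) by (metis walk.simps(2))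
qed auto

lemma walk_sym: "walk K m x y \<Longrightarrow> walk K m y x"
proof (induction m arbitrary: x)
  case (Suc m)
  then obtain z where "z \<in> nb K x" "walk K m y z" by auto
  then show ?case using walk_snoc[of K m y z x] nb_sym[of z K x] by blast
qed simp

lemma walk_along:
  assumes "\<And>i. i < m \<Longrightarrow> c (Suc i) \<in> nb K (c i)"
  shows "walk K m (c 0) (c m)"
  using assms
proof (induction m arbitrary: c)
  case (Suc m)
  have "walk K m (c (Suc 0)) (c (Suc m))"
    using Suc.IH[of "\<lambda>i. c (Suc i)"] Suc.prems by simp
  then show ?case using Suc.prems[of 0] by auto
qed simp

subsection \<open>The strong double broom with two paths\<close>

locale broom =
  fixes n L :: nat
  assumes n1: "1 \<le> n" and L2: "2 \<le> L"
begin

abbreviation G :: "broom_vertex ugraph" where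
  "G \<equiv> strong_double_broom n n 2 (Suc L)"

abbreviation pv :: "nat \<Rightarrow> nat \<Rightarrow> broom_vertex" where
  "pv \<equiv> path_vertex (Suc L)"

lemma pv_0 [simp]: "pv c 0 = EndU"
  and pv_L [simp]: "pv c L = EndV"
  and pv_Inner: "0 < i \<Longrightarrow> i < L \<Longrightarrow> pv c i = Inner c i"
  using L2 by (simp_all add: path_vertex_def)

lemma pv_cases:
  assumes "i \<le> L"
  obtains "i = 0" "pv c i = EndU" | "i = L" "pv c i = EndV" | "0 < i" "i < L" "pv c i = Inner c i"
proof -
  have "i = 0 \<or> i = L \<or> 0 < i \<and> i < L" using assms by auto
  then show thesis using that pv_Inner[of i c] by auto
qed

lemma pv_eq_iff:
  assumes "i \<le> L" "j \<le> L"
  shows "pv c i = pv d j \<longleftrightarrow> i = j \<and> (c = d \<or> i = 0 \<or> i = L)"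
  using L2 by (cases rule: pv_cases[OF assms(1), of c]; cases rule: pv_cases[OF assms(2), of d]) auto

lemma simple_G: "simple_graph G"
  by (rule simple_graph_strong_double_broom) (use L2 in auto)

lemma less_2: "c < (2 :: nat) \<longleftrightarrow> c = 0 \<or> c = 1"
  by auto

lemma verts_G: "verts G = {EndU, EndV} \<union> {Inner c i | c i. c < 2 \<and> 0 < i \<and> i < L}
    \<union> LeafU ` {..<n} \<union> LeafV ` {..<n}"
proof -
  have "{pv c i | c i. c < 2 \<and> i < Suc L} = {EndU, EndV} \<union> {Inner c i | c i. c < 2 \<and> 0 < i \<and> i < L}"
  proof (intro equalityI subsetI)
    fix x assume "x \<in> {pv c i | c i. c < 2 \<and> i < Suc L}"
    then obtain c i where ci: "x = pv c i" "c < 2" "i \<le> L" by auto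
    show "x \<in> {EndU, EndV} \<union> {Inner c i | c i. c < 2 \<and> 0 < i \<and> i < L}"
      by (rule pv_cases[OF ci(3), of c]) (use ci in auto)
  next
    fix x assume "x \<in> {EndU, EndV} \<union> {Inner c i | c i. c < 2 \<and> 0 < i \<and> i < L}"
    then have "\<exists>c i. x = pv c i \<and> c < 2 \<and> i < Suc L"
    proof (elim UnE insertE CollectE exE conjE)
      assume "x = EndU"
      then show ?thesis by (intro exI[of _ 0]) simp
    next
      assume "x = EndV"
      then show ?thesis by (intro exI[of _ 0] exI[of _ L]) simp
    next
      fix c i assume "x = Inner c i" "c < 2" "0 < i" "i < L"
      then show ?thesis by (intro exI[of _ c] exI[of _ i]) (simp add: pv_Inner)
    qed simp
    then show "x \<in> {pv c i | c i. c < 2 \<and> i < Suc L}" by blast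
  qed
  then show ?thesis by (simp add: strong_double_broom_def verts_def)
qed

lemma edges_G: "edges G = {{pv c i, pv c (Suc i)} | c i. c < 2 \<and> i < L}
    \<union> {{EndU, LeafU i} | i. i < n} \<union> {{EndV, LeafV i} | i. i < n}"
  by (simp add: strong_double_broom_def edges_def)

lemma path_edge: "c < 2 \<Longrightarrow> i < L \<Longrightarrow> {pv c i, pv c (Suc i)} \<in> edges G"
  by (auto simp: edges_G)

lemma path_edge_eq:
  assumes "{pv c i, pv c (Suc i)} = {pv d j, pv d (Suc j)}" "i < L" "j < L"
  shows "i = j" "c = d"
  using assms L2 pv_eq_iff[of i j c d] pv_eq_iff[of i "Suc j" c d] pv_eq_iff[of "Suc i" j c d]
    pv_eq_iff[of "Suc i" "Suc j" c d]
  by (simp_all add: doubleton_eq_iff) linarith+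

lemma edge_cases:
  assumes "e \<in> edges G"
  obtains c i where "e = {pv c i, pv c (Suc i)}" "c < 2" "i < L"
  | i where "e = {EndU, LeafU i}" "i < n"
  | i where "e = {EndV, LeafV i}" "i < n"
  using assms unfolding edges_G by blast

lemma vert_cases:
  assumes "x \<in> verts G"
  obtains "x = EndU" | "x = EndV" | c i where "x = Inner c i" "c < 2" "0 < i" "i < L"
  | i where "x = LeafU i" "i < n" | i where "x = LeafV i" "i < n"
  using assms unfolding verts_G by blast

lemma nb_iff_pv: "y \<in> nb G x \<longleftrightarrow>
    (\<exists>c i. c < 2 \<and> i < L \<and> (x = pv c i \<and> y = pv c (Suc i) \<or> y = pv c i \<and> x = pv c (Suc i)))
    \<or> (\<exists>i<n. x = EndU \<and> y = LeafU i \<or> y = EndU \<and> x = LeafU i \<or> x = EndV \<and> y = LeafV i \<or> y = EndV \<and> x = LeafV i)"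
  unfolding nb_def edges_G mem_Collect_eq Un_iff doubleton_eq_iff by blast

lemma pv_not_leaf: "pv c i \<noteq> LeafU j" "pv c i \<noteq> LeafV j" "LeafU j \<noteq> pv c i" "LeafV j \<noteq> pv c i"
  by (auto simp: path_vertex_def)

lemma pv_eq_EndU: "i \<le> L \<Longrightarrow> pv c i = EndU \<longleftrightarrow> i = 0"
  and pv_eq_EndV: "i \<le> L \<Longrightarrow> pv c i = EndV \<longleftrightarrow> i = L"
  and pv_eq_Inner: "i \<le> L \<Longrightarrow> pv c i = Inner d j \<longleftrightarrow> i = j \<and> c = d \<and> 0 < i \<and> i < L"
  using L2 by (auto simp: path_vertex_def)

lemma nb_LeafU: "i < n \<Longrightarrow> nb G (LeafU i) = {EndU}"
  by (auto simp: nb_iff_pv pv_not_leaf)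

lemma nb_LeafV: "i < n \<Longrightarrow> nb G (LeafV i) = {EndV}"
  by (auto simp: nb_iff_pv pv_not_leaf)

lemma nb_Inner:
  assumes "c < 2" "0 < i" "i < L"
  shows "nb G (Inner c i) = {pv c (i - 1), pv c (Suc i)}"
proof (intro equalityI subsetI)
  fix y assume "y \<in> nb G (Inner c i)"
  then have "\<exists>d j. d < 2 \<and> j < L \<and> (Inner c i = pv d j \<and> y = pv d (Suc j) \<or> y = pv d j \<and> Inner c i = pv d (Suc j))"
    by (auto simp: nb_iff_pv)
  then consider d j where "j < L" "pv d j = Inner c i" "y = pv d (Suc j)"
    | d j where "j < L" "y = pv d j" "pv d (Suc j) = Inner c i"
    by metis
  then show "y \<in> {pv c (i - 1), pv c (Suc i)}"
  proof cases
    case (1 d j)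
    then have "j = i" "d = c" using pv_eq_Inner[of j d c i] by simp_all
    then show ?thesis using 1 by simp
  next
    case (2 d j)
    then have "Suc j = i" "d = c" using pv_eq_Inner[of "Suc j" d c i] by simp_all
    then show ?thesis using 2 by auto
  qed
next
  fix y assume "y \<in> {pv c (i - 1), pv c (Suc i)}"
  then have "y = pv c (i - 1) \<and> Inner c i = pv c (Suc (i - 1)) \<or> Inner c i = pv c i \<and> y = pv c (Suc i)"
    using assms pv_Inner by auto
  moreover have "i - 1 < L" using assms by simp
  ultimately show "y \<in> nb G (Inner c i)"
    unfolding nb_iff_pv using assms by blast
qed

lemma nb_EndU: "nb G EndU = {Inner 0 1, Inner 1 1} \<union> LeafU ` {..<n}"
proof (intro equalityI subsetI)
  fix y assume "y \<in> nb G EndU"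
  then consider c i where "c < 2" "i < L" "EndU = pv c i \<and> y = pv c (Suc i) \<or> y = pv c i \<and> EndU = pv c (Suc i)"
    | i where "i < n" "y = LeafU i"
    by (auto simp: nb_iff_pv)
  then show "y \<in> {Inner 0 1, Inner 1 1} \<union> LeafU ` {..<n}"
  proof cases
    case (1 c i)
    then have "i = 0" "y = pv c (Suc 0)" using pv_eq_EndU[of i c] pv_eq_EndU[of "Suc i" c] by auto
    then show ?thesis using L2 1(1) by (auto simp: pv_Inner less_2)
  qed auto
next
  fix y assume "y \<in> {Inner 0 1, Inner 1 1} \<union> LeafU ` {..<n}"
  then consider c where "c < 2" "y = Inner c 1" | i where "i < n" "y = LeafU i" by auto
  then show "y \<in> nb G EndU"
  proof cases
    case (1 c)
    then have "EndU = pv c 0 \<and> y = pv c (Suc 0)" using L2 by (simp add: pv_Inner)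
    then show ?thesis unfolding nb_iff_pv using 1 L2 by (metis less_le_trans zero_less_numeral)
  qed (auto simp: nb_iff_pv)
qed

lemma nb_EndV: "nb G EndV = {Inner 0 (L - 1), Inner 1 (L - 1)} \<union> LeafV ` {..<n}"
proof (intro equalityI subsetI)
  fix y assume "y \<in> nb G EndV"
  then consider c i where "c < 2" "i < L" "EndV = pv c i \<and> y = pv c (Suc i) \<or> y = pv c i \<and> EndV = pv c (Suc i)"
    | i where "i < n" "y = LeafV i"
    by (auto simp: nb_iff_pv)
  then show "y \<in> {Inner 0 (L - 1), Inner 1 (L - 1)} \<union> LeafV ` {..<n}"
  proof cases
    case (1 c i)
    then have "i = L - 1" "y = pv c (L - 1)" using pv_eq_EndV[of i c] pv_eq_EndV[of "Suc i" c] by auto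
    then show ?thesis using L2 1(1) by (auto simp: pv_Inner less_2)
  qed auto
next
  fix y assume "y \<in> {Inner 0 (L - 1), Inner 1 (L - 1)} \<union> LeafV ` {..<n}"
  then consider c where "c < 2" "y = Inner c (L - 1)" | i where "i < n" "y = LeafV i" by auto
  then show "y \<in> nb G EndV"
  proof cases
    case (1 c)
    then have "y = pv c (L - 1) \<and> EndV = pv c (Suc (L - 1))" "L - 1 < L" using L2 by (simp_all add: pv_Inner)
    then show ?thesis unfolding nb_iff_pv using 1 by blast
  qed (auto simp: nb_iff_pv)
qed

lemmas nb_G = nb_EndU nb_EndV nb_Inner nb_LeafU nb_LeafV

lemma pv_in_verts: "c < 2 \<Longrightarrow> i \<le> L \<Longrightarrow> pv c i \<in> verts G"
  by (rule pv_cases[of i c]) (auto simp: verts_G)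

lemma deg_EndU: "deg G EndU = n + 2"
  unfolding deg_def nb_EndU by (subst card_Un_disjoint) (auto simp: card_image inj_on_def)

lemma deg_EndV: "deg G EndV = n + 2"
  unfolding deg_def nb_EndV by (subst card_Un_disjoint) (auto simp: card_image inj_on_def)

lemma deg_Inner: "c < 2 \<Longrightarrow> 0 < i \<Longrightarrow> i < L \<Longrightarrow> deg G (Inner c i) = 2"
  unfolding deg_def by (subst nb_Inner) (auto simp: card_2_iff pv_eq_iff)

lemma deg_LeafU: "i < n \<Longrightarrow> deg G (LeafU i) = 1"
  and deg_LeafV: "i < n \<Longrightarrow> deg G (LeafV i) = 1"
  by (simp_all add: deg_def nb_G)

lemmas deg_G = deg_EndU deg_EndV deg_Inner deg_LeafU deg_LeafV

text \<open>Both numbers are 2L + 2n. An edge exchange preserves the equality, which is what makes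
  the bounds on non-bridges applicable to every exchanged graph.\<close>

lemma card_edges_G: "card (edges G) = card (verts G)"
proof -
  let ?q = "\<lambda>(c, i). {pv c i, pv c (Suc i)}"
  let ?A = "?q ` ({..<2} \<times> {..<L})" and ?B = "(\<lambda>i. {EndU, LeafU i}) ` {..<n}" and ?C = "(\<lambda>i. {EndV, LeafV i}) ` {..<n}"
  let ?I = "(\<lambda>(c, i). Inner c i) ` ({..<2} \<times> {0<..<L})"
  have "inj_on ?q ({..<2} \<times> {..<L})" using path_edge_eq by (auto simp: inj_on_def)
  then have A: "card ?A = 2 * L" by (simp add: card_image)
  have B: "card ?B = n" by (subst card_image) (auto simp: inj_on_def doubleton_eq_iff)
  have C: "card ?C = n" by (subst card_image) (auto simp: inj_on_def doubleton_eq_iff)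
  have AU: "LeafU j \<notin> e" and AV: "LeafV j \<notin> e" if e: "e \<in> ?A" for e j
  proof -
    obtain c i where "e = {pv c i, pv c (Suc i)}" using e by auto
    then show "LeafU j \<notin> e" "LeafV j \<notin> e" by (simp_all add: pv_not_leaf)
  qed
  have "?A \<inter> ?B = {}" using AU by blast
  moreover have "?A \<inter> ?C = {}" using AV by blast
  moreover have "?B \<inter> ?C = {}" by (auto simp: doubleton_eq_iff)
  ultimately have "card (?A \<union> ?B \<union> ?C) = 2 * L + n + n"
    using A B C by (simp add: card_Un_disjoint Int_Un_distrib2)
  moreover have "edges G = ?A \<union> ?B \<union> ?C"
    unfolding edges_G by auto
  ultimately have E: "card (edges G) = 2 * L + n + n" by simp
  have I: "card ?I = 2 * (L - 1)" by (subst card_image) (auto simp: inj_on_def)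
  have "card ({EndU, EndV} \<union> ?I) = 2 + 2 * (L - 1)"
    using I by (subst card_Un_disjoint) auto
  then have "card ({EndU, EndV} \<union> ?I \<union> LeafU ` {..<n}) = 2 + 2 * (L - 1) + n"
    by (subst card_Un_disjoint) (auto simp: card_image inj_on_def)
  then have "card ({EndU, EndV} \<union> ?I \<union> LeafU ` {..<n} \<union> LeafV ` {..<n}) = 2 + 2 * (L - 1) + n + n"
    by (subst card_Un_disjoint) (auto simp: card_image inj_on_def)
  moreover have "{Inner c i | c i. c < 2 \<and> 0 < i \<and> i < L} = ?I" by auto
  ultimately have "card (verts G) = 2 + 2 * (L - 1) + n + n" unfolding verts_G by (simp only:)
  then show ?thesis using E L2 by simp
qed

end

context broom
begin

subsection \<open>Symmetries of the broom\<close>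

definition flip :: "broom_vertex \<Rightarrow> broom_vertex" where
  "flip x = (case x of EndU \<Rightarrow> EndV | EndV \<Rightarrow> EndU | Inner c i \<Rightarrow> Inner c (L - i)
    | LeafU i \<Rightarrow> LeafV i | LeafV i \<Rightarrow> LeafU i)"

definition swp :: "broom_vertex \<Rightarrow> broom_vertex" where
  "swp x = (case x of Inner c i \<Rightarrow> Inner (1 - c) i | y \<Rightarrow> y)"

lemma flip_simps [simp]: "flip EndU = EndV" "flip EndV = EndU" "flip (Inner c i) = Inner c (L - i)"
  "flip (LeafU i) = LeafV i" "flip (LeafV i) = LeafU i"
  by (simp_all add: flip_def)

lemma swp_simps [simp]: "swp EndU = EndU" "swp EndV = EndV" "swp (Inner c i) = Inner (1 - c) i"
  "swp (LeafU i) = LeafU i" "swp (LeafV i) = LeafV i"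
  by (simp_all add: swp_def)

lemma flip_pv: "i \<le> L \<Longrightarrow> flip (pv c i) = pv c (L - i)"
  by (rule pv_cases[of i c]) (auto simp: pv_Inner)

lemma swp_pv: "i \<le> L \<Longrightarrow> swp (pv c i) = pv (1 - c) i"
  by (rule pv_cases[of i c]) (auto simp: pv_Inner)

lemma iso_map_flip: "iso_map flip G G"
proof (rule graph_isoI_involution[OF simple_G simple_G refl refl])
  fix x assume x: "x \<in> verts G"
  show "flip x \<in> verts G" by (rule vert_cases[OF x]) (auto simp: verts_G)
  show "flip (flip x) = x" by (rule vert_cases[OF x]) auto
next
  fix e assume "e \<in> edges G"
  then show "flip ` e \<in> edges G"
  proof (cases rule: edge_cases)
    case (1 c i)
    then have "flip ` e = {pv c (L - Suc i), pv c (Suc (L - Suc i))}"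
      by (simp add: flip_pv Suc_diff_Suc insert_commute)
    then show ?thesis using path_edge[of c "L - Suc i"] 1 by simp
  qed (auto simp: edges_G)
qed

lemma iso_map_swp: "iso_map swp G G"
proof (rule graph_isoI_involution[OF simple_G simple_G refl refl])
  fix x assume x: "x \<in> verts G"
  show "swp x \<in> verts G" by (rule vert_cases[OF x]) (auto simp: verts_G)
  show "swp (swp x) = x" by (rule vert_cases[OF x]) auto
next
  fix e assume "e \<in> edges G"
  then show "swp ` e \<in> edges G"
  proof (cases rule: edge_cases)
    case (1 c i)
    then have "swp ` e = {pv (1 - c) i, pv (1 - c) (Suc i)}" by (simp add: swp_pv)
    then show ?thesis using path_edge[of "1 - c" i] 1 by simp
  qed (auto simp: edges_G)
qed

abbreviation eL :: "broom_vertex set" where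
  "eL \<equiv> {EndU, LeafU 0}"

definition ep :: "nat \<Rightarrow> broom_vertex set" where
  "ep j = {pv 0 j, pv 0 (Suc j)}"

lemma eL_edge: "eL \<in> edges G"
  using n1 by (auto simp: edges_G)

lemma ep_edge: "j \<le> L - 2 \<Longrightarrow> ep j \<in> edges G"
  unfolding ep_def by (rule path_edge) (use L2 in auto)

text \<open>Stopping at j = L - 2 keeps \<open>EndV\<close> off the representative; the last edge of
  a path is carried to \<open>ep 0\<close> by \<open>flip\<close>.\<close>

lemma edge_representative:
  assumes "e \<in> edges G"
  shows "\<exists>s. iso_map s G G \<and> (s ` e = eL \<or> (\<exists>j\<le>L - 2. s ` e = ep j))"
  using assms
proof (cases rule: edge_cases)
  case (1 c i)
  define s where "s = (if c = 0 then id else swp)"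
  have s: "iso_map s G G" by (simp add: s_def iso_map_id iso_map_swp)
  have se: "s ` e = {pv 0 i, pv 0 (Suc i)}"
    using 1 by (auto simp: s_def swp_pv less_2)
  show ?thesis
  proof (cases "i \<le> L - 2")
    case True
    then show ?thesis using s se by (auto simp: ep_def)
  next
    case False
    then have i: "L - i = Suc 0" "L - Suc i = 0" using 1 by simp_all
    have "(flip \<circ> s) ` e = flip ` s ` e" by (simp only: image_comp)
    also have "\<dots> = {pv 0 (L - i), pv 0 (L - Suc i)}" unfolding se using 1 by (simp add: flip_pv)
    finally have "(flip \<circ> s) ` e = {pv 0 (L - i), pv 0 (L - Suc i)}" .
    then have "(flip \<circ> s) ` e = ep 0" unfolding i ep_def by (simp add: insert_commute)
    then show ?thesis using iso_map_comp[OF s iso_map_flip] by blast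
  qed
next
  case (2 i)
  let ?t = "transpose (LeafU i) (LeafU 0)"
  have "iso_map ?t G G"
    by (rule iso_map_twins[OF simple_G]) (use 2 n1 in \<open>auto simp: nb_G verts_G\<close>)
  moreover have "?t ` e = eL" using 2 by simp
  ultimately show ?thesis by blast
next
  case (3 i)
  let ?t = "transpose (LeafU i) (LeafU 0)"
  have "iso_map ?t G G"
    by (rule iso_map_twins[OF simple_G]) (use 3 n1 in \<open>auto simp: nb_G verts_G\<close>)
  then have "iso_map (?t \<circ> flip) G G" by (rule iso_map_comp[OF iso_map_flip])
  moreover have "(?t \<circ> flip) ` e = eL" using 3 by simp
  ultimately show ?thesis by blast
qed

lemma da_ecard_representative:
  assumes "e \<in> edges G"
  shows "da_ecard G e = da_ecard G eL \<or> (\<exists>j\<le>L - 2. da_ecard G e = da_ecard G (ep j))"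
  using edge_representative[OF assms] iso_map_da_ecard[OF simple_G simple_G _ assms] by metis

lemma goods_cases:
  assumes "g \<in> goods G K"
  obtains "g \<in> edges K" "da_ecard K g = da_ecard G eL"
  | j where "g \<in> edges K" "j \<le> L - 2" "da_ecard K g = da_ecard G (ep j)"
proof -
  obtain e where "e \<in> edges G" "da_ecard K g = da_ecard G e" "g \<in> edges K"
    using assms by (auto simp: goods_def)
  then show thesis using da_ecard_representative[of e] that by auto
qed

text \<open>Leaf cards take precedence: a path edge is exchanged only if \<open>H\<close> shares no
  leaf card with \<open>G\<close>. In that case every shared card comes from a path edge of
  \<open>G\<close> and is connected.\<close>

lemma shared_card_reduction:
  fixes H :: "'w ugraph"
  assumes H: "simple_graph H" "goods G H \<noteq> {}"
  obtains e f where
    "e = eL \<or> (\<exists>j\<le>L - 2. e = ep j) \<and> (\<forall>g\<in>edges H. da_ecard H g \<noteq> da_ecard G eL)"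
    "f \<in> [verts G]\<^bsup>2\<^esup>" "f \<notin> edges G - {e}" "graph_iso (swap_edge G e f) H"
    "edge_degree (swap_edge G e f) f = edge_degree G e"
proof (cases "\<exists>g\<in>edges H. da_ecard H g = da_ecard G eL")
  case True
  then obtain g where "g \<in> edges H" "da_ecard H g = da_ecard G eL" by blast
  from shared_card_swap_edge[OF simple_G H(1) eL_edge this] that show thesis by metis
next
  case False
  obtain g where "g \<in> goods G H" using H(2) by blast
  then obtain j where "g \<in> edges H" "j \<le> L - 2" "da_ecard H g = da_ecard G (ep j)"
    by (rule goods_cases) (use False in blast)+
  then show thesis
    using shared_card_swap_edge[OF simple_G H(1) ep_edge, of j g] that False by metis
qed

subsection \<open>The da-ecards of the broom\<close>

text \<open>The isomorphism invariants of \<open>G - eL\<close> on which the counting relies, with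
  \<open>u\<close> and \<open>v\<close> in the roles of \<open>EndU\<close> and \<open>EndV\<close>.
  The last clause says that their distance is at least L.\<close>

definition leaf_profile :: "'w ugraph \<Rightarrow> 'w \<Rightarrow> 'w \<Rightarrow> bool" where
  "leaf_profile D u v \<longleftrightarrow> u \<in> verts D \<and> v \<in> verts D \<and> u \<noteq> v \<and> deg D u = n + 1 \<and> deg D v = n + 2
    \<and> (\<forall>x\<in>verts D - {u, v}. deg D x \<le> 2) \<and> (\<exists>x\<in>verts D. deg D x = 0)
    \<and> n - 1 \<le> card (leaves D u) \<and> n \<le> card (leaves D v) \<and> (\<forall>m<L. \<not> walk D m u v)"

text \<open>Isomorphism invariants of \<open>G - ep j\<close>. The clauses for L = 2 and L = 3
  record inner vertices that turn into leaves of an end. The second path stays whole, so the ends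
  have distance exactly L. For j = 0 the broken path hangs at \<open>v\<close>, and the vertices
  farthest from \<open>v\<close> are the leaves at \<open>u\<close>, at distance L + 1.\<close>

definition path_profile :: "nat \<Rightarrow> 'w ugraph \<Rightarrow> 'w \<Rightarrow> 'w \<Rightarrow> bool" where
  "path_profile j D u v \<longleftrightarrow> u \<in> verts D \<and> v \<in> verts D \<and> u \<noteq> v
    \<and> deg D u = (if j = 0 then n + 1 else n + 2) \<and> deg D v = n + 2
    \<and> (\<forall>x\<in>verts D - {u, v}. deg D x \<le> 2) \<and> (\<forall>x\<in>verts D. deg D x \<noteq> 0) \<and> conn D
    \<and> n \<le> card (leaves D u) \<and> n \<le> card (leaves D v)
    \<and> (L = 2 \<longrightarrow> n + 1 \<le> card (leaves D v))
    \<and> (L = 3 \<and> j \<noteq> 0 \<longrightarrow> n + 1 \<le> card (leaves D u) \<and> n + 1 \<le> card (leaves D v))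
    \<and> walk D L u v \<and> (\<forall>m<L. \<not> walk D m u v)
    \<and> (j = 0 \<longrightarrow> (\<forall>x\<in>verts D. \<exists>m\<le>L + 1. walk D m v x))"

lemma walk_iso_iff:
  assumes "simple_graph D" "simple_graph D'" "iso_map s D D'" "x \<in> verts D" "y \<in> verts D"
  shows "walk D' m (s x) (s y) \<longleftrightarrow> walk D m x y"
proof
  let ?t = "inv_into (verts D) s"
  have t: "?t (s x) = x" "?t (s y) = y" using iso_map_inj[OF assms(3)] assms(4,5) by simp_all
  have "s x \<in> verts D'" using iso_map_image[OF assms(3)] assms(4) by blast
  then show "walk D' m (s x) (s y) \<Longrightarrow> walk D m x y"
    using walk_iso[OF assms(2,1) iso_map_inv[OF assms(1,3)]] t by metis
qed (rule walk_iso[OF assms(1-4)])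

lemma iso_map_verts_Diff:
  assumes "iso_map s D D'" "x \<in> verts D' - {s u, s v}"
  obtains y where "y \<in> verts D - {u, v}" "x = s y"
  using assms iso_map_image[OF assms(1)] by blast

lemma leaf_profile_iso:
  assumes D: "simple_graph D" "simple_graph D'" "iso_map s D D'" and p: "leaf_profile D u v"
  shows "leaf_profile D' (s u) (s v)"
proof -
  have im: "s ` verts D = verts D'" and inj: "inj_on s (verts D)"
    using iso_map_image[OF D(3)] iso_map_inj[OF D(3)] .
  have u: "u \<in> verts D" and v: "v \<in> verts D" and uv: "u \<noteq> v" using p by (auto simp: leaf_profile_def)
  have "\<forall>x\<in>verts D' - {s u, s v}. deg D' x \<le> 2"
    using p iso_map_deg[OF D] by (auto simp: leaf_profile_def elim!: iso_map_verts_Diff[OF D(3)])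
  moreover have "\<exists>x\<in>verts D'. deg D' x = 0"
    using p iso_map_deg[OF D] im unfolding leaf_profile_def by force
  ultimately show ?thesis
    using p u v uv im inj iso_map_deg[OF D] iso_map_card_leaves[OF D] walk_iso_iff[OF D u v]
    unfolding leaf_profile_def by (auto dest: inj_onD)
qed

lemma path_profile_iso:
  assumes D: "simple_graph D" "simple_graph D'" "iso_map s D D'" and p: "path_profile j D u v"
  shows "path_profile j D' (s u) (s v)"
proof -
  have im: "s ` verts D = verts D'" and inj: "inj_on s (verts D)"
    using iso_map_image[OF D(3)] iso_map_inj[OF D(3)] .
  have u: "u \<in> verts D" and v: "v \<in> verts D" and uv: "u \<noteq> v" using p by (auto simp: path_profile_def)
  have "\<forall>x\<in>verts D' - {s u, s v}. deg D' x \<le> 2"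
    using p iso_map_deg[OF D] by (auto simp: path_profile_def elim!: iso_map_verts_Diff[OF D(3)])
  moreover have "\<forall>x\<in>verts D'. deg D' x \<noteq> 0"
    using p iso_map_deg[OF D] unfolding im[symmetric] path_profile_def by simp
  moreover have "\<forall>x\<in>verts D'. \<exists>m\<le>L + 1. walk D' m (s v) x" if "j = 0"
    using p that walk_iso[OF D v] unfolding im[symmetric] path_profile_def by blast
  moreover have "s u \<noteq> s v" using inj u v uv by (auto dest: inj_onD)
  moreover have "s u \<in> verts D'" "s v \<in> verts D'" using im u v by blast+
  moreover have "conn D'" using conn_iso[OF D(3)] p by (simp add: path_profile_def)
  ultimately show ?thesis
    using p iso_map_deg[OF D u] iso_map_deg[OF D v] iso_map_card_leaves[OF D u] iso_map_card_leaves[OF D v]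
      walk_iso_iff[OF D u v]
    unfolding path_profile_def by simp
qed

lemma nb_delete_iff: "y \<in> nb (delete_edge K e) x \<longleftrightarrow> y \<in> nb K x \<and> {x, y} \<noteq> e"
  by (simp add: nb_delete_edge)

lemma ep_mem:
  assumes "j \<le> L - 2"
  shows "EndU \<in> ep j \<longleftrightarrow> j = 0" "EndV \<notin> ep j" "Inner c i \<in> ep j \<longleftrightarrow> c = 0 \<and> 0 < i \<and> (i = j \<or> i = Suc j)"
    "LeafU i \<notin> ep j" "LeafV i \<notin> ep j"
proof -
  have j: "j \<le> L" "Suc j \<le> L" "Suc j < L" using assms L2 by auto
  show "EndU \<in> ep j \<longleftrightarrow> j = 0" using pv_eq_EndU[OF j(1), of 0] pv_eq_EndU[OF j(2), of 0] unfolding ep_def by auto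
  show "EndV \<notin> ep j" using pv_eq_EndV[OF j(1), of 0] pv_eq_EndV[OF j(2), of 0] j(3) unfolding ep_def by auto
  show "Inner c i \<in> ep j \<longleftrightarrow> c = 0 \<and> 0 < i \<and> (i = j \<or> i = Suc j)"
    using pv_eq_Inner[OF j(1), of 0 c i] pv_eq_Inner[OF j(2), of 0 c i] j(3) unfolding ep_def by auto
  show "LeafU i \<notin> ep j" "LeafV i \<notin> ep j" unfolding ep_def by (simp_all add: pv_not_leaf)
qed

lemma edge_degree_eL: "edge_degree G eL = n + 1"
  using edge_degree_eq[OF simple_G eL_edge] n1 by (simp add: deg_G)

lemma deg_pv: "c < 2 \<Longrightarrow> i \<le> L \<Longrightarrow> deg G (pv c i) = (if i = 0 \<or> i = L then n + 2 else 2)"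
  by (rule pv_cases[of i c]) (auto simp: deg_G)

lemma edge_degree_ep:
  assumes "j \<le> L - 2"
  shows "edge_degree G (ep j) = (if j = 0 then n + 2 else 2)"
proof -
  have "j \<noteq> L" "Suc j \<noteq> L" "j \<le> L" "Suc j \<le> L" using assms L2 by auto
  then show ?thesis
    using edge_degree_eq[OF simple_G ep_edge[OF assms, unfolded ep_def]] by (auto simp: deg_pv ep_def)
qed

text \<open>distance from \<open>EndU\<close>, except on the leaves\<close>

definition pot :: "broom_vertex \<Rightarrow> int" where
  "pot x = (case x of EndU \<Rightarrow> 0 | EndV \<Rightarrow> int L | Inner c i \<Rightarrow> int i | LeafU i \<Rightarrow> 0 | LeafV i \<Rightarrow> int L)"

lemma pot_pv: "i \<le> L \<Longrightarrow> pot (pv c i) = int i"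
  by (rule pv_cases[of i c]) (auto simp: pot_def)

lemma pot_nb: "y \<in> nb G x \<Longrightarrow> pot y \<le> pot x + 1"
  unfolding nb_iff_pv by (auto simp: pot_pv) (auto simp: pot_def)

lemma walk_EndU_EndV:
  assumes "walk (delete_edge G e) m EndU EndV"
  shows "L \<le> m"
proof -
  have "pot EndV \<le> pot EndU + int m"
    by (rule walk_potential[OF _ assms]) (auto simp: nb_delete_iff intro: pot_nb)
  then show ?thesis by (simp add: pot_def)
qed

lemma leaves_delete_EndU:
  assumes "i < n" "LeafU i \<notin> e" "e \<in> edges G"
  shows "LeafU i \<in> leaves (delete_edge G e) EndU"
  using assms deg_delete_edge[OF simple_G assms(3), of "LeafU i"]
  by (auto simp: leaves_def nb_delete_iff nb_EndU deg_G)

lemma leaves_delete_EndV: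
  assumes "i < n" "LeafV i \<notin> e" "e \<in> edges G"
  shows "LeafV i \<in> leaves (delete_edge G e) EndV"
  using assms deg_delete_edge[OF simple_G assms(3), of "LeafV i"]
  by (auto simp: leaves_def nb_delete_iff nb_EndV deg_G)

lemma leaf_profile_eL: "leaf_profile (delete_edge G eL) EndU EndV"
proof -
  let ?D = "delete_edge G eL"
  have d: "deg G x = deg ?D x + (if x \<in> eL then 1 else 0)" for x
    by (rule deg_delete_edge[OF simple_G eL_edge])
  have fin: "finite (leaves ?D x)" for x using finite_leaves[OF simple_delete_edge[OF simple_G]] .
  have "deg ?D x \<le> 2" if "x \<in> verts G - {EndU, EndV}" for x
  proof -
    from that have "x \<in> verts G" by simp
    then show ?thesis using d[of x] that by (cases rule: vert_cases) (auto simp: deg_G)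
  qed
  moreover have "LeafU 0 \<in> verts G" "deg ?D (LeafU 0) = 0"
    using d[of "LeafU 0"] n1 by (simp_all add: deg_G verts_G)
  moreover have "card (LeafU ` {1..<n}) \<le> card (leaves ?D EndU)"
    by (rule card_mono[OF fin]) (auto intro!: leaves_delete_EndU eL_edge)
  moreover have "card (LeafU ` {1..<n}) = n - 1" by (simp add: card_image inj_on_def)
  moreover have "card (LeafV ` {..<n}) \<le> card (leaves ?D EndV)"
    by (rule card_mono[OF fin]) (auto intro!: leaves_delete_EndV eL_edge)
  moreover have "card (LeafV ` {..<n}) = n" by (simp add: card_image inj_on_def)
  moreover have "\<forall>m<L. \<not> walk ?D m EndU EndV" using walk_EndU_EndV by fastforce
  ultimately show ?thesis
    unfolding leaf_profile_def using d[of EndU] d[of EndV] deg_G(1,2) by (auto simp: verts_G)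
qed

lemma nb_path: "c < 2 \<Longrightarrow> i < L \<Longrightarrow> pv c (Suc i) \<in> nb G (pv c i)"
  using path_edge by (simp add: nb_def)

lemma path_profile_ep:
  assumes j: "j \<le> L - 2"
  shows "path_profile j (delete_edge G (ep j)) EndU EndV"
proof -
  let ?D = "delete_edge G (ep j)"
  note E = ep_edge[OF j]
  have d: "deg G x = deg ?D x + (if x \<in> ep j then 1 else 0)" for x
    by (rule deg_delete_edge[OF simple_G E])
  have jL: "Suc j < L" using j L2 by simp
  have fin: "finite (leaves ?D x)" for x using finite_leaves[OF simple_delete_edge[OF simple_G]] .
  have dd: "deg ?D x \<le> 2 \<and> deg ?D x \<noteq> 0" if "x \<in> verts G - {EndU, EndV}" for x
  proof -
    from that have "x \<in> verts G" by simp
    then show ?thesis using d[of x] that ep_mem[OF j] by (cases rule: vert_cases) (auto simp: deg_G split: if_splits)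
  qed
  have dU: "deg ?D EndU = (if j = 0 then n + 1 else n + 2)" and dV: "deg ?D EndV = n + 2"
    using d[of EndU] d[of EndV] ep_mem[OF j] by (auto simp: deg_G)
  \<comment> \<open>The path with index 1 is untouched and joins the two ends by a walk of length L;
    the path with index 0 loses only its step \<open>j\<close>.\<close>
  have stepQ: "pv 1 (Suc i) \<in> nb ?D (pv 1 i)" if "i < L" for i
    using nb_path[of 1 i] path_edge_eq(2)[of 1 i 0 j] that jL by (auto simp: nb_delete_iff ep_def)
  have stepP: "pv 0 (Suc i) \<in> nb ?D (pv 0 i)" if "i < L" "i \<noteq> j" for i
    using nb_path[of 0 i] path_edge_eq(1)[of 0 i 0 j] that jL by (auto simp: nb_delete_iff ep_def)
  have stepU: "LeafU i \<in> nb ?D EndU" and stepV: "LeafV i \<in> nb ?D EndV" if "i < n" for i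
    using that leaves_delete_EndU[OF that _ E] leaves_delete_EndV[OF that _ E] ep_mem[OF j]
    by (auto simp: leaves_def)
  have cU: "n = card (LeafU ` {..<n})" and cV: "n = card (LeafV ` {..<n})"
    by (simp_all add: card_image inj_on_def)
  have subU: "LeafU ` {..<n} \<subseteq> leaves ?D EndU" and subV: "LeafV ` {..<n} \<subseteq> leaves ?D EndV"
    using leaves_delete_EndU leaves_delete_EndV E ep_mem[OF j] by auto
  have lU: "n \<le> card (leaves ?D EndU)" and lV: "n \<le> card (leaves ?D EndV)"
    using card_mono[OF fin subU] card_mono[OF fin subV] cU cV by simp_all
  have extraU: "Inner 0 1 \<in> leaves ?D EndU" if "j = 1"
  proof -
    have "pv 0 1 \<in> nb ?D (pv 0 0)" using stepP[of 0] that L2 by simp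
    moreover have "pv 0 1 = Inner 0 1" using L2 by (simp add: pv_Inner)
    ultimately show ?thesis using d[of "Inner 0 1"] ep_mem(3)[OF j, of 0 1] that jL by (simp add: leaves_def deg_G)
  qed
  have extraV: "Inner 0 (L - 1) \<in> leaves ?D EndV" if "Suc (Suc j) = L"
  proof -
    have "pv 0 (Suc (L - 1)) \<in> nb ?D (pv 0 (L - 1))" using stepP[of "L - 1"] that L2 by simp
    moreover have "pv 0 (L - 1) = Inner 0 (L - 1)" "Suc (L - 1) = L" using L2 by (simp_all add: pv_Inner)
    ultimately have "Inner 0 (L - 1) \<in> nb ?D EndV" by (simp add: nb_sym)
    then show ?thesis using d[of "Inner 0 (L - 1)"] ep_mem(3)[OF j, of 0 "L - 1"] that jL by (auto simp: leaves_def deg_G)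
  qed
  have lU': "n + 1 \<le> card (leaves ?D EndU)" if "j = 1"
  proof -
    have "insert (Inner 0 1) (LeafU ` {..<n}) \<subseteq> leaves ?D EndU" using extraU that subU by simp
    from card_mono[OF fin this] cU show ?thesis by (subst (asm) card_insert_disjoint) auto
  qed
  have lV': "n + 1 \<le> card (leaves ?D EndV)" if "Suc (Suc j) = L"
  proof -
    have "insert (Inner 0 (L - 1)) (LeafV ` {..<n}) \<subseteq> leaves ?D EndV" using extraV that subV by simp
    from card_mono[OF fin this] cV show ?thesis by (subst (asm) card_insert_disjoint) auto
  qed
  have wQ: "walk ?D (L - i) EndV (pv 1 i)" if "i \<le> L" for i
  proof -
    have "walk ?D (L - i) ((\<lambda>t. pv 1 (i + t)) 0) ((\<lambda>t. pv 1 (i + t)) (L - i))"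
      by (rule walk_along) (use stepQ in auto)
    then show ?thesis using that walk_sym[of ?D "L - i" "pv 1 i" EndV] by simp
  qed
  have wP: "walk ?D (L - i) EndV (pv 0 i)" if "i \<le> L" "j < i" for i
  proof -
    have "walk ?D (L - i) ((\<lambda>t. pv 0 (i + t)) 0) ((\<lambda>t. pv 0 (i + t)) (L - i))"
      by (rule walk_along) (use stepP that in auto)
    then show ?thesis using that walk_sym[of ?D "L - i" "pv 0 i" EndV] by simp
  qed
  have wUV: "walk ?D L EndU EndV" using wQ[of 0] walk_sym[of ?D L EndV EndU] by simp
  have reach: "\<exists>m\<le>L + 1. walk ?D m EndV x" if "j = 0" "x \<in> verts G" for x
    using that(2)
  proof (cases rule: vert_cases)
    case 1
    then show ?thesis using wUV walk_sym[of ?D L EndU EndV] by (intro exI[of _ L]) auto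
  next
    case 2
    then show ?thesis by (intro exI[of _ 0]) auto
  next
    case (3 c i)
    then consider "x = pv 0 i" | "x = pv 1 i" by (auto simp: less_2 pv_Inner)
    then show ?thesis
      using wP[of i] wQ[of i] 3 that(1) by cases (auto intro!: exI[of _ "L - i"])
  next
    case (4 i)
    then show ?thesis using walk_snoc[OF walk_sym[OF wUV], of "LeafU i"] stepU[of i]
      by (intro exI[of _ "L + 1"]) simp
  next
    case (5 i)
    then have "walk ?D (Suc 0) EndV x" using stepV[of i] by simp
    then show ?thesis using L2 by (intro exI[of _ "Suc 0"]) simp
  qed
  have "conn ?D"
    unfolding conn_def
  proof (intro allI impI ballI)
    fix p x y assume p: "\<forall>x y. {x, y} \<in> edges ?D \<longrightarrow> (p x \<longleftrightarrow> p y)" and xy: "x \<in> verts ?D" "y \<in> verts ?D"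
    have step: "p x \<longleftrightarrow> p y" if "y \<in> nb ?D x" for x y using p that unfolding nb_def by blast
    have pQ: "p (pv 1 i) \<longleftrightarrow> p EndU" if "i \<le> L" for i
      using that by (induction i) (use step[OF stepQ] in auto)
    have pV: "p EndV \<longleftrightarrow> p EndU" using pQ[of L] by simp
    have pP1: "p (pv 0 i) \<longleftrightarrow> p EndU" if "i \<le> j" for i
      using that by (induction i) (use step[OF stepP] jL in auto)
    \<comment> \<open>Beyond the gap the broken path is attached to \<open>EndV\<close> only, so the
      induction runs backwards from there.\<close>
    have pP2: "p (pv 0 (L - t)) \<longleftrightarrow> p EndV" if "t < L - j" for t
      using that
    proof (induction t)
      case (Suc t)
      have "p (pv 0 (L - Suc t)) \<longleftrightarrow> p (pv 0 (Suc (L - Suc t)))"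
        using step[OF stepP, of "L - Suc t"] Suc.prems by simp
      then show ?case using Suc by (simp add: Suc_diff_Suc)
    qed simp
    have pP: "p (pv 0 i) \<longleftrightarrow> p EndU" if "i \<le> L" for i
      using pP1[of i] pP2[of "L - i"] pV that by (cases "i \<le> j") auto
    have "p x \<longleftrightarrow> p EndU" if "x \<in> verts G" for x
      using that
    proof (cases rule: vert_cases)
      case (3 c i)
      then consider "x = pv 0 i" | "x = pv 1 i" by (auto simp: less_2 pv_Inner)
      then show ?thesis using pP[of i] pQ[of i] 3 by cases auto
    qed (use pV step[OF stepU] step[OF stepV] in auto)
    then show "p x \<longleftrightarrow> p y" using xy by simp
  qed
  moreover have "\<forall>m<L. \<not> walk ?D m EndU EndV" using walk_EndU_EndV by fastforce
  moreover have "L = 3 \<Longrightarrow> j \<noteq> 0 \<Longrightarrow> j = 1 \<and> Suc (Suc j) = L" "L = 2 \<Longrightarrow> Suc (Suc j) = L" using j by auto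
  moreover have "EndU \<in> verts G" "EndV \<in> verts G" by (simp_all add: verts_G)
  moreover have "\<forall>x\<in>verts G. deg ?D x \<noteq> 0"
  proof
    fix x assume "x \<in> verts G"
    then show "deg ?D x \<noteq> 0" using dd[of x] dU dV n1 by (cases "x \<in> {EndU, EndV}") auto
  qed
  ultimately show ?thesis
    unfolding path_profile_def using dd dU dV lU lV lU' lV' wUV reach by auto
qed

lemma leaf_card:
  assumes K: "simple_graph K" "g \<in> edges K" "da_ecard K g = da_ecard G eL"
  obtains u v where "leaf_profile (delete_edge K g) u v" "edge_degree K g = n + 1"
proof -
  obtain s where s: "iso_map s (delete_edge G eL) (delete_edge K g)" "edge_degree K g = edge_degree G eL"
    by (rule da_ecard_eqE[OF simple_G K(1,3)])
  show thesis
    using that leaf_profile_iso[OF simple_delete_edge[OF simple_G] simple_delete_edge[OF K(1)] s(1) leaf_profile_eL]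
      s(2) edge_degree_eL by simp
qed

lemma path_card:
  assumes K: "simple_graph K" "g \<in> edges K" "da_ecard K g = da_ecard G (ep j)" "j \<le> L - 2"
  obtains u v where "path_profile j (delete_edge K g) u v" "edge_degree K g = (if j = 0 then n + 2 else 2)"
proof -
  obtain s where s: "iso_map s (delete_edge G (ep j)) (delete_edge K g)" "edge_degree K g = edge_degree G (ep j)"
    by (rule da_ecard_eqE[OF simple_G K(1,3)])
  show thesis
    using that path_profile_iso[OF simple_delete_edge[OF simple_G] simple_delete_edge[OF K(1)] s(1) path_profile_ep[OF K(4)]]
      s(2) edge_degree_ep[OF K(4)] by simp
qed

end

subsection \<open>Exchanging one edge of the broom\<close>

text \<open>\<open>f_degree\<close> is the degree component of the shared da-ecard. The graph
  component needs no assumption, because removing \<open>f\<close> from the exchanged graph gives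
  \<open>G - e\<close>.\<close>

locale broom_exchange = broom +
  fixes e f :: "broom_vertex set"
  assumes e_edge: "e \<in> edges G" and f_pair: "f \<in> [verts G]\<^bsup>2\<^esup>" and f_new: "f \<notin> edges G - {e}"
    and f_degree: "edge_degree (swap_edge G e f) f = edge_degree G e"
begin

abbreviation K :: "broom_vertex ugraph" where
  "K \<equiv> swap_edge G e f"

lemma simple_K: "simple_graph K"
  by (rule simple_swap_edge[OF simple_G f_pair])

lemma card_K: "card (edges K) = card (verts K)"
  using card_edges_swap_edge[OF simple_G e_edge f_new] card_edges_G by simp

lemma deg_K: "deg K x + (if x \<in> e then 1 else 0) = deg G x + (if x \<in> f then 1 else 0)"
  by (rule deg_swap_edge[OF simple_G e_edge f_pair f_new])

lemma nb_K: "y \<in> nb K x \<longleftrightarrow> y \<in> nb G x \<and> {x, y} \<noteq> e \<or> {x, y} = f"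
  by (auto simp: nb_def)

lemma f_in_K: "f \<in> edges K"
  by simp

lemma f_obtain:
  obtains a b where "f = {a, b}" "a \<noteq> b" "a \<in> verts G" "b \<in> verts G"
    "deg K a + deg K b = edge_degree G e + 2"
proof -
  obtain a b where ab: "f = {a, b}" "a \<noteq> b" "a \<in> verts G" "b \<in> verts G"
    using simple_edge[OF simple_K f_in_K] by auto
  moreover have "deg K a + deg K b = edge_degree G e + 2"
    using edge_degree_eq[OF simple_K, of a b] f_in_K ab(1) f_degree by simp
  ultimately show thesis using that by blast
qed

lemma iso_if_eq: "f = e \<Longrightarrow> graph_iso G K"
proof -
  assume "f = e"
  then have "K = G" using e_edge by (intro ugraph_eqI) auto
  then show ?thesis by (simp add: graph_iso_refl)
qed

lemma iso_sym_G: "graph_iso K G \<Longrightarrow> graph_iso G K"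
  by (rule graph_iso_sym[OF simple_K])

lemma K_edge_obtain:
  assumes "g \<in> edges K"
  obtains x y where "g = {x, y}" "x \<noteq> y" "x \<in> verts G" "y \<in> verts G" "edge_degree K g + 2 = deg K x + deg K y"
proof -
  obtain x y where "g = {x, y}" "x \<noteq> y" "x \<in> verts G" "y \<in> verts G"
    using simple_edge[OF simple_K assms] by auto
  then show thesis using that edge_degree_eq[OF simple_K, of x y] assms by simp
qed

lemma deg_K_delete: "g \<in> edges K \<Longrightarrow> deg K x = deg (delete_edge K g) x + (if x \<in> g then 1 else 0)"
  by (rule deg_delete_edge[OF simple_K])

end

section \<open>Removing a path edge: branch vertices that lose leaves\<close>

locale broom_ep_exchange = broom_exchange +
  fixes j :: nat
  assumes j: "j \<le> L - 2" and e_def: "e = ep j"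
begin

text \<open>No vertex of \<open>G - e\<close> is isolated, so the ends of \<open>f\<close> have
  degree at least 2 in \<open>K\<close>. Hence \<open>f\<close> creates no leaf, and only ends of
  \<open>e\<close> can be leaves that were none before.\<close>

lemma deg_K_one:
  assumes "deg K y = 1" "y \<in> verts G"
  shows "y \<notin> f \<and> (y \<in> e \<or> (\<exists>i<n. y = LeafU i) \<or> (\<exists>i<n. y = LeafV i))"
  using assms(2)
proof (cases rule: vert_cases)
  case 1
  then show ?thesis using deg_K[of y] assms(1) n1 by (simp add: deg_G split: if_splits)
next
  case 2
  then show ?thesis using deg_K[of y] assms(1) n1 by (simp add: deg_G split: if_splits)
next
  case (3 c i)
  then have "deg G y = 2" by (simp add: deg_Inner)
  then show ?thesis using deg_K[of y] assms(1) by (simp split: if_splits)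
next
  case (4 i)
  then have "y \<notin> e" using ep_mem[OF j] by (simp add: e_def)
  then show ?thesis using deg_K[of y] assms(1) 4 by (auto simp: deg_G split: if_splits)
next
  case (5 i)
  then have "y \<notin> e" using ep_mem[OF j] by (simp add: e_def)
  then show ?thesis using deg_K[of y] assms(1) 5 by (auto simp: deg_G split: if_splits)
qed

lemma Inner_1_not_e: "Inner 1 i \<notin> e"
  using ep_mem(3)[OF j, of 1 i] by (simp add: e_def)

lemma leaves_EndV_subset:
  assumes "EndV \<notin> f" "EndV \<notin> e" "Inner 0 (L - 1) \<notin> e"
  shows "leaves K EndV \<subseteq> LeafV ` {..<n} - f"
proof
  fix y assume y: "y \<in> leaves K EndV"
  then have y: "y \<in> nb G EndV" "deg K y = 1" using assms(1) by (auto simp: leaves_def nb_K)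
  then have "y \<in> verts G" using nb_subset_verts[OF simple_G] by blast
  from deg_K_one[OF y(2) this] y(1) show "y \<in> LeafV ` {..<n} - f"
    using assms(3) Inner_1_not_e unfolding nb_EndV by auto
qed

lemma leaves_EndU_subset:
  assumes "EndU \<notin> f" "EndU \<notin> e" "Inner 0 1 \<notin> e"
  shows "leaves K EndU \<subseteq> LeafU ` {..<n} - f"
proof
  fix y assume y: "y \<in> leaves K EndU"
  then have y: "y \<in> nb G EndU" "deg K y = 1" using assms(1) by (auto simp: leaves_def nb_K)
  then have "y \<in> verts G" using nb_subset_verts[OF simple_G] by blast
  from deg_K_one[OF y(2) this] y(1) show "y \<in> LeafU ` {..<n} - f"
    using assms(3) Inner_1_not_e unfolding nb_EndU by auto
qed

lemma card_leaf_sets: "card (LeafU ` {..<n}) = n" "card (LeafV ` {..<n}) = n"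
  by (simp_all add: card_image inj_on_def)

lemma few_leaves:
  assumes "leaves K h \<subseteq> A - f" "finite A" "card A \<le> n" "x \<in> A" "x \<in> f"
  shows "card (leaves K h) < n"
proof -
  have "leaves K h \<subseteq> A - {x}" using assms by blast
  then have "card (leaves K h) \<le> card (A - {x})" using assms(2) by (intro card_mono) auto
  also have "\<dots> < card A" using assms(2,4) by (rule card_Diff1_less)
  finally show ?thesis using assms(3) by simp
qed

text \<open>An old leaf on \<open>f\<close> is lost, and nothing replaces it unless the neighbour of
  \<open>EndV\<close> on the broken path is an end of \<open>e\<close>.\<close>

lemma deficient_EndV:
  assumes "EndV \<notin> f" "EndV \<notin> e" "Inner 0 (L - 1) \<notin> e" "LeafV i \<in> f" "i < n"
  shows "deg K EndV = n + 2" "card (leaves K EndV) < n"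
  using few_leaves[OF leaves_EndV_subset[OF assms(1-3)], of "LeafV i"] assms card_leaf_sets deg_K[of EndV]
  by (simp_all add: deg_EndV)

lemma deficient_EndU:
  assumes "EndU \<notin> f" "EndU \<notin> e" "Inner 0 1 \<notin> e" "LeafU i \<in> f" "i < n"
  shows "deg K EndU = n + 2" "card (leaves K EndU) < n"
  using few_leaves[OF leaves_EndU_subset[OF assms(1-3)], of "LeafU i"] assms card_leaf_sets deg_K[of EndU]
  by (simp_all add: deg_EndU)

text \<open>For \<open>j = 1\<close> the vertex \<open>Inner 0 1\<close> is one more leaf at \<open>EndU\<close> after the deletion of \<open>e\<close>.\<close>

lemma deficient_EndU':
  assumes "j = 1" "EndU \<notin> f" "x \<in> f" "y \<in> f" "x \<noteq> y" "x \<in> A" "y \<in> A"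
    and A: "A = insert (Inner 0 1) (LeafU ` {..<n})"
  shows "deg K EndU = n + 2" "card (leaves K EndU) < n"
proof -
  have "EndU \<notin> e" using ep_mem(1)[OF j] assms(1) e_def by simp
  then show "deg K EndU = n + 2" using deg_K[of EndU] assms(2) by (simp add: deg_EndU)
  have "leaves K EndU \<subseteq> A - f"
  proof
    fix z assume z: "z \<in> leaves K EndU"
    then have z: "z \<in> nb G EndU" "deg K z = 1" using assms(2) by (auto simp: leaves_def nb_K)
    then have "z \<in> verts G" using nb_subset_verts[OF simple_G] by blast
    from deg_K_one[OF z(2) this] z(1) show "z \<in> A - f"
      using Inner_1_not_e unfolding nb_EndU A by auto
  qed
  then have "leaves K EndU \<subseteq> A - {x} - {y}" using assms(3,4) by blast
  then have "card (leaves K EndU) \<le> card (A - {x} - {y})" using A by (intro card_mono) auto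
  moreover have "card (A - {x} - {y}) < card (A - {x})" by (rule card_Diff1_less) (use assms in auto)
  moreover have "card (A - {x}) < card A" by (rule card_Diff1_less) (use assms in auto)
  moreover have "card A = n + 1" unfolding A by (subst card_insert_disjoint) (auto simp: card_leaf_sets)
  ultimately show "card (leaves K EndU) < n" by simp
qed

text \<open>Here \<open>Inner 0 (L - 1)\<close> supplies a spare leaf at \<open>EndV\<close>, so
  there are n + 1 candidates; \<open>f\<close> spoils two of them.\<close>

lemma deficient_EndV':
  assumes "Suc (Suc j) = L" "0 < j" "EndV \<notin> f" "x \<in> f" "y \<in> f" "x \<noteq> y" "x \<in> A" "y \<in> A"
    and A: "A = insert (Inner 0 (L - 1)) (LeafV ` {..<n})"
  shows "deg K EndV = n + 2" "card (leaves K EndV) < n"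
proof -
  have "EndV \<notin> e" using ep_mem(2)[OF j] e_def by simp
  then show "deg K EndV = n + 2" using deg_K[of EndV] assms(3) by (simp add: deg_EndV)
  have "leaves K EndV \<subseteq> A - f"
  proof
    fix z assume z: "z \<in> leaves K EndV"
    then have z: "z \<in> nb G EndV" "deg K z = 1" using assms(3) by (auto simp: leaves_def nb_K)
    then have "z \<in> verts G" using nb_subset_verts[OF simple_G] by blast
    from deg_K_one[OF z(2) this] z(1) show "z \<in> A - f"
      using Inner_1_not_e unfolding nb_EndV A by auto
  qed
  then have "leaves K EndV \<subseteq> A - {x} - {y}" using assms(4,5) by blast
  then have "card (leaves K EndV) \<le> card (A - {x} - {y})" using A by (intro card_mono) auto
  moreover have "card (A - {x} - {y}) < card (A - {x})" by (rule card_Diff1_less) (use assms in auto)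
  moreover have "card (A - {x}) < card A" by (rule card_Diff1_less) (use assms in auto)
  moreover have "card A = n + 1" unfolding A by (subst card_insert_disjoint) (auto simp: card_leaf_sets)
  ultimately show "card (leaves K EndV) < n" by simp
qed

end

section \<open>Removing a path edge: shared cards bounded by a deficient branch vertex\<close>

locale broom_path_exchange = broom_ep_exchange +
  assumes no_leaf: "\<And>g. g \<in> edges K \<Longrightarrow> da_ecard K g \<noteq> da_ecard G eL"
    and not_iso: "\<not> graph_iso G K"
begin

lemma f_ne_e: "f \<noteq> e"
  using iso_if_eq not_iso by blast

lemma goods_path:
  assumes "g \<in> goods G K"
  obtains j' u v where "g \<in> edges K" "path_profile j' (delete_edge K g) u v" "j' \<le> L - 2"
    "edge_degree K g = (if j' = 0 then n + 2 else 2)"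
  using assms
proof (cases rule: goods_cases)
  case (2 i)
  from path_card[OF simple_K 2(1,3,2)] that 2 show thesis by metis
qed (use no_leaf in blast)

text \<open>Only the two distinguished vertices of a path profile have degree above 2, and each of
  them has n leaves.\<close>

lemma hub_leaves:
  assumes "g \<in> goods G K" "h \<in> verts G" "3 \<le> deg (delete_edge K g) h"
  shows "n \<le> card (leaves (delete_edge K g) h)"
proof -
  obtain j' u v where p: "path_profile j' (delete_edge K g) u v" by (rule goods_path[OF assms(1)])
  have "deg (delete_edge K g) h \<le> 2" if "h \<notin> {u, v}"
    using p assms(2) that unfolding path_profile_def by simp
  then have "h \<in> {u, v}" using assms(3) by fastforce
  then show ?thesis using p unfolding path_profile_def by auto
qed

lemma goods_conn: "g \<in> goods G K \<Longrightarrow> g \<in> edges K \<and> conn (delete_edge K g)"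
  by (rule goods_path[of g]) (auto simp: path_profile_def)

text \<open>If the deleted edge misses \<open>h\<close>, then \<open>h\<close> is still a branch
  vertex of the card and must have gained a leaf: at most two non-bridges do this. At most two more
  non-bridges contain \<open>h\<close>.\<close>

lemma goods_le_4:
  assumes h: "h \<in> verts G" "3 \<le> deg K h" "card (leaves K h) < n"
  shows "card (goods G K) \<le> 4"
proof -
  let ?A = "{g \<in> edges K. conn (delete_edge K g) \<and> card (leaves K h) < card (leaves (delete_edge K g) h)}"
  let ?B = "{g \<in> edges K. h \<in> g \<and> conn (delete_edge K g)}"
  have "goods G K \<subseteq> ?A \<union> ?B"
  proof
    fix g assume g: "g \<in> goods G K"
    show "g \<in> ?A \<union> ?B"
    proof (cases "h \<in> g")
      case False
      then have "3 \<le> deg (delete_edge K g) h" using deg_K_delete[of g h] goods_conn[OF g] h(2) by simp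
      then show ?thesis using hub_leaves[OF g h(1)] h(3) goods_conn[OF g] by auto
    qed (use goods_conn[OF g] in auto)
  qed
  moreover have "finite (?A \<union> ?B)" using finite_edges[OF simple_K] by simp
  ultimately have "card (goods G K) \<le> card (?A \<union> ?B)" by (rule card_mono[rotated])
  also have "\<dots> \<le> card ?A + card ?B" by (rule card_Un_le)
  also have "\<dots> \<le> 4"
    using card_leaf_gaining_non_bridges_le[OF simple_K card_K, of h] card_non_bridges_at_le[OF simple_K card_K, of h]
    by linarith
  finally show ?thesis .
qed

text \<open>From degree 4 on, \<open>h\<close> remains a branch vertex even if the deleted edge
  contains it, so every shared card gains a leaf at \<open>h\<close>.\<close>

lemma goods_le_2:
  assumes h: "h \<in> verts G" "4 \<le> deg K h" "card (leaves K h) < n"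
  shows "card (goods G K) \<le> 2"
proof -
  let ?A = "{g \<in> edges K. conn (delete_edge K g) \<and> card (leaves K h) < card (leaves (delete_edge K g) h)}"
  have "goods G K \<subseteq> ?A"
  proof
    fix g assume g: "g \<in> goods G K"
    then have "3 \<le> deg (delete_edge K g) h"
      using deg_K_delete[of g h] goods_conn[OF g] h(2) by (simp split: if_splits)
    then show "g \<in> ?A" using hub_leaves[OF g h(1)] h(3) goods_conn[OF g] by auto
  qed
  then have "card (goods G K) \<le> card ?A" using finite_edges[OF simple_K] by (intro card_mono) auto
  then show ?thesis using card_leaf_gaining_non_bridges_le[OF simple_K card_K, of h] by linarith
qed

lemma nb_EndU_no_edge:
  assumes "3 \<le> L" "x \<in> nb G EndU" "y \<in> nb G EndU"
  shows "{x, y} \<notin> edges G"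
proof
  assume "{x, y} \<in> edges G"
  then have y: "y \<in> nb G x" by (simp add: nb_def)
  consider c where "c < 2" "x = Inner c 1" | i where "i < n" "x = LeafU i"
    using assms(2) by (auto simp: nb_EndU)
  then show False
  proof cases
    case (1 c)
    then have "y = EndU \<or> y = Inner c 2"
      using y nb_Inner[of c 1] assms(1) by (auto simp: pv_Inner numeral_2_eq_2)
    then show False using assms(3) by (auto simp: nb_EndU)
  next
    case (2 i)
    then show False using y assms(3) by (auto simp: nb_LeafU nb_EndU)
  qed
qed

lemma nb_EndV_no_edge:
  assumes "3 \<le> L" "x \<in> nb G EndV" "y \<in> nb G EndV"
  shows "{x, y} \<notin> edges G"
proof
  assume "{x, y} \<in> edges G"
  then have y: "y \<in> nb G x" by (simp add: nb_def)
  consider c where "c < 2" "x = Inner c (L - 1)" | i where "i < n" "x = LeafV i"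
    using assms(2) by (auto simp: nb_EndV)
  then show False
  proof cases
    case (1 c)
    then have "y = EndV \<or> y = Inner c (L - 2)"
      using y nb_Inner[of c "L - 1"] assms(1) by (auto simp: pv_Inner numeral_2_eq_2)
    moreover have "L - 2 \<noteq> L - 1" using assms(1) by simp
    ultimately show False using assms(3) by (auto simp: nb_EndV)
  next
    case (2 i)
    then show False using y assms(3) by (auto simp: nb_LeafV nb_EndV)
  qed
qed

text \<open>For L = 3 the neighbours of an end are pairwise non-adjacent, and the two ends have no
  common neighbour. Every shared edge other than \<open>f\<close> would contradict one of these two
  facts.\<close>

lemma goods_le_1:
  assumes L: "L = 3" and n: "3 \<le> n" and h: "h \<in> {EndU, EndV}" "h \<notin> f" "n + 2 \<le> deg K h" "card (leaves K h) < n"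
  shows "goods G K \<subseteq> {f}"
proof
  fix g assume g: "g \<in> goods G K"
  obtain j' u v where p: "g \<in> edges K" "path_profile j' (delete_edge K g) u v"
    "edge_degree K g = (if j' = 0 then n + 2 else 2)"
    by (rule goods_path[OF g])
  let ?h' = "if h = EndU then EndV else EndU"
  have hv: "h \<in> verts G" using h(1) by (auto simp: verts_G)
  have nbh: "nb K h \<subseteq> nb G h" using h(2) by (auto simp: nb_K)
  have d3: "3 \<le> deg (delete_edge K g) h"
    using deg_K_delete[OF p(1), of h] h(3) n by (simp split: if_splits)
  have "deg (delete_edge K g) h \<le> 2" if "h \<notin> {u, v}"
    using p(2) hv that unfolding path_profile_def by simp
  then have huv: "h \<in> {u, v}" using d3 by fastforce
  have inG: "g \<in> edges G" if "g \<noteq> f" using p(1) that by simp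
  show "g \<in> {f}"
  proof (rule ccontr)
    assume "g \<notin> {f}"
    then have gG: "g \<in> edges G" using inG by simp
    show False
    proof (cases "j' = 0")
      case False
      then have "n + 1 \<le> card (leaves (delete_edge K g) h)"
        using p(2) huv L unfolding path_profile_def by auto
      \<comment> \<open>The card of a middle edge has n + 1 leaves at both ends, so \<open>h\<close>
        gains two at once and the deleted edge joins two neighbours of \<open>h\<close>.\<close>
      then have "card (leaves K h) + 2 \<le> card (leaves (delete_edge K g) h)" using h(4) by simp
      then obtain x y where "g = {x, y}" "x \<in> nb K h" "y \<in> nb K h"
        by (rule two_leaves_gainedE[OF simple_K p(1)])
      then show False using nb_EndU_no_edge[of x y] nb_EndV_no_edge[of x y] nbh h(1) gG L by auto
    next
      case True
      have "card (leaves K h) < card (leaves (delete_edge K g) h)"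
        using hub_leaves[OF g hv d3] h(4) by simp
      then obtain x y where xy: "g = {x, y}" "x \<in> nb K h" "nb K x = {h, y}" "h \<noteq> y" "deg K x = 2"
        by (rule leaf_gainedE[OF simple_K p(1)])
      \<comment> \<open>The card of an end edge has degree n + 2. As \<open>x\<close> has degree 2,
        the degree of \<open>y\<close> is n + 2, at least 5, which only an end can reach; then
        \<open>x\<close> would be adjacent to both ends.\<close>
      have "deg K x + deg K y = n + 4"
        using edge_degree_eq[OF simple_K, of x y] p(1,3) xy(1) True by simp
      then have dy: "5 \<le> deg K y" using xy(5) n by simp
      have yv: "y \<in> verts G" using simple_edge_mem(3)[OF simple_K, of x y] p(1) xy(1) by simp
      have "y \<in> {EndU, EndV}"
        using yv dy deg_K[of y] by (cases rule: vert_cases) (auto simp: deg_G split: if_splits)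
      moreover have "x \<in> nb G h" using xy(2) nbh by blast
      moreover have "x \<in> nb G y" using gG xy(1) by (simp add: nb_def insert_commute)
      moreover have "1 \<noteq> L - 1" using L by simp
      then have "nb G EndU \<inter> nb G EndV = {}" by (auto simp: nb_EndU nb_EndV)
      ultimately show False using h(1) xy(4) by auto
    qed
  qed
qed

end

section \<open>Which new edges can replace a path edge\<close>

context broom_path_exchange
begin

text \<open>An inner path edge has edge degree 2, so the ends of \<open>f\<close> have degree sum 4
  in \<open>K\<close>. Each of them has degree at least 2, hence exactly 2, and degree 1 before
  \<open>f\<close> was added.\<close>

lemma f_vertices_inner_edge:
  assumes "0 < j" "x \<in> f"
  shows "(\<exists>i<n. x = LeafU i) \<or> (\<exists>i<n. x = LeafV i) \<or> x = Inner 0 j \<or> x = Inner 0 (Suc j)"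
proof -
  obtain a b where ab: "f = {a, b}" "a \<noteq> b" "a \<in> verts G" "b \<in> verts G" "deg K a + deg K b = edge_degree G e + 2"
    by (rule f_obtain)
  have sum: "deg K a + deg K b = 4" using ab(5) edge_degree_ep[OF j] assms(1) e_def by simp
  have ge: "2 \<le> deg K y" if "y \<in> verts G" "y \<in> f" for y
    using that deg_K[of y] ep_mem[OF j] assms(1) by (cases rule: vert_cases) (auto simp: deg_G e_def split: if_splits)
  have "deg K x = 2" "x \<in> verts G"
    using ge[of a] ge[of b] ab(1,3,4) sum assms(2) by auto
  then show ?thesis
    using deg_K[of x] ep_mem[OF j] assms
    by (cases rule: vert_cases[OF \<open>x \<in> verts G\<close>]) (auto simp: deg_G e_def split: if_splits)
qed

text \<open>Two successive twin exchanges in \<open>G - e\<close> move the ends of \<open>f\<close>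
  to the ends of \<open>e\<close>, which restores \<open>G\<close>.\<close>

lemma iso_by_twins:
  assumes f: "f = {x, y}" and e: "e = {p, q}"
    and x: "x = p \<or> x \<in> verts G \<and> p \<in> verts G \<and> nb (delete_edge G e) x = nb (delete_edge G e) p"
    and y: "y = q \<or> y \<in> verts G \<and> q \<in> verts G \<and> nb (delete_edge G e) y = nb (delete_edge G e) q"
    and ne: "y \<noteq> x" "y \<noteq> p" "p \<noteq> q"
  shows "graph_iso G K"
proof -
  have 1: "graph_iso K (swap_edge G e {p, y})"
  proof (cases "x = p")
    case False
    then have "graph_iso K (swap_edge G e (transpose x p ` f))"
      using x by (intro graph_iso_swap_twins[OF simple_G e_edge]) auto
    moreover have "transpose x p ` f = {p, y}" using ne by (simp add: f)
    ultimately show ?thesis by simp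
  qed (simp add: f graph_iso_refl)
  have 2: "graph_iso (swap_edge G e {p, y}) (swap_edge G e {p, q})"
  proof (cases "y = q")
    case False
    then have "graph_iso (swap_edge G e {p, y}) (swap_edge G e (transpose y q ` {p, y}))"
      using y by (intro graph_iso_swap_twins[OF simple_G e_edge]) auto
    moreover have "transpose y q ` {p, y} = {p, q}" using ne by simp
    ultimately show ?thesis by simp
  qed (simp add: graph_iso_refl)
  have "swap_edge G e {p, q} = G" using e e_edge by (intro ugraph_eqI) auto
  then show ?thesis using graph_iso_trans[OF 1 2] iso_sym_G by simp
qed

text \<open>If no end lacks leaves, then \<open>f\<close> uses one vertex from each side of the gap,
  namely an end of \<open>e\<close> or a leaf that is its twin in \<open>G - e\<close>. By
  \<open>iso_by_twins\<close> the graph is then \<open>G\<close> itself.\<close>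

lemma deficient_inner_edge:
  assumes "0 < j"
  shows "\<exists>h\<in>{EndU, EndV}. h \<notin> f \<and> deg K h = n + 2 \<and> card (leaves K h) < n"
proof (rule ccontr)
  assume neg: "\<not> ?thesis"
  have jL: "Suc j < L" using j assms L2 by simp
  note fv = f_vertices_inner_edge[OF assms]
  have Uf: "EndU \<notin> f" and Vf: "EndV \<notin> f" using fv by blast+
  have Ue: "EndU \<notin> e" and Ve: "EndV \<notin> e" using ep_mem[OF j] assms by (auto simp: e_def)
  \<comment> \<open>The ends that \<open>f\<close> may have on the side of \<open>EndU\<close>. A
    leaf there is harmless only if j = 1, when \<open>Inner 0 1\<close> is itself a leaf of
    \<open>EndU\<close> after the deletion and can replace it. \<open>?B\<close> is the same at
    \<open>EndV\<close>.\<close>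
  let ?A = "if j = 1 then insert (Inner 0 1) (LeafU ` {..<n}) else {Inner 0 j}"
  let ?B = "if Suc (Suc j) = L then insert (Inner 0 (L - 1)) (LeafV ` {..<n}) else {Inner 0 (Suc j)}"
  have e: "e = {Inner 0 j, Inner 0 (Suc j)}" using assms jL by (simp add: e_def ep_def pv_Inner)
  have "x \<in> ?A \<union> ?B" if x: "x \<in> f" for x
  proof -
    have "j = 1" if "x = LeafU i" "i < n" for i
    proof (rule ccontr)
      assume "j \<noteq> 1"
      then have "Inner 0 1 \<notin> e" using assms by (auto simp: e)
      then show False using deficient_EndU[OF Uf Ue _ _ that(2)] x that(1) neg Uf by blast
    qed
    moreover have "Suc (Suc j) = L" if "x = LeafV i" "i < n" for i
    proof (rule ccontr)
      assume "Suc (Suc j) \<noteq> L"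
      then have "Inner 0 (L - 1) \<notin> e" using jL by (auto simp: e)
      then show False using deficient_EndV[OF Vf Ve _ _ that(2)] x that(1) neg Vf by blast
    qed
    moreover have "Suc (Suc j) = L \<Longrightarrow> L - 1 = Suc j" by simp
    ultimately show ?thesis using fv[OF x] by auto
  qed
  then have sub: "f \<subseteq> ?A \<union> ?B" by blast
  \<comment> \<open>Two ends of \<open>f\<close> on the same side would spoil two of n + 1 leaves,
    which again leaves a deficient end.\<close>
  have A1: "x = y" if "x \<in> f \<inter> ?A" "y \<in> f \<inter> ?A" for x y
  proof (rule ccontr)
    assume "x \<noteq> y"
    then have "j = 1" using that by (auto split: if_splits)
    then show False using deficient_EndU'[OF _ Uf _ _ \<open>x \<noteq> y\<close> _ _ refl] that neg Uf by auto
  qed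
  have B1: "x = y" if "x \<in> f \<inter> ?B" "y \<in> f \<inter> ?B" for x y
  proof (rule ccontr)
    assume "x \<noteq> y"
    then have "Suc (Suc j) = L" using that by (auto split: if_splits)
    then show False using deficient_EndV'[OF _ assms Vf _ _ \<open>x \<noteq> y\<close> _ _ refl] that neg Vf by auto
  qed
  obtain a b where ab: "f = {a, b}" "a \<noteq> b" by (rule f_obtain)
  have "\<exists>x y. f = {x, y} \<and> x \<noteq> y \<and> x \<in> ?A \<and> y \<in> ?B"
  proof (cases "a \<in> ?A")
    case True
    then have "b \<in> ?B" using A1[of a b] ab sub by blast
    then show ?thesis using True ab by blast
  next
    case False
    then have "a \<in> ?B" using ab sub by blast
    moreover have "b \<in> ?A" using B1[of a b] calculation ab sub by blast
    ultimately show ?thesis using ab by (metis insert_commute)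
  qed
  then obtain x y where xy: "f = {x, y}" "x \<noteq> y" "x \<in> ?A" "y \<in> ?B" by blast
  have nbp: "nb (delete_edge G e) (Inner 0 1) = {EndU}" if "j = 1"
  proof -
    have "nb G (Inner 0 1) = {EndU, Inner 0 2}" using nb_Inner[of 0 1] that jL by (simp add: pv_Inner numeral_2_eq_2)
    moreover have "e = {Inner 0 1, Inner 0 2}" using e that by (simp add: numeral_2_eq_2)
    ultimately show ?thesis unfolding nb_delete_edge by (auto simp: doubleton_eq_iff)
  qed
  have nbq: "nb (delete_edge G e) (Inner 0 (L - 1)) = {EndV}" if "Suc (Suc j) = L"
  proof -
    have L': "L - 1 - 1 = j" "Suc (L - 1) = L" "0 < L - 1" "L - 1 < L" "L - 1 = Suc j"
      using that assms by linarith+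
    have "nb G (Inner 0 (L - 1)) = {pv 0 (L - 1 - 1), pv 0 (Suc (L - 1))}" using L'(3,4) by (simp add: nb_Inner)
    then have "nb G (Inner 0 (L - 1)) = {Inner 0 j, EndV}"
      unfolding L'(1,2) using assms jL by (simp add: pv_Inner)
    moreover have "e = {Inner 0 j, Inner 0 (L - 1)}" using e unfolding L'(5) .
    ultimately show ?thesis unfolding nb_delete_edge by (auto simp: doubleton_eq_iff)
  qed
  have nbu: "nb (delete_edge G e) (LeafU i) = {EndU}" if "i < n" for i
    using nb_LeafU[OF that] Ue unfolding nb_delete_edge by auto
  have nbv: "nb (delete_edge G e) (LeafV i) = {EndV}" if "i < n" for i
    using nb_LeafV[OF that] Ve unfolding nb_delete_edge by auto
  have inv: "Inner 0 j \<in> verts G" "Inner 0 (Suc j) \<in> verts G" "LeafU ` {..<n} \<subseteq> verts G" "LeafV ` {..<n} \<subseteq> verts G"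
    using assms jL by (auto simp: verts_G)
  have "graph_iso G K"
  proof (rule iso_by_twins[OF xy(1) e])
    show "x = Inner 0 j \<or> x \<in> verts G \<and> Inner 0 j \<in> verts G
        \<and> nb (delete_edge G e) x = nb (delete_edge G e) (Inner 0 j)"
    proof (cases "j = 1 \<and> x \<noteq> Inner 0 1")
      case True
      then obtain i where "x = LeafU i" "i < n" using xy(3) by auto
      then show ?thesis using nbp nbu True inv by auto
    qed (use xy(3) in \<open>auto split: if_splits\<close>)
    show "y = Inner 0 (Suc j) \<or> y \<in> verts G \<and> Inner 0 (Suc j) \<in> verts G
        \<and> nb (delete_edge G e) y = nb (delete_edge G e) (Inner 0 (Suc j))"
    proof (cases "Suc (Suc j) = L \<and> y \<noteq> Inner 0 (L - 1)")
      case True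
      then obtain i where "y = LeafV i" "i < n" using xy(4) by auto
      moreover have "L - 1 = Suc j" using True by linarith
      ultimately show ?thesis using nbq nbv True inv by auto
    next
      case False
      then show ?thesis using xy(4) by (auto split: if_splits)
    qed
    show "y \<noteq> x" using xy by blast
    show "y \<noteq> Inner 0 j" using xy(4) jL by (auto split: if_splits)
    show "Inner 0 j \<noteq> Inner 0 (Suc j)" by simp
  qed
  then show False using not_iso by simp
qed

text \<open>The degrees of the ends of \<open>f\<close> in \<open>G - e\<close> have sum n + 2.
  \<open>EndV\<close> already has degree n + 2 and would need an isolated partner.
  \<open>EndU\<close> has degree n + 1, and its partner of degree 1 can only be a leaf at
  \<open>EndV\<close>. Otherwise the sum is 2 + 2, so n = 2, or 2 + 1, so n = 1.\<close>

lemma f_end_edge: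
  assumes "j = 0"
  obtains i where "f = {EndU, LeafV i}" "i < n"
  | c i d k where "n = 2" "f = {Inner c i, Inner d k}" "Inner c i \<noteq> Inner d k" "c < 2" "0 < i" "i < L" "d < 2" "0 < k" "k < L"
      "Inner 0 1 \<notin> f"
  | c i where "n = 1" "f = {Inner 0 1, Inner c i}" "c < 2" "0 < i" "i < L" "Inner c i \<noteq> Inner 0 1"
  | c i where "n = 1" "f = {LeafU 0, Inner c i}" "c < 2" "0 < i" "i < L" "Inner c i \<noteq> Inner 0 1"
  | c i where "n = 1" "f = {LeafV 0, Inner c i}" "c < 2" "0 < i" "i < L" "Inner c i \<noteq> Inner 0 1"
proof -
  have e: "e = {EndU, Inner 0 1}" using assms L2 by (simp add: e_def ep_def pv_Inner)
  obtain a b where ab: "f = {a, b}" "a \<noteq> b" "a \<in> verts G" "b \<in> verts G" "deg K a + deg K b = edge_degree G e + 2"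
    by (rule f_obtain)
  have ne: "f \<noteq> {EndU, Inner 0 1}" using f_ne_e e by simp
  have nU: "f \<noteq> {EndU, LeafU i}" if "i < n" for i
  proof
    assume *: "f = {EndU, LeafU i}"
    then have "f \<in> edges G" using that by (auto simp: edges_G)
    moreover have "f \<noteq> e" by (rule f_ne_e)
    ultimately show False using f_new by simp
  qed
  have sum: "deg K a + deg K b = n + 4" using ab(5) edge_degree_ep[OF j] assms e_def by simp
  have nes: "\<not> (a = EndU \<and> b = Inner 0 1)" "\<not> (b = EndU \<and> a = Inner 0 1)"
    "\<And>i. i < n \<Longrightarrow> \<not> (a = EndU \<and> b = LeafU i)" "\<And>i. i < n \<Longrightarrow> \<not> (b = EndU \<and> a = LeafU i)"
    using ne nU ab(1) by (auto simp: insert_commute)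
  \<comment> \<open>The degree of \<open>x\<close> after the deletion of \<open>e\<close> and before
    the addition of \<open>f\<close>.\<close>
  define W where "W x = deg G x - (if x \<in> e then 1 else 0)" for x
  have W: "W EndU = n + 1" "W EndV = n + 2" "W (Inner 0 1) = 1"
    using e L2 by (simp_all add: W_def deg_G)
  have "deg G x = W x + (if x \<in> e then 1 else 0)" for x
    unfolding W_def using L2 by (auto simp: e deg_G)
  then have sumW: "W a + W b = n + 2"
    using sum deg_K[of a] deg_K[of b] ab(1) by simp
  define A where "A x \<longleftrightarrow> (\<exists>c i. x = Inner c i \<and> c < 2 \<and> 0 < i \<and> i < L \<and> Inner c i \<noteq> Inner 0 1)" for x
  define U where "U x \<longleftrightarrow> (\<exists>k<n. x = LeafU k)" for x
  define V where "V x \<longleftrightarrow> (\<exists>k<n. x = LeafV k)" for x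
  have cl: "A x \<and> W x = 2 \<or> (x = Inner 0 1 \<or> U x \<or> V x) \<and> W x = 1 \<or> x = EndU \<or> x = EndV"
    if "x \<in> verts G" for x
    using that
  proof (cases rule: vert_cases)
    case (3 c i)
    show ?thesis
    proof (cases "x = Inner 0 1")
      case False
      then have "A x" using 3 unfolding A_def by blast
      moreover have "x \<notin> e" using 3 False e by simp
      ultimately show ?thesis using 3 by (simp add: W_def deg_G)
    qed (use W in simp)
  next
    case (4 i)
    then have "U x" unfolding U_def by blast
    then show ?thesis using 4 by (simp add: W_def deg_G e)
  next
    case (5 i)
    then have "V x" unfolding V_def by blast
    then show ?thesis using 5 by (simp add: W_def deg_G e)
  qed simp_all
  have pos: "W x \<noteq> 0" if "x \<in> verts G" for x
    using cl[OF that] W by auto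
  have nV: "a \<noteq> EndV" "b \<noteq> EndV" using sumW W pos[OF ab(3)] pos[OF ab(4)] by auto
  have other: "V y" if "f = {EndU, y}" "y \<in> verts G" "W y = 1" for y
  proof -
    have "y \<noteq> EndV" "y \<noteq> EndU" using that(3) W n1 by auto
    moreover have "y \<noteq> Inner 0 1" "\<not> U y" using that(1) ne nU unfolding U_def by auto
    ultimately show ?thesis using cl[OF that(2)] that(3) by auto
  qed
  have "(\<exists>y. f = {EndU, y} \<and> V y) \<or> (A a \<or> A b) \<and> (n = 1 \<and> (a = Inner 0 1 \<or> U a \<or> V a \<or> b = Inner 0 1 \<or> U b \<or> V b) \<or> n = 2 \<and> A a \<and> A b)"
  proof (cases "a = EndU \<or> b = EndU")
    case True
    then have "f = {EndU, b} \<and> W b = 1 \<or> f = {EndU, a} \<and> W a = 1"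
      using ab(1) sumW W by (auto simp: insert_commute)
    then show ?thesis using other[of b] other[of a] ab(3,4) by blast
  next
    case False
    then have "A a \<and> W a = 2 \<or> (a = Inner 0 1 \<or> U a \<or> V a) \<and> W a = 1"
      "A b \<and> W b = 2 \<or> (b = Inner 0 1 \<or> U b \<or> V b) \<and> W b = 1"
      using cl[OF ab(3)] cl[OF ab(4)] nV by blast+
    then show ?thesis using sumW n1 by (elim disjE conjE) auto
  qed
  moreover have "\<not> (A x \<and> (x = Inner 0 1 \<or> U x \<or> V x))" for x unfolding A_def U_def V_def by auto
  moreover have "f = {b, a}" using ab(1) by (simp add: insert_commute)
  ultimately have "(\<exists>y. f = {EndU, y} \<and> V y) \<or>
      (\<exists>x y. f = {y, x} \<and> x \<noteq> y \<and> A x \<and> (n = 1 \<and> (y = Inner 0 1 \<or> U y \<or> V y) \<or> n = 2 \<and> A y))"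
    using ab(1,2) by blast
  then show thesis
  proof (elim disjE exE conjE)
    fix y assume "f = {EndU, y}" "V y"
    then show thesis using that(1) unfolding V_def by blast
  next
    fix x y assume *: "f = {y, x}" "n = 1" "A x" "y = Inner 0 1"
    then show thesis using that(3) unfolding A_def by blast
  next
    fix x y assume *: "f = {y, x}" "n = 1" "A x" "U y"
    then have "y = LeafU 0" unfolding U_def by auto
    then show thesis using * that(4) unfolding A_def by blast
  next
    fix x y assume *: "f = {y, x}" "n = 1" "A x" "V y"
    then have "y = LeafV 0" unfolding V_def by auto
    then show thesis using * that(5) unfolding A_def by blast
  next
    fix x y assume *: "f = {y, x}" "x \<noteq> y" "n = 2" "A x" "A y"
    then have "Inner 0 1 \<notin> f" unfolding A_def by auto
    moreover obtain c i where ci: "y = Inner c i" "c < 2" "0 < i" "i < L" using *(5) unfolding A_def by blast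
    moreover obtain d k where dk: "x = Inner d k" "d < 2" "0 < k" "k < L" using *(4) unfolding A_def by blast
    ultimately show thesis using that(2)[of c i d k] *(1-3) by auto
  qed
qed

end

section \<open>Removing a leaf edge: possible new edges and the cases n = 2 and n = 3\<close>

locale broom_leaf_exchange = broom_exchange +
  assumes e_leaf: "e = eL" and not_iso: "\<not> graph_iso G K"
begin

lemma f_ne_e: "f \<noteq> e"
  using iso_if_eq not_iso by blast

text \<open>The degrees of the ends of \<open>f\<close> in \<open>G - eL\<close> have sum n + 1.
  \<open>EndU\<close> could only be joined to the isolated \<open>LeafU 0\<close>, which is the
  removed edge again. All vertices other than the ends have degree at most 2 there, so n is at most
  3.\<close>

lemma f_leaf_edge:
  obtains c i where "n = 1" "f = {LeafU 0, Inner c i}" "c < 2" "0 < i" "i < L"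
  | c i where "n = 2" "f = {LeafU 1, Inner c i}" "c < 2" "0 < i" "i < L"
  | c i k where "n = 2" "f = {LeafV k, Inner c i}" "k < 2" "c < 2" "0 < i" "i < L"
  | c i d k where "n = 3" "f = {Inner c i, Inner d k}" "Inner c i \<noteq> Inner d k" "c < 2" "0 < i" "i < L" "d < 2" "0 < k" "k < L"
proof -
  obtain a b where ab: "f = {a, b}" "a \<noteq> b" "a \<in> verts G" "b \<in> verts G" "deg K a + deg K b = edge_degree G e + 2"
    by (rule f_obtain)
  have ne: "\<not> (a = EndU \<and> b = LeafU 0)" "\<not> (b = EndU \<and> a = LeafU 0)"
    using f_ne_e e_leaf ab(1) by (auto simp: insert_commute)
  have sum: "deg K a + deg K b = n + 3" using ab(5) edge_degree_eL e_leaf by simp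
  define W where "W x = deg G x - (if x \<in> eL then 1 else 0)" for x
  have W: "W EndU = n + 1" "W EndV = n + 2" "W (LeafU 0) = 0"
    using n1 by (simp_all add: W_def deg_G)
  have sumW: "W a + W b = n + 1"
  proof -
    have "deg G x = W x + (if x \<in> e then 1 else 0)" for x
      unfolding W_def e_leaf using n1 by (auto simp: deg_G)
    moreover have "a \<in> f" "b \<in> f" using ab(1) by simp_all
    ultimately show ?thesis using sum deg_K[of a] deg_K[of b] by simp
  qed
  define A where "A x \<longleftrightarrow> (\<exists>c i. x = Inner c i \<and> c < 2 \<and> 0 < i \<and> i < L)" for x
  define B where "B x \<longleftrightarrow> (\<exists>k. k < n \<and> (x = LeafU k \<and> k \<noteq> 0 \<or> x = LeafV k))" for x
  have cl: "A x \<and> W x = 2 \<or> x = LeafU 0 \<and> W x = 0 \<or> B x \<and> W x = 1 \<or> x = EndU \<or> x = EndV"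
    if "x \<in> verts G" for x
    using that
  proof (cases rule: vert_cases)
    case (3 c i)
    then have "A x" unfolding A_def by blast
    then show ?thesis using 3 by (simp add: W_def deg_G)
  next
    case (4 i)
    then have "i \<noteq> 0 \<Longrightarrow> B x" unfolding B_def by blast
    then show ?thesis using 4 W(3) by (cases "i = 0") (simp_all add: W_def deg_G)
  next
    case (5 i)
    then have "B x" unfolding B_def by blast
    then show ?thesis using 5 by (simp add: W_def deg_G)
  qed simp_all
  have pos: "W x = 0 \<Longrightarrow> x = LeafU 0" if "x \<in> verts G" for x
    using cl[OF that] W by auto
  have "a \<noteq> EndV" "b \<noteq> EndV" using sumW W by auto
  moreover have "a \<noteq> EndU" using sumW W pos[OF ab(4)] ne by auto
  moreover have "b \<noteq> EndU" using sumW W pos[OF ab(3)] ne by auto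
  ultimately have cla: "A a \<and> W a = 2 \<or> a = LeafU 0 \<and> W a = 0 \<or> B a \<and> W a = 1"
    and clb: "A b \<and> W b = 2 \<or> b = LeafU 0 \<and> W b = 0 \<or> B b \<and> W b = 1"
    using cl[OF ab(3)] cl[OF ab(4)] by blast+
  have B1: "x = LeafV 0" if "B x" "n = 1" for x using that unfolding B_def by auto
  have B2: "x = LeafU 1 \<or> (\<exists>k<2. x = LeafV k)" if "B x" "n = 2" for x
    using that unfolding B_def by (auto simp: less_2)
  have "(A a \<or> A b) \<and> (n = 1 \<and> (a = LeafU 0 \<or> b = LeafU 0) \<or> n = 2 \<and> (B a \<or> B b) \<or> n = 3 \<and> A a \<and> A b)"
    using cla
  proof (elim disjE conjE)
    assume a: "A a" "W a = 2"
    from clb a sumW show ?thesis by (elim disjE conjE) auto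
  next
    assume a: "a = LeafU 0" "W a = 0"
    from clb a sumW n1 show ?thesis by (elim disjE conjE) auto
  next
    assume a: "B a" "W a = 1"
    from clb show ?thesis
    proof (elim disjE conjE)
      assume b: "B b" "W b = 1"
      then have "n = 1" using sumW a by simp
      then show ?thesis using B1[OF a(1)] B1[OF b(1)] ab(2) by simp
    qed (use a sumW n1 in auto)
  qed
  moreover have "\<not> (A x \<and> B x)" "\<not> A (LeafU 0)" for x unfolding A_def B_def by auto
  moreover have "f = {b, a}" using ab(1) by (simp add: insert_commute)
  ultimately obtain x y where xy: "f = {y, x}" "x \<noteq> y" "A x" "n = 1 \<and> y = LeafU 0 \<or> n = 2 \<and> B y \<or> n = 3 \<and> A y"
    using ab(1,2) by blast
  then have y: "n = 1 \<and> y = LeafU 0 \<or> n = 2 \<and> y = LeafU 1 \<or> n = 2 \<and> (\<exists>k<2. y = LeafV k)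
          \<or> n = 3 \<and> (\<exists>d k. y = Inner d k \<and> d < 2 \<and> 0 < k \<and> k < L)"
    using B2[of y] unfolding A_def by blast
  obtain c i where ci: "x = Inner c i" "c < 2" "0 < i" "i < L" using xy(3) unfolding A_def by blast
  from y show thesis
  proof (elim disjE exE conjE)
    fix d k assume "n = 3" "y = Inner d k" "d < 2" "0 < k" "k < L"
    then show thesis using that(4)[of d k c i] xy(1,2) ci by auto
  next
    fix k assume "n = 2" "k < 2" "y = LeafV k"
    then show thesis using that(3)[of k c i] xy(1) ci by auto
  qed (use that(1,2)[of c i] xy(1) ci in auto)
qed

text \<open>For n at least 2 the new edge avoids \<open>LeafU 0\<close>, which stays isolated in
  \<open>K\<close> and in all its cards. A card of a path edge has no isolated vertex.\<close>

lemma goods_leaf: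
  assumes g: "g \<in> goods G K" and n: "2 \<le> n"
  obtains u v where "g \<in> edges K" "leaf_profile (delete_edge K g) u v" "edge_degree K g = n + 1"
  using g
proof (cases rule: goods_cases)
  case 1
  from leaf_card[OF simple_K 1] that 1 show thesis by metis
next
  case (2 i)
  obtain u v where p: "path_profile i (delete_edge K g) u v"
    using path_card[OF simple_K 2(1,3,2)] by metis
  have "LeafU 0 \<notin> f" by (rule f_leaf_edge) (use n in auto)
  then have "deg K (LeafU 0) = 0" using deg_K[of "LeafU 0"] n1 e_leaf by (simp add: deg_G)
  then have "deg (delete_edge K g) (LeafU 0) = 0" using deg_K_delete[OF 2(1), of "LeafU 0"] by simp
  moreover have "LeafU 0 \<in> verts (delete_edge K g)" using n1 by (simp add: verts_G)
  ultimately show thesis using p unfolding path_profile_def by blast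
qed

lemma degs:
  "deg K EndU + 1 = n + 2 + (if EndU \<in> f then 1 else 0)"
  "deg K EndV = n + 2 + (if EndV \<in> f then 1 else 0)"
  "c < 2 \<Longrightarrow> 0 < i \<Longrightarrow> i < L \<Longrightarrow> deg K (Inner c i) = 2 + (if Inner c i \<in> f then 1 else 0)"
  "deg K (LeafU 0) = (if LeafU 0 \<in> f then 1 else 0)"
  "0 < k \<Longrightarrow> k < n \<Longrightarrow> deg K (LeafU k) = 1 + (if LeafU k \<in> f then 1 else 0)"
  "k < n \<Longrightarrow> deg K (LeafV k) = 1 + (if LeafV k \<in> f then 1 else 0)"
  using deg_K[of EndU] deg_K[of EndV] deg_K[of "Inner c i"] deg_K[of "LeafU 0"] deg_K[of "LeafU k"]
    deg_K[of "LeafV k"] n1 unfolding e_leaf by (simp_all add: deg_G)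

text \<open>The chord produces four vertices of degree at least 3, and the card has only two. Both
  ends of the broom keep degree at least 3, so the two ends of the chord must both lose an
  edge.\<close>

lemma goods_leaf_3:
  assumes n: "n = 3"
  shows "goods G K \<subseteq> {f}"
proof
  fix g assume g: "g \<in> goods G K"
  obtain u v where p: "g \<in> edges K" "leaf_profile (delete_edge K g) u v"
    by (rule goods_leaf[OF g]) (use n in auto)
  obtain c i d k where f: "f = {Inner c i, Inner d k}" "Inner c i \<noteq> Inner d k"
    "c < 2" "0 < i" "i < L" "d < 2" "0 < k" "k < L"
    by (rule f_leaf_edge) (use n in auto)
  have d: "deg K EndU = 4" "deg K EndV = 5" "deg K (Inner c i) = 3" "deg K (Inner d k) = 3"
    using degs(1,2) degs(3)[of c i] degs(3)[of d k] f n by simp_all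
  have small: "deg (delete_edge K g) x \<le> 2" if "x \<in> verts G" "x \<notin> {u, v}" for x
    using p(2) that unfolding leaf_profile_def by simp
  have "EndU \<in> {u, v}" "EndV \<in> {u, v}"
    using small[of EndU] small[of EndV] d deg_K_delete[OF p(1), of EndU] deg_K_delete[OF p(1), of EndV]
    by (fastforce simp: verts_G split: if_splits)+
  then have "Inner c i \<notin> {u, v}" "Inner d k \<notin> {u, v}" by auto
  then have "Inner c i \<in> g" "Inner d k \<in> g"
    using small[of "Inner c i"] small[of "Inner d k"] d deg_K_delete[OF p(1), of "Inner c i"]
      deg_K_delete[OF p(1), of "Inner d k"] f
    by (fastforce simp: verts_G split: if_splits)+
  moreover obtain x y where "g = {x, y}" "x \<noteq> y" by (rule K_edge_obtain[OF p(1)])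
  ultimately show "g \<in> {f}" using f(1,2) by auto
qed

text \<open>The card has one vertex of degree 4 and one of degree 3. \<open>EndV\<close> must be the
  former and one of the two degree-3 vertices of \<open>K\<close> the latter; the other one,
  \<open>w\<close>, lies on the deleted edge. Edge degree 3 leaves degree 2 for the second end of
  that edge.\<close>

lemma two_hubs:
  assumes n: "n = 2" and f: "f = {y, Inner c i}" "y \<in> verts G" "c < 2" "0 < i" "i < L" "deg K y = 2" "y \<noteq> EndU" "y \<noteq> EndV"
    and g: "g \<in> goods G K"
  obtains u w x where "g \<in> edges K" "g = {x, w}" "deg K x = 2" "deg K w = 3" "{u, w} = {EndU, Inner c i}" "u \<noteq> w"
    "1 \<le> card (leaves (delete_edge K g) u)" "2 \<le> card (leaves (delete_edge K g) EndV)"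
    "\<forall>m<L. \<not> walk (delete_edge K g) m u EndV" "EndV \<notin> g" "u \<notin> g"
proof -
  let ?a = "Inner c i"
  obtain u v where p: "g \<in> edges K" "leaf_profile (delete_edge K g) u v" and ed: "edge_degree K g = 3"
    by (rule goods_leaf[OF g]) (use n in auto)
  have av: "?a \<in> verts G" using f by (auto simp: verts_G)
  have "y \<noteq> ?a" using simple_edge_mem(1)[OF simple_K, of y ?a] f(1) f_in_K by auto
  have mem: "EndU \<notin> f" "EndV \<notin> f" "?a \<in> f" using f(1,7,8) by auto
  have d: "deg K EndU = 3" "deg K EndV = 4" "deg K ?a = 3"
    using degs(1,2) degs(3)[OF f(3-5)] mem n by simp_all
  have other: "deg K x \<le> 2" if "x \<in> verts G" "x \<notin> {EndU, EndV, ?a}" for x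
  proof (cases "x = y")
    case False
    then have "x \<notin> f" using that(2) f(1) by auto
    then have "deg K x \<le> deg G x" using deg_K[of x] by simp
    moreover have "deg G x \<le> 2" using that(1)
      by (cases rule: vert_cases) (use that(2) in \<open>simp_all add: deg_G\<close>)
    ultimately show ?thesis by simp
  next
    case True
    then show ?thesis using f(6) by simp
  qed
  have le: "deg (delete_edge K g) x \<le> deg K x" for x using deg_K_delete[OF p(1), of x] by simp
  have prof: "u \<in> verts G" "v \<in> verts G" "u \<noteq> v" "deg (delete_edge K g) u = 3" "deg (delete_edge K g) v = 4"
    "\<And>x. x \<in> verts G \<Longrightarrow> x \<notin> {u, v} \<Longrightarrow> deg (delete_edge K g) x \<le> 2"
    "1 \<le> card (leaves (delete_edge K g) u)" "2 \<le> card (leaves (delete_edge K g) v)"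
    "\<And>m. m < L \<Longrightarrow> \<not> walk (delete_edge K g) m u v"
    using p(2) n unfolding leaf_profile_def by simp_all
  have v: "v = EndV"
  proof (rule ccontr)
    assume "v \<noteq> EndV"
    then have "deg K v \<le> 3" using d other[OF prof(2)] by fastforce
    then show False using le[of v] prof(5) by simp
  qed
  then have Vg: "EndV \<notin> g" using prof(5) d(2) deg_K_delete[OF p(1), of EndV] by (auto split: if_splits)
  have u: "u \<in> {EndU, ?a}"
  proof (rule ccontr)
    assume "u \<notin> {EndU, ?a}"
    then have "deg K u \<le> 2" using other[OF prof(1)] prof(3) v by auto
    then show False using le[of u] prof(4) by simp
  qed
  then have ug: "u \<notin> g" using prof(4) d deg_K_delete[OF p(1), of u] by (auto split: if_splits)
  define w where "w = (if u = EndU then ?a else EndU)"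
  have w: "{u, w} = {EndU, ?a}" "u \<noteq> w" "w \<in> verts G" "deg K w = 3" "w \<noteq> EndV"
    using u d av by (auto simp: w_def verts_G)
  then have "deg (delete_edge K g) w \<le> 2" using prof(6)[OF w(3)] v by auto
  then have wg: "w \<in> g" using deg_K_delete[OF p(1), of w] w(4) by (auto split: if_splits)
  obtain x z where xz: "g = {x, z}" "edge_degree K g + 2 = deg K x + deg K z" by (rule K_edge_obtain[OF p(1)])
  obtain x where x: "g = {x, w}" "deg K x + 3 = 5"
    using xz wg w(4) ed by (cases "w = x") (auto simp: insert_commute)
  have x2: "deg K x = 2" using x(2) by simp
  have l2: "2 \<le> card (leaves (delete_edge K g) EndV)" using prof(8) unfolding v .
  have nw: "\<forall>m<L. \<not> walk (delete_edge K g) m u EndV" using prof(9) unfolding v by blast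
  show thesis
    by (rule that[OF p(1) x(1) x2 w(4) w(1,2) prof(7) l2 nw Vg ug])
qed

lemma deg_K_one:
  assumes n: "n = 2" and y: "deg K y = 1" "y \<in> verts G"
  shows "y \<notin> f \<and> (\<exists>k<n. y = LeafU k \<and> k \<noteq> 0 \<or> y = LeafV k)"
proof -
  have "LeafU 0 \<notin> f" by (rule f_leaf_edge) (use n in auto)
  from y(2) show ?thesis
  proof (cases rule: vert_cases)
    case 1
    then show ?thesis using degs(1) y(1) n1 by (simp split: if_splits)
  next
    case 2
    then show ?thesis using degs(2) y(1) n1 by (simp split: if_splits)
  next
    case (3 c i)
    then show ?thesis using degs(3)[of c i] y(1) by (simp split: if_splits)
  next
    case (4 i)
    show ?thesis
    proof (cases "i = 0")
      case True
      then show ?thesis using 4 degs(4) y(1) \<open>LeafU 0 \<notin> f\<close> by simp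
    next
      case False
      then have "y \<notin> f" using 4 degs(5)[of i] y(1) by (simp split: if_splits)
      then show ?thesis using 4 False by blast
    qed
  next
    case (5 i)
    then have "y \<notin> f" using degs(6)[of i] y(1) by (simp split: if_splits)
    then show ?thesis using 5 by blast
  qed
qed

text \<open>The new edge takes one of the two leaves of \<open>EndV\<close>, and the card has both
  again. So the degree-2 end of the deleted edge is adjacent to \<open>EndV\<close>: it is the
  spoiled leaf or the last inner vertex of a path.\<close>

lemma goods_leaf_2V:
  assumes n: "n = 2" and f: "f = {LeafV k, Inner c i}" "k < 2" "c < 2" "0 < i" "i < L"
    and g: "g \<in> goods G K"
  shows "g = f \<or> L \<noteq> 2 \<and> g = {Inner c (L - 1), Inner c i}"
proof -
  have dl: "deg K (LeafV k) = 2" using degs(6)[of k] f n by simp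
  have y: "LeafV k \<in> verts G" "LeafV k \<noteq> EndU" "LeafV k \<noteq> EndV" proof -
    have "k < n" using f(2) n by simp
    then show "LeafV k \<in> verts G" by (simp add: verts_G)
  qed simp_all
  obtain u w x where g: "g \<in> edges K" "g = {x, w}" "deg K x = 2" "deg K w = 3" "{u, w} = {EndU, Inner c i}" "u \<noteq> w"
    "1 \<le> card (leaves (delete_edge K g) u)" "2 \<le> card (leaves (delete_edge K g) EndV)"
    "\<forall>m<L. \<not> walk (delete_edge K g) m u EndV" "EndV \<notin> g" "u \<notin> g"
    by (rule two_hubs[OF n f(1) y(1) f(3-5) dl y(2,3) g]) blast
  have "leaves K EndV \<subseteq> {LeafV (1 - k)}"
  proof
    fix z assume z: "z \<in> leaves K EndV"
    moreover have "EndV \<notin> f" using f(1) by simp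
    ultimately have zn: "z \<in> nb G EndV" "deg K z = 1" by (auto simp: leaves_def nb_K)
    then have "z \<in> verts G" using nb_subset_verts[OF simple_G] by blast
    from deg_K_one[OF n zn(2) this] zn(1)[unfolded nb_EndV] have "z \<notin> f" "z \<in> LeafV ` {..<n}" by auto
    then have "z \<notin> f" "z \<in> LeafV ` {..<2}" using n by simp_all
    then show "z \<in> {LeafV (1 - k)}" using f(1,2) by (auto simp: less_2)
  qed
  then have "card (leaves K EndV) \<le> 1" using card_mono[of "{LeafV (1 - k)}" "leaves K EndV"] by simp
  then have "card (leaves K EndV) < card (leaves (delete_edge K g) EndV)" using g(8) by simp
  then obtain x' y' where xy': "g = {x', y'}" "x' \<in> nb K EndV" "nb K x' = {EndV, y'}" "EndV \<noteq> y'" "deg K x' = 2"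
    by (rule leaf_gainedE[OF simple_K g(1)])
  have "x' \<noteq> w" using xy'(5) g(4) by auto
  then have x: "x' = x" "y' = w" using xy'(1) g(2) by (auto simp: doubleton_eq_iff)
  have nbx: "nb K x = {EndV, w}" using xy'(3) unfolding x .
  have "EndV \<notin> f" using f(1) by simp
  then have "x \<in> nb G EndV" using xy'(2) x(1) by (auto simp: nb_K)
  then have "x \<in> {Inner 0 (L - 1), Inner 1 (L - 1)} \<union> LeafV ` {..<n}" unfolding nb_EndV .
  then consider k' where "k' < 2" "x = LeafV k'" | d where "d < 2" "x = Inner d (L - 1)"
    using n by auto
  then show ?thesis
  proof cases
    case (1 k')
    have k: "k' < n" using 1(1) n by simp
    have d2: "deg K (LeafV k') = 2" using g(3) unfolding 1(2) .
    have "LeafV k' \<in> f"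
    proof (rule ccontr)
      assume "LeafV k' \<notin> f"
      then have "deg K (LeafV k') = 1" using degs(6)[OF k] by simp
      with d2 show False by simp
    qed
    then have xk: "x = LeafV k" using f(1) 1(2) by simp
    then have "{x, Inner c i} = f" using f(1) by simp
    then have "Inner c i \<in> nb K x" by (simp only: nb_K simp_thms)
    then have "Inner c i = w" unfolding nbx by simp
    then show ?thesis using g(2) f(1) xk by simp
  next
    case (2 d)
    have "pv d (L - 2) \<in> nb G x" using nb_Inner[of d "L - 1"] 2 L2 by (simp add: numeral_2_eq_2)
    moreover have "{x, pv d (L - 2)} \<noteq> e" using 2 e_leaf by (auto simp: doubleton_eq_iff)
    ultimately have "pv d (L - 2) \<in> nb K x" by (simp only: nb_K simp_thms)
    then have "pv d (L - 2) \<in> {EndV, w}" unfolding nbx .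
    moreover have "pv d (L - 2) \<noteq> EndV" using pv_eq_EndV[of "L - 2" d] L2 by simp
    ultimately have w: "pv d (L - 2) = w" by simp
    have "w \<in> {EndU, Inner c i}" using g(5) by blast
    then show ?thesis
    proof (elim insertE emptyE)
      assume "w = Inner c i"
      then have "L - 2 = i" "d = c" using w pv_eq_Inner[of "L - 2" d c i] by auto
      moreover from this have "L \<noteq> 2" using f(4) by auto
      ultimately show ?thesis using g(2) 2 \<open>w = Inner c i\<close> by auto
    next
      assume wU: "w = EndU"
      then have "L - 2 = 0" using w pv_eq_EndU[of "L - 2" d] by auto
      then have "L = 2" using L2 by simp
      then have i': "i = 1" "Suc i = L" using f(4,5) by simp_all
      have i: "i = 1" "pv c (i - 1) = EndU" "pv c (Suc i) = EndV"
        unfolding i'(2) by (simp_all add: i'(1))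
      have u: "u = Inner c i" using g(5,6) wU by auto
      \<comment> \<open>In the card, \<open>u\<close> needs a leaf, but none of its three neighbours
        in \<open>K\<close> has degree 1 after the deletion.\<close>
      have "leaves (delete_edge K g) u \<noteq> {}" using g(7) by auto
      then obtain z where z: "z \<in> nb K u" "deg (delete_edge K g) z = 1" by (auto simp: leaves_def nb_delete_iff)
      have "z \<in> nb G (Inner c i) \<or> {Inner c i, z} = f" using z(1) unfolding u nb_K by blast
      then have zc: "z \<in> {EndU, EndV, LeafV k}"
      proof
        assume "z \<in> nb G (Inner c i)"
        then show ?thesis unfolding nb_Inner[OF f(3-5)] i(2,3) by blast
      next
        assume "{Inner c i, z} = f"
        then show ?thesis unfolding f(1) by (auto simp: doubleton_eq_iff)
      qed
      have "EndU \<notin> f" "EndV \<notin> f" using f(1) by simp_all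
      then have dUV: "deg K EndU = 3" "deg K EndV = 4" using degs(1,2) n by simp_all
      have "LeafV k \<notin> g" using g(2) 2 wU by auto
      then show ?thesis
        using zc z(2) deg_K_delete[OF g(1), of EndU] deg_K_delete[OF g(1), of EndV]
          deg_K_delete[OF g(1), of "LeafV k"] dl dUV g(10)
        by (elim insertE emptyE) (simp_all split: if_splits)
    qed
  qed
qed

text \<open>Neither of the degree-3 vertices has a leaf in \<open>K\<close>, so the one that plays
  \<open>u\<close> must gain one. The gained leaf is a common neighbour of \<open>EndU\<close> and
  \<open>Inner c i\<close>.\<close>

lemma goods_leaf_2U:
  assumes n: "n = 2" and f: "f = {LeafU 1, Inner c i}" "c < 2" "0 < i" "i < L"
    and g: "g \<in> goods G K"
  shows "g = f \<or> L \<noteq> 2 \<and> g = {Inner c 1, Inner c i}"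
proof -
  have dl: "deg K (LeafU 1) = 2" using degs(5)[of 1] f n by simp
  have y: "LeafU 1 \<in> verts G" "LeafU 1 \<noteq> EndU" "LeafU 1 \<noteq> EndV" proof -
    have "1 < n" using n by simp
    then show "LeafU 1 \<in> verts G" by (simp add: verts_G)
  qed simp_all
  obtain u w x where g: "g \<in> edges K" "g = {x, w}" "deg K x = 2" "deg K w = 3" "{u, w} = {EndU, Inner c i}" "u \<noteq> w"
    "1 \<le> card (leaves (delete_edge K g) u)" "2 \<le> card (leaves (delete_edge K g) EndV)" "\<forall>m<L. \<not> walk (delete_edge K g) m u EndV" "EndV \<notin> g" "u \<notin> g"
    by (rule two_hubs[OF n f(1) y(1) f(2-4) dl y(2,3) g]) blast
  have "leaves K u = {}"
  proof (rule ccontr)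
    assume "leaves K u \<noteq> {}"
    then obtain z where z: "z \<in> nb K u" "deg K z = 1" by (auto simp: leaves_def)
    have "z \<in> verts G" using z(1) nb_subset_verts[OF simple_K] by auto
    from deg_K_one[OF n z(2) this] obtain k where zf: "z \<notin> f" and k: "k < 2" "z = LeafU k \<and> k \<noteq> 0 \<or> z = LeafV k"
      using n by auto
    have "{u, z} \<noteq> f" using zf by auto
    then have zG: "z \<in> nb G u" using z(1) by (auto simp: nb_K)
    have "u \<in> {EndU, Inner c i}" using g(5) by blast
    then have "z = LeafU 1"
      using zG k nb_Inner[OF f(2-4)] nb_EndU by (auto simp: pv_not_leaf less_2)
    then show False using zf f(1) by simp
  qed
  then have "card (leaves K u) < card (leaves (delete_edge K g) u)" using g(7) by simp
  then obtain x' y' where xy': "g = {x', y'}" "x' \<in> nb K u" "nb K x' = {u, y'}" "u \<noteq> y'" "deg K x' = 2"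
    by (rule leaf_gainedE[OF simple_K g(1)])
  have "x' \<noteq> w" using xy'(5) g(4) by auto
  then have "x' = x" "y' = w" using xy'(1) g(2) by (auto simp: doubleton_eq_iff)
  then have nbx: "nb K x = {EndU, Inner c i}" using xy'(3) g(5) by simp
  then have "EndU \<in> nb K x" by simp
  then have "x \<in> nb K EndU" using nb_sym[of EndU K x] by blast
  moreover have "EndU \<notin> f" using f(1) by simp
  ultimately have xG: "x \<in> nb G EndU" by (auto simp: nb_K)
  then have "x \<in> {Inner 0 1, Inner 1 1} \<union> LeafU ` {..<n}" unfolding nb_EndU .
  then consider k' where "k' < 2" "x = LeafU k'" | d where "d < 2" "x = Inner d 1"
    using n by auto
  then have x: "x = LeafU 1 \<or> L \<noteq> 2 \<and> x = Inner c 1"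
  proof cases
    case (1 k')
    have k: "k' < n" using 1(1) n by simp
    have d2: "deg K (LeafU k') = 2" using g(3) unfolding 1(2) .
    have "LeafU k' \<in> f"
    proof (rule ccontr)
      assume nf: "LeafU k' \<notin> f"
      have "deg K (LeafU k') \<le> 1"
      proof (cases "k' = 0")
        case True
        then show ?thesis using degs(4) by simp
      next
        case False
        then show ?thesis using degs(5)[OF _ k] nf by simp
      qed
      with d2 show False by simp
    qed
    then show ?thesis using 1 f(1) by auto
  next
    case (2 d)
    have "pv d 2 \<in> nb G x" using nb_Inner[of d 1] 2 L2 by (simp add: numeral_2_eq_2)
    moreover have "{x, pv d 2} \<noteq> e" using 2 e_leaf by (auto simp: doubleton_eq_iff)
    ultimately have "pv d 2 \<in> nb K x" by (simp only: nb_K simp_thms)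
    then have "pv d 2 \<in> {EndU, Inner c i}" unfolding nbx .
    moreover have "pv d 2 \<noteq> EndU" using pv_eq_EndU[of 2 d] L2 by simp
    ultimately have "pv d 2 = Inner c i" by simp
    then have "d = c" "2 < L" using pv_eq_Inner[of 2 d c i] L2 by auto
    then show ?thesis using 2 by auto
  qed
  show ?thesis
  proof (cases "u = EndU")
    case True
    then have w: "w = Inner c i" using g(5,6) unfolding doubleton_eq_iff by blast
    from x show ?thesis
    proof
      assume "x = LeafU 1"
      then have "g = f" unfolding g(2) w f(1) by simp
      then show ?thesis ..
    next
      assume "L \<noteq> 2 \<and> x = Inner c 1"
      then show ?thesis unfolding g(2) w by simp
    qed
  next
    case False
    then have uw: "u = Inner c i" "w = EndU" using g(5,6) by (auto simp: doubleton_eq_iff)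
    \<comment> \<open>If \<open>Inner c i\<close> plays \<open>u\<close>, then the rest of its path
      to \<open>EndV\<close> avoids the deleted edge, and the two branch vertices of the card are
      too close.\<close>
    have "walk (delete_edge K g) (L - i) ((\<lambda>t. pv c (i + t)) 0) ((\<lambda>t. pv c (i + t)) (L - i))"
    proof (rule walk_along)
      fix t assume t: "t < L - i"
      have "{pv c (i + t), pv c (Suc (i + t))} \<in> edges G" using f t by (intro path_edge) auto
      moreover have "EndU \<notin> {pv c (i + t), pv c (Suc (i + t))}"
      proof -
        have "i + t \<le> L" "Suc (i + t) \<le> L" "0 < i" using f(3) t by simp_all
        then have "pv c (i + t) \<noteq> EndU" "pv c (Suc (i + t)) \<noteq> EndU" by (simp_all add: pv_eq_EndU)
        then show ?thesis by (metis insert_iff empty_iff)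
      qed
      then have "{pv c (i + t), pv c (Suc (i + t))} \<noteq> e" "{pv c (i + t), pv c (Suc (i + t))} \<noteq> g"
        using e_leaf g(2) uw by blast+
      ultimately show "pv c (i + Suc t) \<in> nb (delete_edge K g) (pv c (i + t))" by (simp add: nb_def)
    qed
    then have "walk (delete_edge K g) (L - i) u EndV" using f uw by (simp add: pv_Inner)
    then show ?thesis using g(9) f(3,4) by simp
  qed
qed

lemma leaf_bound:
  assumes n: "2 \<le> n"
  shows "n \<le> 3" "card (goods G K) \<le> 2" "n = 3 \<or> L = 2 \<Longrightarrow> card (goods G K) \<le> 1"
proof -
  have one: "card (goods G K) \<le> 1" if "goods G K \<subseteq> {f}"
    using card_mono[OF _ that] by simp
  have two: "card (goods G K) \<le> 2" if "goods G K \<subseteq> {f, h}" for h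
    using card_mono[OF _ that] card_insert_le_m1[of 2 "{h}" f] by (simp add: card_insert_if split: if_splits)
  have "n \<le> 3 \<and> card (goods G K) \<le> 2 \<and> (n = 3 \<or> L = 2 \<longrightarrow> card (goods G K) \<le> 1)"
  proof (rule f_leaf_edge)
    fix c i assume f: "n = 2" "f = {LeafU 1, Inner c i}" "c < 2" "0 < i" "i < L"
    have "goods G K \<subseteq> {f, {Inner c 1, Inner c i}}" "L = 2 \<Longrightarrow> goods G K \<subseteq> {f}"
      using goods_leaf_2U[OF f] by auto
    then show ?thesis using one two f(1) by auto
  next
    fix c i k assume f: "n = 2" "f = {LeafV k, Inner c i}" "k < 2" "c < 2" "0 < i" "i < L"
    have "goods G K \<subseteq> {f, {Inner c (L - 1), Inner c i}}" "L = 2 \<Longrightarrow> goods G K \<subseteq> {f}"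
      using goods_leaf_2V[OF f] by auto
    then show ?thesis using one two f(1) by auto
  next
    assume "n = 3"
    then show ?thesis using one[OF goods_leaf_3] by simp
  qed (use n in auto)
  then show "n \<le> 3" "card (goods G K) \<le> 2" "n = 3 \<or> L = 2 \<Longrightarrow> card (goods G K) \<le> 1" by auto
qed

end

context broom_exchange
begin

lemma nb_K_out: "x \<notin> f \<Longrightarrow> x \<notin> e \<Longrightarrow> nb K x = nb G x"
  by (auto simp: nb_K)

lemma nb_K_f:
  assumes "f = {x, y}" "x \<notin> e"
  shows "nb K x = insert y (nb G x)"
proof -
  have "{x, z} = f \<longleftrightarrow> z = y" for z by (subst assms(1)) (auto simp: doubleton_eq_iff)
  then show ?thesis using assms(2) by (auto simp: nb_K)
qed

lemma nb_K_ef: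
  assumes "e = {x, w}" "f = {x, y}"
  shows "nb K x = insert y (nb G x - {w})"
proof -
  have "{x, z} = e \<longleftrightarrow> z = w" for z by (subst assms(1)) (auto simp: doubleton_eq_iff)
  moreover have "{x, z} = f \<longleftrightarrow> z = y" for z by (subst assms(2)) (auto simp: doubleton_eq_iff)
  ultimately show ?thesis by (auto simp: nb_K)
qed

end

section \<open>Removing a leaf edge: the case n = 1\<close>

context broom_leaf_exchange
begin

text \<open>Here \<open>K\<close> is a cycle of length 2L with pendant edges at
  \<open>Inner c i\<close> and \<open>EndV\<close>, joined by arcs of lengths L - i and L + i.
  Shared leaf cards delete a pendant edge. Deleting an edge of the short arc puts the branch
  vertices too far apart; otherwise they are too close, so one of them has to lose an edge of the
  long arc.\<close>

lemma goods_leaf_1: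
  assumes n: "n = 1" and f: "f = {LeafU 0, Inner c i}" "c < 2" "0 < i" "i < L" and g: "g \<in> goods G K"
  shows "g \<in> {f, {EndV, LeafV 0}} \<or> L \<noteq> 2 \<and> g \<in> {{pv c (i - 1), Inner c i}, {EndV, Inner (1 - c) (L - 1)}}"
proof -
  let ?z = "Inner c i"
  have zv: "?z \<in> verts G" using f by (auto simp: verts_G)
  have fm: "EndU \<notin> f" "EndV \<notin> f" "?z \<in> f" "LeafU 0 \<in> f" "LeafV 0 \<notin> f" using f(1) by auto
  have d: "deg K EndU = 2" "deg K EndV = 3" "deg K ?z = 3" "deg K (LeafU 0) = 1" "deg K (LeafV 0) = 1"
    using degs(1,2,4) degs(3)[OF f(2-4)] degs(6)[of 0] fm n by simp_all
  have dI: "deg K x = 2" if "x \<in> verts G" "x \<notin> {EndV, ?z, LeafU 0, LeafV 0}" for x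
    using that(1)
  proof (cases rule: vert_cases)
    case (3 c' i')
    then have "x \<notin> f" using that(2) f(1) by auto
    then show ?thesis using degs(3)[of c' i'] 3 by simp
  qed (use that(2) d n in auto)
  have e': "e = {LeafU 0, EndU}" using e_leaf by auto
  have f': "f = {?z, LeafU 0}" using f(1) by auto
  have mem: "EndV \<notin> f" "EndV \<notin> e" "LeafV 0 \<notin> f" "LeafV 0 \<notin> e" "?z \<notin> e" using f(1) e_leaf by auto
  have "0 < n" using n1 by simp
  then have nbLU: "nb K (LeafU 0) = {?z}" and nbLV: "nb K (LeafV 0) = {EndV}"
    unfolding nb_K_ef[OF e' f(1)] nb_K_out[OF mem(3,4)] by (simp_all add: nb_LeafU nb_LeafV)
  have nbz: "nb K ?z = {pv c (i - 1), pv c (Suc i), LeafU 0}"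
    unfolding nb_K_f[OF f' mem(5)] nb_Inner[OF f(2-4)] by auto
  have "LeafV ` {..<n} = {LeafV 0}" using n by auto
  then have nbV: "nb K EndV = {Inner 0 (L - 1), Inner 1 (L - 1), LeafV 0}"
    unfolding nb_K_out[OF mem(1,2)] nb_EndV by auto
  have dc: "deg K x = 3 \<and> x \<in> {?z, EndV} \<or> deg K x = 1 \<and> x \<in> {LeafU 0, LeafV 0} \<or> deg K x = 2"
    if "x \<in> verts G" for x
  proof (cases "x \<in> {EndV, ?z, LeafU 0, LeafV 0}")
    case True
    then show ?thesis using d(2-5) by (elim insertE emptyE) simp_all
  qed (use dI[OF that] in simp)
  have at_LU: "h = f" if hK: "h \<in> edges K" and hm: "LeafU 0 \<in> h" for h
  proof -
    obtain x y where "h = {x, y}" by (rule K_edge_obtain[OF hK])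
    then obtain y where y: "h = {LeafU 0, y}" using hm by auto
    then have "y \<in> nb K (LeafU 0)" using hK by (simp add: nb_def)
    then have "y = ?z" unfolding nbLU by simp
    then show ?thesis unfolding y f(1) by simp
  qed
  have at_LV: "h = {EndV, LeafV 0}" if hK: "h \<in> edges K" and hm: "LeafV 0 \<in> h" for h
  proof -
    obtain x y where "h = {x, y}" by (rule K_edge_obtain[OF hK])
    then obtain y where y: "h = {LeafV 0, y}" using hm by auto
    then have "y \<in> nb K (LeafV 0)" using hK by (simp add: nb_def)
    then have "y = EndV" unfolding nbLV by simp
    then show ?thesis unfolding y by auto
  qed
  from g show ?thesis
  proof (cases rule: goods_cases)
    case 1
    obtain u v where "leaf_profile (delete_edge K g) u v" by (rule leaf_card[OF simple_K 1])
    then obtain x where x: "x \<in> verts G" "deg (delete_edge K g) x = 0" unfolding leaf_profile_def by auto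
    then have "deg K x = (if x \<in> g then 1 else 0)" using deg_K_delete[OF 1(1), of x] by simp
    then have "x \<in> g" "deg K x = 1" using dc[OF x(1)] by (cases "x \<in> g"; simp)+
    then have "x = LeafU 0 \<or> x = LeafV 0" using dc[OF x(1)] by simp
    then show ?thesis using at_LU[OF 1(1)] at_LV[OF 1(1)] \<open>x \<in> g\<close> by blast
  next
    case (2 j')
    note gK = 2(1)
    obtain u v where p: "path_profile j' (delete_edge K g) u v" "edge_degree K g = (if j' = 0 then 3 else 2)"
    proof -
      obtain u v where "path_profile j' (delete_edge K g) u v" "edge_degree K g = (if j' = 0 then n + 2 else 2)"
        by (rule path_card[OF simple_K 2(1,3,2)])
      moreover have "n + 2 = 3" using n by simp
      ultimately show thesis using that by metis
    qed
    have pp: "u \<in> verts G" "v \<in> verts G" "u \<noteq> v" "deg (delete_edge K g) v = 3"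
      "j' \<noteq> 0 \<Longrightarrow> deg (delete_edge K g) u = 3" "walk (delete_edge K g) L u v"
      "\<And>m. m < L \<Longrightarrow> \<not> walk (delete_edge K g) m u v"
      "\<And>x. j' = 0 \<Longrightarrow> x \<in> verts G \<Longrightarrow> \<exists>m\<le>L + 1. walk (delete_edge K g) m v x"
      "L = 2 \<Longrightarrow> 2 \<le> card (leaves (delete_edge K g) v)"
      using p(1) n unfolding path_profile_def by simp_all
    have hub: "x \<in> {?z, EndV} \<and> x \<notin> g" if "x \<in> verts G" "deg (delete_edge K g) x = 3" for x
    proof -
      have "deg K x = 3 + (if x \<in> g then 1 else 0)" using deg_K_delete[OF gK, of x] that(2) by simp
      then show ?thesis using dc[OF that(1)] by (cases "x \<in> g") simp_all
    qed
    have vz: "v \<in> {?z, EndV}" "v \<notin> g" using hub[OF pp(2,4)] by auto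
    have uz: "u \<in> {?z, EndV}" if "j' \<noteq> 0" using hub[OF pp(1) pp(5)[OF that]] by auto
    show ?thesis
    proof (cases "\<exists>m. i \<le> m \<and> m < L \<and> g = {pv c m, pv c (Suc m)}")
      case True
      then obtain m where m: "i \<le> m" "m < L" "g = {pv c m, pv c (Suc m)}" by blast
      \<comment> \<open>The position along the cycle opened at \<open>g\<close>, measured from
        \<open>EndV\<close> over the other path and then up to the gap. The pieces on either side of
        \<open>g\<close> may have overlapping values, since only the growth along edges matters. The
        branch vertices differ by L + i, and each is L + i + 1 away from the pendant vertex at the
        other.\<close>
      define \<phi> where "\<phi> x = (case x of EndU \<Rightarrow> int L | EndV \<Rightarrow> 0
          | Inner d t \<Rightarrow> (if d = c \<and> t \<le> m then int L + int t else int L - int t)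
          | LeafU t \<Rightarrow> int L + int i + 1 | LeafV t \<Rightarrow> - 1)" for x
      have \<phi>c: "\<phi> (pv c t) = (if t \<le> m then int L + int t else int L - int t)" if "t \<le> L" for t
        by (rule pv_cases[OF that, of c]) (use m(2) in \<open>auto simp: \<phi>_def\<close>)
      have \<phi>d: "\<phi> (pv d t) = int L - int t" if "t \<le> L" "d \<noteq> c" for t d
        by (rule pv_cases[OF that(1), of d]) (use that(2) in \<open>auto simp: \<phi>_def\<close>)
      have lip: "\<phi> y \<le> \<phi> x + 1" if "y \<in> nb (delete_edge K g) x" for x y
      proof -
        have "{x, y} \<in> edges K" "{x, y} \<noteq> g" using that by (auto simp: nb_def)
        then consider "{x, y} = f" | "{x, y} \<in> edges G" "{x, y} \<noteq> e" "{x, y} \<noteq> g" by auto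
        then have "\<bar>\<phi> x - \<phi> y\<bar> \<le> 1"
        proof cases
          case 1
          then show ?thesis using f(1) m(1) by (auto simp: doubleton_eq_iff \<phi>_def)
        next
          case 2
          from 2(1) show ?thesis
          proof (cases rule: edge_cases)
            case (1 d t)
            have "\<bar>\<phi> (pv d t) - \<phi> (pv d (Suc t))\<bar> \<le> 1"
            proof (cases "d = c")
              case True
              then have "t \<noteq> m" using 1(1) 2(3) m(3) by auto
              then show ?thesis using \<phi>c[of t] \<phi>c[of "Suc t"] 1(3) True by auto
            next
              case False
              then show ?thesis using \<phi>d[of t d] \<phi>d[of "Suc t" d] 1(3) by auto
            qed
            moreover have "(x = pv d t \<and> y = pv d (Suc t)) \<or> (y = pv d t \<and> x = pv d (Suc t))"
              using 1(1) by (simp add: doubleton_eq_iff) blast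
            ultimately show ?thesis by (auto simp: abs_minus_commute)
          next
            case (2 t)
            then show ?thesis using \<open>{x, y} \<noteq> e\<close> n e_leaf by auto
          next
            case (3 t)
            then show ?thesis by (auto simp: doubleton_eq_iff \<phi>_def)
          qed
        qed
        then show ?thesis by linarith
      qed
      have pot: "\<phi> b \<le> \<phi> a + int k" if "walk (delete_edge K g) k a b" for a b k
        by (rule walk_potential[OF _ that]) (rule lip)
      have \<phi>z: "\<phi> ?z = int L + int i" "\<phi> EndV = 0" "\<phi> (LeafU 0) = int L + int i + 1" "\<phi> (LeafV 0) = - 1"
        using m(1) by (simp_all add: \<phi>_def)
      show ?thesis
      proof (cases "j' = 0")
        case False
        note w = pp(6) walk_sym[OF pp(6)]
        have "u = ?z \<and> v = EndV \<or> v = ?z \<and> u = EndV" using uz[OF False] vz pp(3) by auto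
        then have "\<phi> ?z \<le> \<phi> EndV + int L" using pot[OF w(1)] pot[OF w(2)] by auto
        then show ?thesis using \<phi>z f(3) by simp
      next
        case True
        from vz(1) show ?thesis
        proof (elim insertE emptyE)
          assume v: "v = EndV"
          obtain k where "k \<le> L + 1" "walk (delete_edge K g) k v (LeafU 0)"
            using pp(8)[OF True, of "LeafU 0"] n1 by (auto simp: verts_G)
          then show ?thesis using pot[of k v "LeafU 0"] v \<phi>z f(3) by simp
        next
          assume v: "v = ?z"
          obtain k where k: "k \<le> L + 1" "walk (delete_edge K g) k v (LeafV 0)"
            using pp(8)[OF True, of "LeafV 0"] n1 by (auto simp: verts_G)
          from pot[OF walk_sym[OF k(2)]] show ?thesis using v k(1) \<phi>z f(3) by simp
        qed
      qed
    next
      case False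
      have w: "walk (delete_edge K g) (L - i) ?z EndV"
      proof -
        have "walk (delete_edge K g) (L - i) ((\<lambda>t. pv c (i + t)) 0) ((\<lambda>t. pv c (i + t)) (L - i))"
        proof (rule walk_along)
          fix t assume t: "t < L - i"
          have "{pv c (i + t), pv c (Suc (i + t))} \<in> edges G" using f t by (intro path_edge) auto
          moreover have "{pv c (i + t), pv c (Suc (i + t))} \<noteq> g" using False t by (auto dest!: spec[of _ "i + t"])
          moreover have "{pv c (i + t), pv c (Suc (i + t))} \<noteq> e"
            using e_leaf pv_not_leaf by (auto simp: doubleton_eq_iff)
          ultimately show "pv c (i + Suc t) \<in> nb (delete_edge K g) (pv c (i + t))" by (simp add: nb_def)
        qed
        then show ?thesis using f by (simp add: pv_Inner)
      qed
      \<comment> \<open>For a card of an inner path edge both degree-3 vertices would survive, at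
        distance at most L - i, less than L.\<close>
      have j0: "j' = 0"
      proof (rule ccontr)
        assume "j' \<noteq> 0"
        then have "u = ?z \<and> v = EndV \<or> v = ?z \<and> u = EndV" using uz vz pp(3) by auto
        then show False using pp(7)[of "L - i"] w walk_sym[OF w] f(3,4) by auto
      qed
      obtain x y where xy: "g = {x, y}" "x \<in> verts G" "y \<in> verts G" "edge_degree K g + 2 = deg K x + deg K y"
        by (rule K_edge_obtain[OF gK])
      have sum: "deg K x + deg K y = 5" using xy(4) p(2) j0 by simp
      have le3: "deg K x \<le> 3" "deg K y \<le> 3" using dc[OF xy(2)] dc[OF xy(3)] by linarith+
      obtain h x where hx: "g = {h, x}" "deg K h = 3" "deg K x = 2" "h \<in> verts G"
      proof (cases "deg K x = 3")
        case True
        then show ?thesis using that[of x y] xy sum by simp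
      next
        case False
        then have "deg K y = 3" "deg K x = 2" using sum le3 by auto
        then show ?thesis using that[of y x] xy by auto
      qed
      have h: "h \<in> {?z, EndV}" using dc[OF hx(4)] hx(2) by simp
      have xn: "x \<in> nb K h" using gK hx(1) by (simp add: nb_def)
      have s1: "g \<noteq> {pv c i, pv c (Suc i)}" using False f(4) by blast
      have s2: "g \<noteq> {pv c (L - 1), pv c (Suc (L - 1))}"
      proof
        assume "g = {pv c (L - 1), pv c (Suc (L - 1))}"
        moreover have "i \<le> L - 1" "L - 1 < L" using f(4) by auto
        ultimately show False using False by blast
      qed
      have cand: "g = {pv c (i - 1), ?z} \<or> g = {EndV, Inner (1 - c) (L - 1)}"
      proof (cases "h = ?z")
        case True
        then have "x \<in> {pv c (i - 1), pv c (Suc i), LeafU 0}" using xn nbz by simp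
        moreover have "x \<noteq> LeafU 0" using hx(3) d by auto
        moreover have "x \<noteq> pv c (Suc i)" using s1 hx(1) True f(3,4) by (auto simp: pv_Inner)
        ultimately show ?thesis using hx(1) True by auto
      next
        case False
        then have hV: "h = EndV" using h by simp
        then have "x \<in> {Inner 0 (L - 1), Inner 1 (L - 1), LeafV 0}" using xn nbV by simp
        moreover have "x \<noteq> LeafV 0" using hx(3) d by auto
        moreover have "x \<noteq> Inner c (L - 1)"
        proof
          assume "x = Inner c (L - 1)"
          then have "g = {pv c (L - 1), pv c (Suc (L - 1))}"
            using hx(1) hV L2 by (auto simp: pv_Inner)
          then show False using s2 by simp
        qed
        ultimately have "x = Inner (1 - c) (L - 1)" using f(2) by (auto simp: less_2)
        then show ?thesis using hx(1) hV by simp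
      qed
      \<comment> \<open>For L = 2 the card of an end edge has two leaves at its vertex of degree 3;
        here there is at most one.\<close>
      moreover have "L \<noteq> 2"
      proof
        assume L: "L = 2"
        then have i': "i = 1" "Suc i = L" using f(3,4) by simp_all
        have i: "i = 1" "pv c (i - 1) = EndU" "pv c (Suc i) = EndV"
          unfolding i'(2) by (simp_all add: i'(1))
        have L1: "L - 1 = 1" using L by simp
        obtain q where q: "leaves (delete_edge K g) v \<subseteq> {q}"
        proof (cases "v = ?z")
          case True
          then have "g = {EndV, Inner (1 - c) 1}" using cand vz(2) L1 by auto
          then have "EndU \<notin> g" "EndV \<in> g" by auto
          then have dUV: "deg (delete_edge K g) EndU = 2" "deg (delete_edge K g) EndV = 2"
            using deg_K_delete[OF gK, of EndU] deg_K_delete[OF gK, of EndV] d(1,2) by simp_all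
          have "leaves (delete_edge K g) v \<subseteq> {LeafU 0}"
          proof
            fix y assume "y \<in> leaves (delete_edge K g) v"
            then have y: "y \<in> nb K ?z" "deg (delete_edge K g) y = 1"
              unfolding True by (simp_all add: leaves_def nb_delete_iff)
            from y(1) have "y \<in> {EndU, EndV, LeafU 0}" unfolding nbz i(2,3) .
            then show "y \<in> {LeafU 0}" using dUV y(2) by (elim insertE emptyE) simp_all
          qed
          then show thesis by (rule that)
        next
          case False
          then have vV: "v = EndV" using vz(1) by simp
          then have gg: "g = {EndU, ?z}" using cand vz(2) i(2) by auto
          have nd: "deg (delete_edge K g) (Inner b 1) \<noteq> 1" if "b < 2" for b
          proof (cases "b = c")
            case True
            have "deg (delete_edge K g) ?z \<noteq> 1"
              using deg_K_delete[OF gK, of ?z] d(3) by (simp split: if_splits)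
            then show ?thesis using True i(1) by simp
          next
            case False
            have "Inner b 1 \<in> verts G" using that L2 by (auto simp: verts_G)
            moreover have "Inner b 1 \<notin> {EndV, ?z, LeafU 0, LeafV 0}" using False by simp
            ultimately have "deg K (Inner b 1) = 2" by (rule dI)
            moreover have "Inner b 1 \<notin> g" unfolding gg using False by simp
            ultimately show ?thesis using deg_K_delete[OF gK, of "Inner b 1"] by simp
          qed
          have "leaves (delete_edge K g) v \<subseteq> {LeafV 0}"
          proof
            fix y assume "y \<in> leaves (delete_edge K g) v"
            then have y: "y \<in> nb K EndV" "deg (delete_edge K g) y = 1"
              unfolding vV by (simp_all add: leaves_def nb_delete_iff)
            from y(1) have "y \<in> {Inner 0 1, Inner 1 1, LeafV 0}" unfolding nbV L1 .
            then show "y \<in> {LeafV 0}" using nd[of 0] nd[of 1] y(2) by (elim insertE emptyE) simp_all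
          qed
          then show thesis by (rule that)
        qed
        then have "card (leaves (delete_edge K g) v) \<le> 1" using card_mono[OF _ q] by simp
        then show False using pp(9)[OF L] by simp
      qed
      ultimately show ?thesis by auto
    qed
  qed
qed

lemma leaf_bound_1:
  assumes n: "n = 1"
  shows "card (goods G K) \<le> 4" "L = 2 \<Longrightarrow> card (goods G K) \<le> 2"
proof -
  obtain c i where f: "f = {LeafU 0, Inner c i}" "c < 2" "0 < i" "i < L"
    by (rule f_leaf_edge) (use n in auto)
  have "goods G K \<subseteq> set [f, {EndV, LeafV 0}, {pv c (i - 1), Inner c i}, {EndV, Inner (1 - c) (L - 1)}]"
    using goods_leaf_1[OF n f] by auto
  then have "card (goods G K) \<le> card (set [f, {EndV, LeafV 0}, {pv c (i - 1), Inner c i}, {EndV, Inner (1 - c) (L - 1)}])"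
    by (intro card_mono) auto
  also have "\<dots> \<le> length [f, {EndV, LeafV 0}, {pv c (i - 1), Inner c i}, {EndV, Inner (1 - c) (L - 1)}]"
    by (rule card_length)
  finally show "card (goods G K) \<le> 4" by simp
  assume "L = 2"
  then have "goods G K \<subseteq> set [f, {EndV, LeafV 0}]"
    using goods_leaf_1[OF n f] by auto
  then have "card (goods G K) \<le> card (set [f, {EndV, LeafV 0}])"
    by (intro card_mono) auto
  also have "\<dots> \<le> length [f, {EndV, LeafV 0}]" by (rule card_length)
  finally show "card (goods G K) \<le> 2" by simp
qed

end

context broom_exchange
begin

text \<open>The converse of \<open>shared_card_swap_edge\<close>: every admissible exchange shares
  at least the card of its new edge.\<close>

lemma da_ecard_f: "da_ecard K f = da_ecard G e"
  using f_degree by (simp add: da_ecard_def delete_swap_edge[OF f_new])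

end

context broom
begin

text \<open>After the exchange of \<open>ep 0\<close>, the vertex \<open>LeafU 0\<close> lies
  between \<open>EndU\<close> and \<open>Inner 0 2\<close>, and \<open>Inner 0 1\<close> is pendant
  at \<open>Inner 0 2\<close>. After the exchange of \<open>eL\<close> these two vertices have the
  opposite roles. The same graph thus arises from two kinds of removed edge and shares cards of both
  kinds.\<close>

lemma iso_map_twist:
  assumes L3: "3 \<le> L"
  shows "iso_map (transpose (LeafU 0) (Inner 0 1)) (swap_edge G (ep 0) {LeafU 0, Inner 0 2})
    (swap_edge G eL {LeafU 0, Inner 0 2})"
proof -
  let ?f = "{LeafU 0, Inner 0 2}" and ?t = "transpose (LeafU 0) (Inner 0 1)"
  let ?K1 = "swap_edge G (ep 0) ?f" and ?K2 = "swap_edge G eL ?f"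
  have e: "ep 0 = {EndU, Inner 0 1}" using L3 by (simp add: ep_def pv_Inner)
  have I: "pv 0 1 = Inner 0 1" "pv 0 2 = Inner 0 2" "pv 0 (Suc 0) = Inner 0 1" "pv 0 (Suc (Suc 0)) = Inner 0 2"
    using L3 by (simp_all add: pv_Inner numeral_2_eq_2)
  have nbL: "nb G (LeafU 0) = {EndU}" using n1 by (simp add: nb_LeafU)
  have nbI: "nb G (Inner 0 1) = {EndU, Inner 0 2}" using nb_Inner[of 0 1] L3 I by simp
  have fG: "?f \<notin> edges G"
  proof
    assume "?f \<in> edges G"
    then have "Inner 0 2 \<in> nb G (LeafU 0)" by (simp add: nb_def)
    then show False unfolding nbL by simp
  qed
  have verts: "LeafU 0 \<in> verts G" "Inner 0 1 \<in> verts G" "Inner 0 2 \<in> verts G" using n1 L3 by (auto simp: verts_G)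
  then have f2: "?f \<in> [verts G]\<^bsup>2\<^esup>" by (simp add: nsets_def)
  have E0: "ep 0 \<in> edges G" by (rule ep_edge) simp
  show ?thesis
  proof (rule graph_isoI_involution[OF simple_swap_edge[OF simple_G f2] simple_swap_edge[OF simple_G f2]])
    show "card (edges ?K1) = card (edges ?K2)"
      using card_edges_swap_edge[OF simple_G E0, of ?f] card_edges_swap_edge[OF simple_G eL_edge, of ?f] fG by simp
    show "verts ?K1 = verts ?K2" by simp
    show "?t x \<in> verts ?K1" if "x \<in> verts ?K1" for x using that verts by (auto simp: transpose_def)
    show "?t (?t x) = x" for x by simp
    fix h assume h: "h \<in> edges ?K1"
    have 1: "?f \<in> edges ?K2" by simp
    have "Inner 0 2 \<in> nb G (Inner 0 1)" "Inner 0 1 \<in> nb G EndU"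
      unfolding nbI nb_EndU by simp_all
    then have "{Inner 0 1, Inner 0 2} \<in> edges G" "{EndU, Inner 0 1} \<in> edges G" by (simp_all add: nb_def)
    then have 2: "{Inner 0 1, Inner 0 2} \<in> edges ?K2" "{EndU, Inner 0 1} \<in> edges ?K2"
      by (simp_all add: doubleton_eq_iff)
    show "?t ` h \<in> edges ?K2"
    proof (cases "h = ?f")
      case True
      then have "?t ` h = {Inner 0 1, Inner 0 2}" by simp
      then show ?thesis using 2(1) by simp
    next
      case False
      then have hG: "h \<in> edges G" "h \<noteq> ep 0" using h by auto
      show ?thesis
      proof (cases "LeafU 0 \<in> h \<or> Inner 0 1 \<in> h")
        case False
        then have "?t ` h = h" by (force simp: transpose_def image_iff)
        moreover have "h \<noteq> eL" using False by auto
        ultimately show ?thesis using hG by simp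
      next
        case True
        obtain a b where "h = {a, b}" using simple_edge[OF simple_G hG(1)] by metis
        then obtain y where "h = {LeafU 0, y} \<or> h = {Inner 0 1, y}" using True by auto
        then have "y \<in> nb G (LeafU 0) \<and> h = {LeafU 0, y} \<or> y \<in> nb G (Inner 0 1) \<and> h = {Inner 0 1, y}"
          using hG(1) by (auto simp: nb_def)
        then have "h = {LeafU 0, EndU} \<or> h = {Inner 0 1, EndU} \<or> h = {Inner 0 1, Inner 0 2}"
          unfolding nbL nbI by blast
        then consider "h = {LeafU 0, EndU}" | "h = {Inner 0 1, Inner 0 2}" using hG(2) e by (auto simp: insert_commute)
        then show ?thesis
        proof cases
          case 1
          then have "?t ` h = {EndU, Inner 0 1}" by (simp add: insert_commute)
          then show ?thesis using 2(2) by simp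
        next
          case hh: 2
          then have "?t ` h = ?f" by simp
          then show ?thesis by simp
        qed
      qed
    qed
  qed
qed

end

section \<open>Removing a path edge: bounds for each form of the new edge\<close>

context broom_path_exchange
begin

lemma degs:
  "deg K EndU = n + 2 + (if EndU \<in> f then 1 else 0) - (if j = 0 then 1 else 0)"
  "deg K EndV = n + 2 + (if EndV \<in> f then 1 else 0)"
  "c < 2 \<Longrightarrow> 0 < i \<Longrightarrow> i < L \<Longrightarrow> Inner c i \<notin> e \<Longrightarrow> deg K (Inner c i) = 2 + (if Inner c i \<in> f then 1 else 0)"
  "c < 2 \<Longrightarrow> 0 < i \<Longrightarrow> i < L \<Longrightarrow> Inner c i \<in> e \<Longrightarrow> deg K (Inner c i) = 1 + (if Inner c i \<in> f then 1 else 0)"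
  "k < n \<Longrightarrow> deg K (LeafU k) = 1 + (if LeafU k \<in> f then 1 else 0)"
  "k < n \<Longrightarrow> deg K (LeafV k) = 1 + (if LeafV k \<in> f then 1 else 0)"
proof -
  have mem: "EndU \<in> e \<longleftrightarrow> j = 0" "EndV \<notin> e" "LeafU k \<notin> e" "LeafV k \<notin> e"
    using ep_mem[OF j] unfolding e_def by simp_all
  show "deg K EndU = n + 2 + (if EndU \<in> f then 1 else 0) - (if j = 0 then 1 else 0)"
    using deg_K[of EndU] deg_EndU mem(1) by (simp split: if_splits)
  show "deg K EndV = n + 2 + (if EndV \<in> f then 1 else 0)"
    using deg_K[of EndV] deg_EndV mem(2) by simp
  show "deg K (LeafU k) = 1 + (if LeafU k \<in> f then 1 else 0)" if "k < n"
    using deg_K[of "LeafU k"] deg_LeafU[OF that] mem(3) by simp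
  show "deg K (LeafV k) = 1 + (if LeafV k \<in> f then 1 else 0)" if "k < n"
    using deg_K[of "LeafV k"] deg_LeafV[OF that] mem(4) by simp
  assume "c < 2" "0 < i" "i < L"
  then have d: "deg G (Inner c i) = 2" by (rule deg_Inner)
  show "deg K (Inner c i) = 2 + (if Inner c i \<in> f then 1 else 0)" if "Inner c i \<notin> e"
    using deg_K[of "Inner c i"] d that by simp
  show "deg K (Inner c i) = 1 + (if Inner c i \<in> f then 1 else 0)" if "Inner c i \<in> e"
    using deg_K[of "Inner c i"] d that by simp
qed

text \<open>\<open>EndV\<close> stays one of the two branch vertices of the card. Of the three
  vertices of degree 3 only one more may remain, so the deleted edge joins two of them. As
  \<open>f\<close> avoids \<open>Inner 0 1\<close>, that edge is \<open>f\<close> or the edge from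
  \<open>EndU\<close> to \<open>Inner 1 1\<close>.\<close>

lemma goods_le_2_chord:
  assumes n: "n = 2" and j0: "j = 0" and f: "f = {Inner c i, Inner d k}" "Inner c i \<noteq> Inner d k" "c < 2" "0 < i" "i < L"
    "d < 2" "0 < k" "k < L" "Inner 0 1 \<notin> f"
  shows "card (goods G K) \<le> 2"
proof -
  let ?a = "Inner c i" and ?b = "Inner d k"
  have e: "e = {EndU, Inner 0 1}" using j0 L2 by (simp add: e_def ep_def pv_Inner)
  have mem: "?a \<in> f" "?b \<in> f" "?a \<notin> e" "?b \<notin> e" "EndU \<notin> f" "EndV \<notin> f" using f(1,9) e by auto
  have dd: "deg K EndU = 3" "deg K EndV = 4" "deg K ?a = 3" "deg K ?b = 3"
    using degs(1,2) degs(3)[OF f(3-5)] degs(3)[OF f(6-8)] mem n j0 by simp_all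
  have "goods G K \<subseteq> {f, {EndU, Inner 1 1}}"
  proof
    fix g assume g: "g \<in> goods G K"
    obtain j' u v where p: "g \<in> edges K" "path_profile j' (delete_edge K g) u v" by (rule goods_path[OF g])
    have small: "deg (delete_edge K g) x \<le> 2" if "x \<in> verts G" "x \<notin> {u, v}" for x
      using p(2) that unfolding path_profile_def by simp
    have V: "EndU \<in> verts G" "EndV \<in> verts G" "?a \<in> verts G" "?b \<in> verts G" using f(3-8) by (auto simp: verts_G)
    have "3 \<le> deg (delete_edge K g) EndV" using deg_K_delete[OF p(1), of EndV] dd by (simp split: if_splits)
    then have Vuv: "EndV \<in> {u, v}" using small[OF V(2)] by fastforce
    have inuv: "x \<in> {u, v} \<or> x \<in> g" if "x \<in> verts G" "deg K x = 3" for x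
      using small[OF that(1)] deg_K_delete[OF p(1), of x] that(2) by (cases "x \<in> g") auto
    obtain w where w: "{u, v} \<subseteq> {EndV, w}" using Vuv by blast
    have three: "x \<in> g \<or> x = w" if "x \<in> {EndU, ?a, ?b}" for x
      using inuv[of x] V dd w that by auto
    obtain x y where xy: "g = {x, y}" by (rule K_edge_obtain[OF p(1)])
    have cand: "g = f \<or> g = {EndU, ?a} \<or> g = {EndU, ?b}"
      using three[of EndU] three[of ?a] three[of ?b] f(1,2) xy by auto
    have "Inner c' i' = Inner 1 1" if "g = {EndU, Inner c' i'}" "Inner c' i' \<in> f" for c' i'
    proof -
      have "Inner c' i' \<in> nb K EndU" using p(1) that(1) by (simp add: nb_def)
      then have "Inner c' i' \<in> nb G EndU" using mem(5) by (auto simp: nb_K)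
      then show ?thesis using that(2) f(9) nb_EndU by auto
    qed
    then show "g \<in> {f, {EndU, Inner 1 1}}" using cand mem(1,2) by auto
  qed
  then have "card (goods G K) \<le> card {f, {EndU, Inner 1 1}}" by (intro card_mono) auto
  also have "\<dots> \<le> 2" by (simp add: card_insert_if)
  finally show ?thesis .
qed

text \<open>By \<open>iso_map_twist\<close> this exchange has a shared leaf card, at the edge from
  \<open>Inner 0 1\<close> to \<open>Inner 0 2\<close>, against the precedence of leaf
  cards.\<close>

lemma no_leaf_twist:
  assumes n: "n = 1" and j0: "j = 0" and L3: "3 \<le> L" and f: "f = {LeafU 0, Inner 0 2}"
  shows False
proof -
  let ?g = "{Inner 0 1, Inner 0 2}" and ?t = "transpose (LeafU 0) (Inner 0 1)"
  let ?K2 = "swap_edge G eL f"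
  have s2: "simple_graph ?K2" by (rule simple_swap_edge[OF simple_G f_pair])
  have e0: "e = ep 0" using j0 e_def by simp
  have iso: "iso_map ?t K ?K2" using iso_map_twist[OF L3] unfolding e0 f .
  have fG: "f \<notin> edges G"
  proof
    assume "f \<in> edges G"
    then have "Inner 0 2 \<in> nb G (LeafU 0)" unfolding f by (simp add: nb_def)
    then show False using n1 by (simp add: nb_LeafU)
  qed
  have dK2: "deg ?K2 x + (if x \<in> eL then 1 else 0) = deg G x + (if x \<in> f then 1 else 0)" for x
    by (rule deg_swap_edge[OF simple_G eL_edge f_pair]) (use fG in simp)
  have dG: "deg G (LeafU 0) = 1" "deg G (Inner 0 2) = 2" using n1 L3 by (simp_all add: deg_G)
  have mem: "LeafU 0 \<in> f" "Inner 0 2 \<in> f" unfolding f by simp_all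
  have dd: "deg ?K2 (LeafU 0) = 1" "deg ?K2 (Inner 0 2) = 3"
    using dK2[of "LeafU 0"] dK2[of "Inner 0 2"] dG mem by simp_all
  have "{LeafU 0, Inner 0 2} \<in> edges ?K2" unfolding f by simp
  from edge_degree_eq[OF s2 this] have "edge_degree ?K2 f = edge_degree G eL"
    using dd edge_degree_eL n unfolding f[symmetric] by simp
  then have c2: "da_ecard ?K2 f = da_ecard G eL"
    using delete_swap_edge[of f G eL] fG by (simp add: da_ecard_def)
  have "{Inner 0 1, Inner 0 2} \<in> edges G" using path_edge[of 0 1] L3 by (simp add: pv_Inner numeral_2_eq_2)
  moreover have "?g \<noteq> e" using L3 by (auto simp: e0 ep_def pv_Inner doubleton_eq_iff)
  ultimately have h: "?g \<in> edges K" by simp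
  have "?t ` ?g = f" unfolding f by simp
  then have "da_ecard K ?g = da_ecard G eL"
    using iso_map_da_ecard[OF simple_K s2 iso h] c2 by simp
  then show False using no_leaf[OF h] by simp
qed

lemma path_bound_inner:
  assumes j0: "0 < j"
  shows "card (goods G K) \<le> (if n = 1 then 4 else if 3 \<le> n \<and> L = 3 then 1 else 2)"
proof -
  obtain h where h: "h \<in> {EndU, EndV}" "h \<notin> f" "deg K h = n + 2" "card (leaves K h) < n"
    using deficient_inner_edge[OF j0] by blast
  have hv: "h \<in> verts G" using h(1) by (auto simp: verts_G)
  define m where "m = card (goods G K)"
  have "m \<le> 4" unfolding m_def using goods_le_4[OF hv _ h(4)] h(3) n1 by simp
  moreover have "m \<le> 2" if "n \<noteq> 1" unfolding m_def using goods_le_2[OF hv _ h(4)] h(3) n1 that by simp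
  moreover have "m \<le> 1" if "3 \<le> n" "L = 3"
    unfolding m_def using card_mono[OF _ goods_le_1[OF that(2,1) h(1,2) _ h(4)]] h(3) by simp
  ultimately have "m \<le> (if n = 1 then 4 else if 3 \<le> n \<and> L = 3 then 1 else 2)" by simp
  then show ?thesis unfolding m_def .
qed

lemma path_bound_end:
  assumes j0: "j = 0" and L3: "3 \<le> L"
  shows "card (goods G K) \<le> (if n = 1 then 4 else if 3 \<le> n \<and> L = 3 then 1 else 2)"
proof -
  have e: "e = {EndU, Inner 0 1}" using j0 L2 by (simp add: e_def ep_def pv_Inner)
  have Ve: "EndV \<notin> e" "Inner 0 (L - 1) \<notin> e" using e L3 by auto
  have EV: "EndV \<in> verts G" by (simp add: verts_G)
  \<comment> \<open>The inner end of \<open>f\<close> has degree 3 and no leaf. The excluded pair,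
    \<open>LeafU 0\<close> with \<open>Inner 0 2\<close>, is the one in which
    \<open>Inner 0 1\<close> would be a leaf there.\<close>
  have hub: "card (goods G K) \<le> 4"
    if n: "n = 1" and f: "f = {y, Inner c i}" "c < 2" "0 < i" "i < L" "Inner c i \<noteq> Inner 0 1"
      and y: "y = Inner 0 1 \<or> y = LeafU 0 \<and> Inner c i \<noteq> Inner 0 2" for y c i
  proof -
    let ?h = "Inner c i"
    have he: "?h \<notin> e" using f(5) e by simp
    have dh: "deg K ?h = 3" using degs(3)[OF f(2-4) he] f(1) by simp
    have hv: "?h \<in> verts G" using f(2-4) by (auto simp: verts_G)
    have "leaves K ?h = {}"
    proof (rule ccontr)
      assume "leaves K ?h \<noteq> {}"
      then obtain z where z: "z \<in> nb K ?h" "deg K z = 1" by (auto simp: leaves_def)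
      have "z \<in> verts G" using z(1) nb_subset_verts[OF simple_K] by auto
      from deg_K_one[OF z(2) this] have zf: "z \<notin> f" and zc: "z \<in> e \<or> (\<exists>i<n. z = LeafU i) \<or> (\<exists>i<n. z = LeafV i)"
        by auto
      have "{?h, z} \<noteq> f" using zf by auto
      then have zG: "z \<in> nb G ?h" using z(1) by (simp add: nb_K)
      then have "z \<in> {pv c (i - 1), pv c (Suc i)}" using nb_Inner[OF f(2-4)] by simp
      then have "z \<in> e" using zc pv_not_leaf by auto
      then consider "z = EndU" | "z = Inner 0 1" using e by auto
      then show False
      proof cases
        case 1
        then have "EndU \<notin> f" using zf by simp
        then show False using degs(1) z(2) 1 n j0 by simp
      next
        case 2
        then have "y \<noteq> Inner 0 1" using zf f(1) by auto
        then have "?h \<noteq> Inner 0 2" using y by simp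
        moreover have "?h \<in> nb G (Inner 0 1)" using zG 2 nb_sym[of z G ?h] by simp
        then have "?h \<in> {EndU, pv 0 2}" using nb_Inner[of 0 1] L3 by (simp add: numeral_2_eq_2)
        moreover have "pv 0 2 = Inner 0 2" using L3 by (simp add: pv_Inner)
        ultimately show False by simp
      qed
    qed
    then show ?thesis using goods_le_4[OF hv] dh n by simp
  qed
  show ?thesis
  proof (rule f_end_edge[OF j0])
    fix i assume f: "f = {EndU, LeafV i}" "i < n"
    have Vf: "EndV \<notin> f" "LeafV i \<in> f" using f by auto
    note h = deficient_EndV[OF Vf(1) Ve Vf(2) f(2)]
    define m where "m = card (goods G K)"
    have "m \<le> 4" unfolding m_def using goods_le_4[OF EV _ h(2)] h(1) n1 by simp
    moreover have "m \<le> 2" if "n \<noteq> 1" unfolding m_def using goods_le_2[OF EV _ h(2)] h(1) n1 that by simp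
    moreover have "m \<le> 1" if "3 \<le> n" "L = 3"
      unfolding m_def using card_mono[OF _ goods_le_1[OF that(2,1) _ Vf(1) _ h(2)]] h(1) by simp
    ultimately have "m \<le> (if n = 1 then 4 else if 3 \<le> n \<and> L = 3 then 1 else 2)" by simp
    then show ?thesis unfolding m_def .
  next
    fix c i d k
    assume f: "n = 2" "f = {Inner c i, Inner d k}" "Inner c i \<noteq> Inner d k" "c < 2" "0 < i" "i < L" "d < 2" "0 < k" "k < L"
      "Inner 0 1 \<notin> f"
    show ?thesis using goods_le_2_chord[OF f(1) j0 f(2-10)] f(1) by simp
  next
    fix c i assume f: "n = 1" "f = {Inner 0 1, Inner c i}" "c < 2" "0 < i" "i < L" "Inner c i \<noteq> Inner 0 1"
    show ?thesis using hub[OF f] f(1) by simp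
  next
    fix c i assume f: "n = 1" "f = {LeafU 0, Inner c i}" "c < 2" "0 < i" "i < L" "Inner c i \<noteq> Inner 0 1"
    have "Inner c i \<noteq> Inner 0 2" using no_leaf_twist[OF f(1) j0 L3] f(2) by auto
    then show ?thesis using hub[OF f] f(1) by simp
  next
    fix c i assume f: "n = 1" "f = {LeafV 0, Inner c i}" "c < 2" "0 < i" "i < L" "Inner c i \<noteq> Inner 0 1"
    have Vf: "EndV \<notin> f" "LeafV 0 \<in> f" "0 < n" using f by auto
    note h = deficient_EndV[OF Vf(1) Ve Vf(2,3)]
    have "card (goods G K) \<le> 4" using goods_le_4[OF EV _ h(2)] h(1) n1 by simp
    then show ?thesis using f(1) by simp
  qed
qed

text \<open>For L = 2 and n = 1 every path card has edge degree 3, and all degrees of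
  \<open>K\<close> lie between 1 and 3, so the ends of the deleted edge have degrees 3 and
  2.\<close>

lemma goods_edge_L2:
  assumes L: "L = 2" and n: "n = 1" and g: "g \<in> goods G K"
  obtains x h where "g = {h, x}" "deg K h = 3" "deg K x = 2" "h \<in> verts G" "x \<in> verts G" "x \<in> nb K h" "g \<in> edges K"
proof -
  obtain j' u v where p: "g \<in> edges K" "j' \<le> L - 2" "edge_degree K g = (if j' = 0 then n + 2 else 2)"
    by (rule goods_path[OF g])
  then have ed: "edge_degree K g = 3" using L n by simp
  obtain x y where xy: "g = {x, y}" "x \<in> verts G" "y \<in> verts G" "edge_degree K g + 2 = deg K x + deg K y"
    by (rule K_edge_obtain[OF p(1)])
  have le3: "1 \<le> deg K z \<and> deg K z \<le> 3" if "z \<in> verts G" for z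
  proof -
    have j0: "j = 0" using j L by simp
    then have e: "e = {EndU, Inner 0 1}" using L2 by (simp add: e_def ep_def pv_Inner)
    have nm: "\<not> (EndV \<in> f)" "\<not> (EndU \<in> f \<and> 3 < deg K EndU)"
      using degs(1) n j0 by (rule_tac f_end_edge[OF j0]; auto)+
    show ?thesis using that
    proof (cases rule: vert_cases)
      case 1
      then show ?thesis using degs(1) nm n j0 by auto
    next
      case 2
      then show ?thesis using degs(2) nm n by auto
    next
      case (3 c i)
      then show ?thesis using degs(3)[of c i] degs(4)[of c i] by (cases "Inner c i \<in> e") auto
    next
      case (4 i)
      then show ?thesis using degs(5)[of i] by auto
    next
      case (5 i)
      then show ?thesis using degs(6)[of i] by auto
    qed
  qed
  have sum: "deg K x + deg K y = 5" using xy(4) ed by simp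
  have n': "y \<in> nb K x" "x \<in> nb K y" using p(1) xy(1) by (simp_all add: nb_def insert_commute)
  show thesis
  proof (cases "deg K x = 3")
    case True
    then show thesis using that[of x y] xy n' p(1) sum by simp
  next
    case False
    then have d: "deg K y = 3" "deg K x = 2" using sum le3[OF xy(2)] le3[OF xy(3)] by linarith+
    have "g = {y, x}" using xy(1) by (simp add: insert_commute)
    from that[OF this d xy(3,2) n'(2) p(1)] show thesis .
  qed
qed

lemma card_le_2_if_subset: "A \<subseteq> set [x, y] \<Longrightarrow> card A \<le> 2"
  using card_mono[of "set [x, y]" A] card_length[of "[x, y]"] by simp

text \<open>The new edge closes a triangle of \<open>EndV\<close>, \<open>Inner 1 1\<close> and
  \<open>y\<close>. Shared edges join a vertex of degree 3 to one of degree 2, and only the two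
  triangle edges at \<open>y\<close> also produce enough leaves.\<close>

lemma goods_triangle_L2:
  assumes L: "L = 2" and n: "n = 1" and y: "y = Inner 0 1 \<or> y = LeafV 0" and f: "f = {y, Inner 1 1}"
  shows "card (goods G K) \<le> 2"
proof -
  have j0: "j = 0" using j L by simp
  have e: "e = {EndU, Inner 0 1}" using j0 L2 by (simp add: e_def ep_def pv_Inner)
  have L1: "L - 1 = 1" using L by simp
  have mem: "EndU \<notin> f" "EndV \<notin> f" "Inner 1 1 \<in> f" "LeafU 0 \<notin> f" "y \<in> f" "Inner 1 1 \<notin> e" "Inner 0 1 \<in> e"
    using f y e by auto
  have dd: "deg K EndU = 2" "deg K EndV = 3" "deg K (Inner 1 1) = 3" "deg K (LeafU 0) = 1" "deg K y = 2"
    using degs(1,2) degs(3)[of 1 1] degs(5,6)[of 0] degs(4)[of 0 1] mem y n L2 j0 by auto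
  have dy: "deg K x = 1" if "x \<in> {Inner 0 1, LeafV 0}" "x \<noteq> y" for x
  proof -
    have "x \<notin> f" using that f by auto
    then show ?thesis using that degs(4)[of 0 1] degs(6)[of 0] mem n L2 by auto
  qed
  have nbV: "nb K EndV = {Inner 0 1, Inner 1 1, LeafV 0}"
  proof -
    have "LeafV ` {..<n} = {LeafV 0}" using n by auto
    then have "nb G EndV = {Inner 0 1, Inner 1 1, LeafV 0}" unfolding nb_EndV L1 by auto
    moreover have "EndV \<notin> e" using e by simp
    ultimately show ?thesis using nb_K_out[OF mem(2)] by simp
  qed
  have "goods G K \<subseteq> set [{EndV, y}, {Inner 1 1, y}]"
  proof
    fix g assume g: "g \<in> goods G K"
    obtain x h where x: "g = {h, x}" "deg K h = 3" "deg K x = 2" "h \<in> verts G" "x \<in> verts G" "x \<in> nb K h" "g \<in> edges K"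
      by (rule goods_edge_L2[OF L n g])
    have xc: "x = EndU \<or> x = y" using x(5)
    proof (cases rule: vert_cases)
      case (3 c i)
      then have "x = Inner 0 1 \<or> x = Inner 1 1" using L by (auto simp: less_2)
      then show ?thesis using dd dy[of x] x(3) by auto
    next
      case (4 i)
      then show ?thesis using dd x(3) n by auto
    next
      case (5 i)
      then show ?thesis using dy[of x] x(3) n by auto
    qed (use dd x(3) in auto)
    have hc: "h = EndV \<or> h = Inner 1 1" using x(4)
    proof (cases rule: vert_cases)
      case (3 c i)
      then have "h = Inner 0 1 \<or> h = Inner 1 1" using L by (auto simp: less_2)
      then show ?thesis using dd dy[of h] x(2) by (cases "h = y") auto
    next
      case (4 i)
      then show ?thesis using dd x(2) n by auto
    next
      case (5 i)
      then show ?thesis using dd dy[of h] x(2) n by (cases "h = y") auto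
    qed (use dd x(2) in auto)
    \<comment> \<open>The remaining candidate joins \<open>EndU\<close> to \<open>Inner 1 1\<close>.
      Without it \<open>EndV\<close> is the vertex of degree 3, and it has fewer than the two leaves
      that a card of \<open>G\<close> has there for L = 2.\<close>
    have "x \<noteq> EndU"
    proof
      assume xU: "x = EndU"
      then have "h \<noteq> EndV" using x(6) nbV by auto
      then have gg: "g = {Inner 1 1, EndU}" using hc x(1) xU by auto
      obtain j' u v where p: "path_profile j' (delete_edge K g) u v" by (rule goods_path[OF g])
      have small: "deg (delete_edge K g) z \<le> 2" if "z \<in> verts G" "z \<notin> {u, v}" for z
        using p that unfolding path_profile_def by simp
      have v3: "deg (delete_edge K g) v = 3" "v \<in> verts G" "2 \<le> card (leaves (delete_edge K g) v)"
        using p n L unfolding path_profile_def by simp_all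
      have dK: "deg K v = deg (delete_edge K g) v + (if v \<in> g then 1 else 0)" by (rule deg_K_delete[OF x(7)])
      have vE: "v = EndV" using v3(2)
      proof (cases rule: vert_cases)
        case (3 c i)
        then have "v = Inner 0 1 \<or> v = Inner 1 1" using L by (auto simp: less_2)
        then show ?thesis using dd dy[of v] v3(1) dK gg by (cases "v = y") auto
      next
        case (4 i)
        then show ?thesis using dd v3(1) dK n by auto
      next
        case (5 i)
        then show ?thesis using dd dy[of v] v3(1) dK n by (cases "v = y") auto
      qed (use dd v3(1) dK in auto)
      have "y \<notin> g" using gg y by auto
      then have d2: "deg (delete_edge K g) y = 2" "deg (delete_edge K g) (Inner 1 1) = 2"
        using deg_K_delete[OF x(7), of y] deg_K_delete[OF x(7), of "Inner 1 1"] dd(3,5) gg by simp_all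
      define q where "q = (if y = Inner 0 1 then LeafV 0 else Inner 0 1)"
      have "leaves (delete_edge K g) v \<subseteq> {q}"
      proof
        fix z assume "z \<in> leaves (delete_edge K g) v"
        then have z: "z \<in> nb K EndV" "deg (delete_edge K g) z = 1"
          unfolding vE by (simp_all add: leaves_def nb_delete_iff)
        have "z \<noteq> y" "z \<noteq> Inner 1 1" using z(2) d2 by auto
        moreover have "z \<in> {Inner 0 1, Inner 1 1, LeafV 0}" using z(1) unfolding nbV .
        ultimately show "z \<in> {q}" using y by (auto simp: q_def)
      qed
      then have "card (leaves (delete_edge K g) v) \<le> 1" using card_mono[of "{q}"] by fastforce
      then show False using v3(3) by simp
    qed
    then show "g \<in> set [{EndV, y}, {Inner 1 1, y}]" using xc hc x(1) by auto
  qed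
  then show ?thesis by (rule card_le_2_if_subset)
qed

text \<open>For L = 2 the new edge from \<open>EndU\<close> to a leaf at \<open>EndV\<close> gives
  \<open>G\<close> again, since that leaf is a twin of \<open>Inner 0 1\<close> in
  \<open>G - e\<close>. A chord is impossible, because \<open>Inner 1 1\<close> is the only other
  inner vertex. What remains has n = 1 and a triangle through \<open>Inner 1 1\<close>.\<close>

lemma path_bound_2:
  assumes L: "L = 2"
  shows "n = 1" "card (goods G K) \<le> 2"
proof -
  have j0: "j = 0" using j L by simp
  have e: "e = {EndU, Inner 0 1}" using j0 L2 by (simp add: e_def ep_def pv_Inner)
  have L1: "L - 1 = 1" using L by simp
  have nbI: "nb G (Inner c 1) = {EndU, EndV}" if "c < 2" for c
  proof -
    have "Suc 1 = L" using L by simp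
    have "nb G (Inner c 1) = {pv c (1 - 1), pv c (Suc 1)}" by (rule nb_Inner) (use that L2 in auto)
    then show ?thesis unfolding \<open>Suc 1 = L\<close> by simp
  qed
  have n_and: "n = 1 \<and> card (goods G K) \<le> 2"
  proof (rule f_end_edge[OF j0])
    fix i assume f: "f = {EndU, LeafV i}" "i < n"
    have f': "f = {LeafV i, EndU}" using f by auto
    have e': "e = {Inner 0 1, EndU}" using e by auto
    have "nb (delete_edge G e) (LeafV i) = {EndV}"
      using nb_LeafV[OF f(2)] e by (auto simp: nb_delete_edge)
    moreover have "nb (delete_edge G e) (Inner 0 1) = {EndV}"
      using nbI[of 0] e by (auto simp: nb_delete_edge doubleton_eq_iff)
    moreover have "LeafV i \<in> verts G" "Inner 0 1 \<in> verts G" using f L2 by (auto simp: verts_G)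
    ultimately have "graph_iso G K" by (intro iso_by_twins[OF f' e']) auto
    then show ?thesis using not_iso by simp
  next
    fix c i d k
    assume f: "n = 2" "f = {Inner c i, Inner d k}" "Inner c i \<noteq> Inner d k" "c < 2" "0 < i" "i < L" "d < 2" "0 < k" "k < L"
      "Inner 0 1 \<notin> f"
    have "i = 1" "k = 1" using f L by auto
    then have "c = 1" "d = 1" using f by (auto simp: less_2)
    then show ?thesis using f \<open>i = 1\<close> \<open>k = 1\<close> by simp
  next
    fix c i assume f: "n = 1" "f = {LeafU 0, Inner c i}" "c < 2" "0 < i" "i < L" "Inner c i \<noteq> Inner 0 1"
    have "i = 1" "c = 1" using f L by (auto simp: less_2)
    then have ff: "f = {LeafU 0, Inner 1 1}" using f by simp
    have dd: "deg K EndU = 2" "deg K EndV = 3" "deg K (Inner 1 1) = 3" "deg K (Inner 0 1) = 1" "deg K (LeafU 0) = 2" "deg K (LeafV 0) = 1"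
      using degs(1,2) degs(3)[of 1 1] degs(4)[of 0 1] degs(5,6)[of 0] ff e f(1) L2 j0 by simp_all
    have "goods G K \<subseteq> set [{Inner 1 1, EndU}, {Inner 1 1, LeafU 0}]"
    proof
      fix g assume "g \<in> goods G K"
      then obtain x h where x: "g = {h, x}" "deg K h = 3" "deg K x = 2" "h \<in> verts G" "x \<in> verts G" "x \<in> nb K h" "g \<in> edges K"
        by (rule goods_edge_L2[OF L f(1)])
      have xc: "x = EndU \<or> x = LeafU 0" using x(5,3) dd L f(1) by (cases rule: vert_cases) (auto simp: less_2)
      have "h = EndV \<or> h = Inner 1 1" using x(4,2) dd L f(1) by (cases rule: vert_cases) (auto simp: less_2)
      moreover have "\<not> (h = EndV)"
      proof
        assume hV: "h = EndV"
        have "EndV \<notin> f" "EndV \<notin> e" using ff e by simp_all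
        then have "nb K EndV = nb G EndV" by (rule nb_K_out)
        then have "x \<in> nb G EndV" using x(6) unfolding hV by simp
        then show False using xc nb_EndV by auto
      qed
      ultimately show "g \<in> set [{Inner 1 1, EndU}, {Inner 1 1, LeafU 0}]" using x(1) xc by auto
    qed
    from conjI[OF f(1) card_le_2_if_subset[OF this]] show ?thesis .
  next
    fix c i assume f: "n = 1" "f = {Inner 0 1, Inner c i}" "c < 2" "0 < i" "i < L" "Inner c i \<noteq> Inner 0 1"
    have "i = 1" "c = 1" using f L by (auto simp: less_2)
    then show ?thesis using goods_triangle_L2[OF L f(1), of "Inner 0 1"] f by simp
  next
    fix c i assume f: "n = 1" "f = {LeafV 0, Inner c i}" "c < 2" "0 < i" "i < L" "Inner c i \<noteq> Inner 0 1"
    have "i = 1" "c = 1" using f L by (auto simp: less_2)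
    then show ?thesis using goods_triangle_L2[OF L f(1), of "LeafV 0"] f by simp
  qed
  then show "n = 1" "card (goods G K) \<le> 2" by auto
qed

end

section \<open>The upper bound for all graphs\<close>

context broom
begin

text \<open>The largest number of da-ecards that a graph not isomorphic to \<open>G\<close> can
  share with \<open>G\<close>, so one less than \<open>adern\<close>.\<close>

definition max_common :: nat where
  "max_common = (if n = 1 \<and> 3 \<le> L then 4 else if (n \<in> {2, 3} \<and> L = 2) \<or> (3 \<le> n \<and> L = 3) then 1
    else if 4 \<le> n \<and> L = 2 then 0 else 2)"

lemma card_goods_le:
  fixes H :: "nat ugraph"
  assumes H: "simple_graph H" "\<not> graph_iso G H"
  shows "card (goods G H) \<le> max_common"
proof (cases "goods G H = {}")
  case False
  obtain e f where ef: "e = eL \<or> (\<exists>j\<le>L - 2. e = ep j) \<and> (\<forall>g\<in>edges H. da_ecard H g \<noteq> da_ecard G eL)"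
    "f \<in> [verts G]\<^bsup>2\<^esup>" "f \<notin> edges G - {e}" "graph_iso (swap_edge G e f) H"
    "edge_degree (swap_edge G e f) f = edge_degree G e"
    by (rule shared_card_reduction[OF H(1) False])
  let ?K = "swap_edge G e f"
  have e: "e \<in> edges G" using ef(1) eL_edge ep_edge by auto
  have K: "simple_graph ?K" by (rule simple_swap_edge[OF simple_G ef(2)])
  have eq: "card (goods G H) = card (goods G ?K)" by (rule goods_iso[OF K H(1) ef(4), symmetric])
  have nK: "\<not> graph_iso G ?K" using H(2) graph_iso_trans ef(4) by blast
  interpret X: broom_exchange n L e f by unfold_locales (fact e ef)+
  consider "e = eL" | j where "j \<le> L - 2" "e = ep j" "\<forall>g\<in>edges H. da_ecard H g \<noteq> da_ecard G eL"
    using ef(1) by blast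
  then show ?thesis
  proof cases
    case 1
    interpret Y: broom_leaf_exchange n L e f by unfold_locales (fact 1 nK)+
    define m where "m = card (goods G ?K)"
    have "m \<le> max_common"
    proof (cases "n = 1")
      case True
      have "m \<le> 4" "L = 2 \<Longrightarrow> m \<le> 2" using Y.leaf_bound_1[OF True] unfolding m_def by simp_all
      then show ?thesis using True L2 unfolding max_common_def by auto
    next
      case False
      then have n: "2 \<le> n" using n1 by simp
      have "n \<le> 3" "m \<le> 2" "n = 3 \<or> L = 2 \<Longrightarrow> m \<le> 1" using Y.leaf_bound[OF n] unfolding m_def by simp_all
      then show ?thesis using n L2 unfolding max_common_def by auto
    qed
    then show ?thesis unfolding eq m_def .
  next
    case (2 j)
    \<comment> \<open>The absence of leaf cards was obtained for \<open>H\<close> and is carried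
      back along the isomorphism to the exchanged graph.\<close>
    have no: "da_ecard ?K g \<noteq> da_ecard G eL" if "g \<in> edges ?K" for g
    proof -
      obtain t where t: "iso_map t ?K H" using ef(4) graph_iso_iff by blast
      show ?thesis using iso_map_da_ecard[OF K H(1) t that] iso_map_edge[OF t that] 2(3) by metis
    qed
    interpret Y: broom_path_exchange n L e f j by unfold_locales (fact 2(1,2) no nK)+
    show ?thesis
    proof (cases "L = 2")
      case True
      then show ?thesis using Y.path_bound_2[OF True] unfolding eq max_common_def by simp
    next
      case False
      then have "3 \<le> L" using L2 by simp
      then have "card (goods G ?K) \<le> (if n = 1 then 4 else if 3 \<le> n \<and> L = 3 then 1 else 2)"
        using Y.path_bound_inner Y.path_bound_end by (cases "j = 0") auto
      also have "\<dots> \<le> max_common" using \<open>3 \<le> L\<close> n1 unfolding max_common_def by auto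
      finally show ?thesis unfolding eq .
    qed
  qed
qed simp

subsection \<open>Graphs sharing many da-ecards with the broom\<close>

text \<open>In \<open>G\<close> the vertices of degree at least 3 are the two ends, and each has n
  leaves.\<close>

lemma not_iso_if_few_leaves:
  assumes K: "simple_graph K" "h \<in> verts K" "3 \<le> deg K h" "card (leaves K h) < n"
  shows "\<not> graph_iso G K"
proof
  assume "graph_iso G K"
  then obtain s where s: "iso_map s G K" using graph_iso_iff by blast
  obtain x where x: "x \<in> verts G" "h = s x" using K(2) iso_map_image[OF s] by blast
  have dx: "3 \<le> deg G x" "card (leaves G x) < n"
    using K(3,4) iso_map_deg[OF simple_G K(1) s x(1)] iso_map_card_leaves[OF simple_G K(1) s x(1)] x(2) by simp_all
  have "LeafU ` {..<n} \<subseteq> leaves G EndU" "LeafV ` {..<n} \<subseteq> leaves G EndV"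
    by (auto simp: leaves_def nb_EndU nb_EndV deg_G)
  from this[THEN card_mono[OF finite_leaves[OF simple_G]]]
  have "n \<le> card (leaves G EndU)" "n \<le> card (leaves G EndV)" by (simp_all add: card_image inj_on_def)
  then show False using dx by (cases rule: vert_cases[OF x(1)]) (auto simp: deg_G)
qed

lemma not_iso_if_isolated:
  assumes K: "simple_graph K" "x \<in> verts K" "deg K x = 0"
  shows "\<not> graph_iso G K"
proof
  assume "graph_iso G K"
  then obtain s where s: "iso_map s G K" using graph_iso_iff by blast
  obtain y where y: "y \<in> verts G" "x = s y" using K(2) iso_map_image[OF s] by blast
  then have "deg G y = 0" using K(3) iso_map_deg[OF simple_G K(1) s y(1)] by simp
  then show False by (cases rule: vert_cases[OF y(1)]) (auto simp: deg_G)
qed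

text \<open>Any two distinct vertices of degree at least 3 in \<open>G\<close> are its ends, and
  \<open>pot\<close> shows that these are not joined by a walk shorter than L.\<close>

lemma not_iso_if_close_hubs:
  assumes K: "simple_graph K" "u \<in> verts K" "v \<in> verts K" "u \<noteq> v" "3 \<le> deg K u" "3 \<le> deg K v" "walk K m u v" "m < L"
  shows "\<not> graph_iso G K"
proof
  assume "graph_iso G K"
  then obtain s where s: "iso_map s G K" using graph_iso_iff by blast
  obtain x y where xy: "x \<in> verts G" "u = s x" "y \<in> verts G" "v = s y" using K(2,3) iso_map_image[OF s] by blast
  have hub: "z \<in> {EndU, EndV}" if "z \<in> verts G" "3 \<le> deg G z" for z
    using that by (cases rule: vert_cases) (auto simp: deg_G)
  have "x \<in> {EndU, EndV}" "y \<in> {EndU, EndV}"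
    using hub[of x] hub[of y] xy K(5,6) iso_map_deg[OF simple_G K(1) s] by simp_all
  moreover have "x \<noteq> y" using K(4) xy by auto
  moreover have w: "walk G m x y" using walk_iso_iff[OF simple_G K(1) s xy(1,3)] K(7) xy by simp
  ultimately have "walk G m EndU EndV" using walk_sym[OF w] w by auto
  then have "pot EndV \<le> pot EndU + int m" by (intro walk_potential[OF pot_nb])
  then show False using K(8) by (simp add: pot_def)
qed

abbreviation sharing :: "nat \<Rightarrow> bool" where
  "sharing m \<equiv> \<exists>S K. simple_graph (K :: broom_vertex ugraph) \<and> \<not> graph_iso G K
    \<and> S \<subseteq># da_edeck G \<and> S \<subseteq># da_edeck K \<and> size S = m"

lemma da_ecard_symmetric:
  assumes "iso_map s G G" "e \<in> edges G"
  shows "da_ecard G (s ` e) = da_ecard G e"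
  by (rule iso_map_da_ecard[OF simple_G simple_G assms])

lemma sharing_1:
  assumes "broom_exchange n L e f" "\<not> graph_iso G (swap_edge G e f)"
  shows "sharing 1"
proof -
  interpret X: broom_exchange n L e f by fact
  obtain S where "S \<subseteq># da_edeck G" "S \<subseteq># da_edeck X.K" "size S = length [e]"
    by (rule common_subset_of_edges[OF simple_G X.simple_K, of "[e]" "[f]"]) (use X.e_edge X.da_ecard_f in auto)
  then show ?thesis using X.simple_K assms(2) by (metis length_0_conv length_Cons One_nat_def)
qed

text \<open>
  If \<open>x\<close> and \<open>y\<close> become twins after the exchange, then the new edge at \<open>x\<close> and the edge
  at \<open>y\<close> have the same da-ecard.
\<close>

lemma sharing_2_twins:
  assumes "broom_exchange n L e {x, z}" "\<not> graph_iso G (swap_edge G e {x, z})"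
    and tw: "nb (swap_edge G e {x, z}) x = nb (swap_edge G e {x, z}) y" and xyz: "x \<noteq> y" "z \<noteq> x" "z \<noteq> y" "y \<in> verts G"
    and e': "e' \<in> edges G" "e' \<noteq> e" "da_ecard G e' = da_ecard G e"
  shows "sharing 2"
proof -
  interpret X: broom_exchange n L e "{x, z}" by fact
  let ?f = "{x, z}" and ?g = "{y, z}"
  have "x \<in> verts X.K" using simple_edge_mem(2)[OF X.simple_K X.f_in_K] .
  then have iso: "iso_map (transpose x y) X.K X.K"
    using iso_map_twins[OF X.simple_K tw] xyz(4) by simp
  have im: "transpose x y ` ?f = ?g" using xyz by simp
  have g: "?g \<in> edges X.K" using iso_map_edge[OF iso X.f_in_K] im by simp
  have cg: "da_ecard X.K ?g = da_ecard X.K ?f"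
    using iso_map_da_ecard[OF X.simple_K X.simple_K iso X.f_in_K] im by simp
  have ne: "?f \<noteq> ?g" using xyz by (auto simp: doubleton_eq_iff)
  obtain S where "S \<subseteq># da_edeck G" "S \<subseteq># da_edeck X.K" "size S = length [e, e']"
  proof (rule common_subset_of_edges[OF simple_G X.simple_K, of "[e, e']" "[?f, ?g]"])
    show "distinct [e, e']" "distinct [?f, ?g]" using e'(2) ne by auto
    show "set [e, e'] \<subseteq> edges G" using X.e_edge e'(1) by simp
    show "set [?f, ?g] \<subseteq> edges X.K" using g X.f_in_K by (simp only: list.set insert_subset empty_subsetI simp_thms)
    show "map (da_ecard G) [e, e'] = map (da_ecard X.K) [?f, ?g]"
      using X.da_ecard_f cg e'(3) by (simp only: list.map)
  qed
  then show ?thesis using X.simple_K assms(2) by (intro exI[of _ S] exI[of _ X.K]) simp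
qed

lemma broom_exchangeI:
  assumes "e \<in> edges G" "a \<noteq> b" "a \<in> verts G" "b \<in> verts G" "{a, b} \<notin> edges G"
    and "deg (swap_edge G e {a, b}) a + deg (swap_edge G e {a, b}) b = edge_degree G e + 2"
  shows "broom_exchange n L e {a, b}"
proof
  show f: "{a, b} \<in> [verts G]\<^bsup>2\<^esup>" using assms(2-4) by (simp add: nsets_def)
  show "e \<in> edges G" "{a, b} \<notin> edges G - {e}" using assms(1,5) by auto
  show "edge_degree (swap_edge G e {a, b}) {a, b} = edge_degree G e"
    using edge_degree_eq[OF simple_swap_edge[OF simple_G f], of a b e] assms(6) by simp
qed

lemma deg_exchange:
  assumes "e \<in> edges G" "a \<noteq> b" "a \<in> verts G" "b \<in> verts G" "{a, b} \<notin> edges G"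
  shows "deg (swap_edge G e {a, b}) x + (if x \<in> e then 1 else 0) = deg G x + (if x = a \<or> x = b then 1 else 0)"
proof -
  have "{a, b} \<in> [verts G]\<^bsup>2\<^esup>" using assms(2-4) by (simp add: nsets_def)
  from deg_swap_edge[OF simple_G assms(1) this, of x] assms(5) show ?thesis by simp
qed

lemma leaf_not_adjacent: "i < n \<Longrightarrow> x \<noteq> EndU \<Longrightarrow> {LeafU i, x} \<notin> edges G"
  using nb_LeafU[of i] by (auto simp: nb_def)

text \<open>The new edge raises both degrees by one, so the sum n + 1 becomes n + 3, as the edge
  degree n + 1 of a leaf edge requires. The result is not \<open>G\<close>, since
  \<open>LeafU 0\<close> stays isolated.\<close>

lemma sharing_leaf_exchange:
  assumes "a \<noteq> b" "a \<in> verts G" "b \<in> verts G" "{a, b} \<notin> edges G" "a \<notin> eL" "b \<notin> eL" "deg G a + deg G b = n + 1"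
  shows "broom_exchange n L eL {a, b}" "\<not> graph_iso G (swap_edge G eL {a, b})"
proof -
  note d = deg_exchange[OF eL_edge assms(1-4)]
  show X: "broom_exchange n L eL {a, b}"
    by (rule broom_exchangeI[OF eL_edge assms(1-4)])
      (use d[of a] d[of b] assms(5-7) edge_degree_eL in simp)
  interpret X: broom_exchange n L eL "{a, b}" by fact
  have "LeafU 0 \<in> verts X.K" using n1 by (simp add: verts_G)
  moreover have "deg X.K (LeafU 0) = 0" using d[of "LeafU 0"] assms(5,6) n1 by (auto simp: deg_G split: if_splits)
  ultimately show "\<not> graph_iso G X.K" by (rule not_iso_if_isolated[OF X.simple_K])
qed

lemma Inner_in_verts: "c < 2 \<Longrightarrow> 0 < i \<Longrightarrow> i < L \<Longrightarrow> Inner c i \<in> verts G"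
  by (auto simp: verts_G)

lemma Inner_edge_path:
  assumes "c < 2" "0 < i" "i < L" "{Inner c i, Inner d k} \<in> edges G"
  shows "d = c" "k = Suc i \<or> Suc k = i"
proof -
  have "Inner d k \<in> {pv c (i - 1), pv c (Suc i)}" using assms nb_Inner[OF assms(1-3)] by (auto simp: nb_def)
  then have "pv c (i - 1) = Inner d k \<or> pv c (Suc i) = Inner d k" by auto
  then show "d = c" "k = Suc i \<or> Suc k = i"
    using pv_eq_Inner[of "i - 1" c d k] pv_eq_Inner[of "Suc i" c d k] assms(2,3) by auto
qed

text \<open>The sum n + 1 of the degrees is 1 + 2 for n = 2, a leaf and an inner vertex, and 2 + 2
  for n = 3, two inner vertices.\<close>

lemma sharing_L2:
  assumes L: "L = 2" and n: "n = 2 \<or> n = 3"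
  shows "sharing 1"
  using n
proof
  assume n: "n = 2"
  have "LeafU 1 \<in> verts G" "deg G (LeafU 1) = 1" using n deg_LeafU[of 1] verts_G by auto
  moreover have "Inner 0 1 \<in> verts G" "deg G (Inner 0 1) = 2" using L2 Inner_in_verts deg_Inner by simp_all
  moreover have "{LeafU 1, Inner 0 1} \<notin> edges G" using leaf_not_adjacent[of 1] n by simp
  ultimately have "broom_exchange n L eL {LeafU 1, Inner 0 1}" "\<not> graph_iso G (swap_edge G eL {LeafU 1, Inner 0 1})"
    using sharing_leaf_exchange[of "LeafU 1" "Inner 0 1"] n by simp_all
  then show ?thesis by (rule sharing_1)
next
  assume n: "n = 3"
  have "Inner 1 1 \<in> verts G" "deg G (Inner 1 1) = 2" "Inner 0 1 \<in> verts G" "deg G (Inner 0 1) = 2"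
    using L2 Inner_in_verts deg_Inner by simp_all
  moreover have "{Inner 0 1, Inner 1 1} \<notin> edges G" using Inner_edge_path(1)[of 0 1 1 1] L2 by auto
  ultimately have "broom_exchange n L eL {Inner 0 1, Inner 1 1}" "\<not> graph_iso G (swap_edge G eL {Inner 0 1, Inner 1 1})"
    using sharing_leaf_exchange[of "Inner 0 1" "Inner 1 1"] n by simp_all
  then show ?thesis by (rule sharing_1)
qed

text \<open>Two leaves joined to each other have degree 2, so the new edge has edge degree 2 like
  the middle edge \<open>ep 1\<close>. \<open>EndU\<close> loses two leaves and only gains
  \<open>Inner 0 1\<close>.\<close>

lemma sharing_L3:
  assumes L: "L = 3" and n: "3 \<le> n"
  shows "sharing 1"
proof -
  have j: "1 \<le> L - 2" using L by simp
  have ab: "LeafU 0 \<noteq> LeafU 1" "LeafU 0 \<in> verts G" "LeafU 1 \<in> verts G" "{LeafU 0, LeafU 1} \<notin> edges G"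
    using n leaf_not_adjacent[of 0 "LeafU 1"] by (auto simp: verts_G)
  note d = deg_exchange[OF ep_edge[OF j] ab]
  have X: "broom_exchange n L (ep 1) {LeafU 0, LeafU 1}"
    by (rule broom_exchangeI[OF ep_edge[OF j] ab])
      (use d[of "LeafU 0"] d[of "LeafU 1"] ep_mem[OF j] edge_degree_ep[OF j] n in \<open>simp add: deg_G\<close>)
  interpret X: broom_ep_exchange n L "ep 1" "{LeafU 0, LeafU 1}" 1
    by (intro broom_ep_exchange.intro X broom_ep_exchange_axioms.intro j refl)
  have "deg X.K EndU = n + 2" "card (leaves X.K EndU) < n"
    using X.deficient_EndU'[OF refl, of "LeafU 0" "LeafU 1", OF _ _ _ _ _ _ refl] n by simp_all
  moreover have "EndU \<in> verts X.K" by (simp add: verts_G)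
  ultimately have "\<not> graph_iso G X.K" using not_iso_if_few_leaves[OF X.simple_K, of EndU] by simp
  then show ?thesis by (rule sharing_1[OF X])
qed

text \<open>\<open>Inner 0 2\<close> is chosen so that \<open>LeafU 1\<close> becomes a twin of
  \<open>Inner 0 1\<close>: both are then adjacent exactly to \<open>EndU\<close> and
  \<open>Inner 0 2\<close>. The second card of \<open>G\<close> comes from its other leaf edge at
  \<open>EndU\<close>.\<close>

lemma sharing_n2:
  assumes L: "3 \<le> L" and n: "n = 2"
  shows "sharing 2"
proof -
  let ?f = "{LeafU 1, Inner 0 2}"
  have l1: "LeafU 1 \<in> verts G" "deg G (LeafU 1) = 1" "nb G (LeafU 1) = {EndU}" using n deg_LeafU[of 1] verts_G nb_LeafU[of 1] by auto
  have i2: "Inner 0 2 \<in> verts G" "deg G (Inner 0 2) = 2" using L Inner_in_verts deg_Inner by simp_all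
  have "{LeafU 1, Inner 0 2} \<notin> edges G" using leaf_not_adjacent[of 1] n by simp
  then have X: "broom_exchange n L eL ?f" "\<not> graph_iso G (swap_edge G eL ?f)"
    using sharing_leaf_exchange[of "LeafU 1" "Inner 0 2"] n l1 i2 by simp_all
  interpret X: broom_exchange n L eL ?f by fact
  have "nb G (Inner 0 1) = {EndU, Inner 0 2}" using nb_Inner[of 0 1] L by (simp add: pv_Inner numeral_2_eq_2)
  then have nI: "nb X.K (Inner 0 1) = {EndU, Inner 0 2}" by (subst X.nb_K_out) auto
  have nL: "nb X.K (LeafU 1) = insert (Inner 0 2) {EndU}" unfolding l1(3)[symmetric] by (rule X.nb_K_f) auto
  have tw: "nb X.K (LeafU 1) = nb X.K (Inner 0 1)" unfolding nI nL by auto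
  have t: "iso_map (transpose (LeafU 0) (LeafU 1)) G G"
    by (rule iso_map_twins[OF simple_G]) (use l1 n1 nb_LeafU[of 0] verts_G in auto)
  have e': "{EndU, LeafU 1} \<in> edges G" using l1(3) by (auto simp: nb_def insert_commute)
  have c: "da_ecard G {EndU, LeafU 1} = da_ecard G eL" using da_ecard_symmetric[OF t eL_edge] by simp
  show ?thesis
    by (rule sharing_2_twins[OF X tw _ _ _ _ e' _ c]) (use L in \<open>auto simp: doubleton_eq_iff Inner_in_verts\<close>)
qed

text \<open>Removing \<open>ep 2\<close> leaves \<open>Inner 0 1\<close> between \<open>EndU\<close>
  and \<open>Inner 0 2\<close>, and the new edge makes \<open>LeafU 0\<close> its twin. The
  assumption L at least 4 gives \<open>ep 2\<close> edge degree 2; the second card of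
  \<open>G\<close> is that of its copy on the other path.\<close>

lemma sharing_L4:
  assumes L: "4 \<le> L" and n: "2 \<le> n"
  shows "sharing 2"
proof -
  let ?f = "{LeafU 0, Inner 0 2}"
  have j: "2 \<le> L - 2" using L by simp
  have ab: "LeafU 0 \<noteq> Inner 0 2" "LeafU 0 \<in> verts G" "Inner 0 2 \<in> verts G" "?f \<notin> edges G"
    using n L leaf_not_adjacent[of 0 "Inner 0 2"] by (auto simp: verts_G)
  note d = deg_exchange[OF ep_edge[OF j] ab]
  have d2: "deg G (LeafU 0) = 1" "deg G (Inner 0 2) = 2" using n1 L by (simp_all add: deg_G)
  have X: "broom_exchange n L (ep 2) ?f"
    by (rule broom_exchangeI[OF ep_edge[OF j] ab])
      (use d[of "LeafU 0"] d[of "Inner 0 2"] d2 ep_mem[OF j] edge_degree_ep[OF j] in simp)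
  interpret X: broom_ep_exchange n L "ep 2" ?f 2
    by (intro broom_ep_exchange.intro X broom_ep_exchange_axioms.intro j refl)
  have "deg X.K EndU = n + 2" "card (leaves X.K EndU) < n"
    using X.deficient_EndU[of 0] ep_mem[OF j] n by simp_all
  moreover have "EndU \<in> verts X.K" by (simp add: verts_G)
  ultimately have ni: "\<not> graph_iso G X.K" using not_iso_if_few_leaves[OF X.simple_K, of EndU] by simp
  have "nb G (Inner 0 1) = {EndU, Inner 0 2}" using nb_Inner[of 0 1] L by (simp add: pv_Inner numeral_2_eq_2)
  then have nI: "nb X.K (Inner 0 1) = {EndU, Inner 0 2}" using ep_mem(3)[OF j] by (subst X.nb_K_out) auto
  have "nb G (LeafU 0) = {EndU}" using n by (simp add: nb_LeafU)
  then have nL: "nb X.K (LeafU 0) = insert (Inner 0 2) {EndU}" using ep_mem(4)[OF j] by (metis X.nb_K_f)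
  have tw: "nb X.K (LeafU 0) = nb X.K (Inner 0 1)" unfolding nI nL by auto
  have e': "swp ` ep 2 \<in> edges G" by (rule iso_map_edge[OF iso_map_swp ep_edge[OF j]])
  have c: "da_ecard G (swp ` ep 2) = da_ecard G (ep 2)" by (rule da_ecard_symmetric[OF iso_map_swp ep_edge[OF j]])
  have "Inner 1 2 \<in> swp ` ep 2" using ep_mem(3)[OF j, of 0 2] by (auto intro!: image_eqI[of _ _ "Inner 0 2"])
  then have "swp ` ep 2 \<noteq> ep 2" using ep_mem(3)[OF j, of 1 2] by auto
  then show ?thesis
    by (intro sharing_2_twins[OF X ni tw _ _ _ _ e' _ c]) (use L in \<open>auto simp: Inner_in_verts\<close>)
qed

text \<open>
  For \<open>n = 1\<close> the shared cards come from the cycle with two pendant edges whose ends are at distance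
  \<open>L - i\<close> instead of \<open>L\<close>. The map \<open>refl_map i\<close> is the reflection of the cycle that exchanges these
  ends: with \<open>pv 0 a\<close> in position \<open>a\<close> and \<open>pv 1 a\<close> in position \<open>2 * L - a\<close> modulo
  \<open>2 * L\<close>, it maps position \<open>x\<close> to \<open>L + i - x\<close>.
\<close>

definition refl_map :: "nat \<Rightarrow> broom_vertex \<Rightarrow> broom_vertex" where
  "refl_map i x = (case x of EndU \<Rightarrow> pv 1 (L - i) | EndV \<Rightarrow> Inner 0 i
    | Inner c a \<Rightarrow> (if c = 0 then (if a \<le> i then pv 1 (L - i + a) else pv 0 (L + i - a))
        else (if L \<le> a + i then pv 0 (a + i - L) else pv 1 (L - a - i)))
    | LeafU t \<Rightarrow> LeafV t | LeafV t \<Rightarrow> LeafU t)"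

text \<open>The formulas for inner vertices of either path are also right at both ends, which spares
  the treatment of path edges a separate case for the ends.\<close>

lemma refl_map_pv:
  assumes "0 < i" "i < L" "a \<le> L"
  shows "refl_map i (pv 0 a) = (if a \<le> i then pv 1 (L - i + a) else pv 0 (L + i - a))"
    and "refl_map i (pv 1 a) = (if L \<le> a + i then pv 0 (a + i - L) else pv 1 (L - a - i))"
  by (rule pv_cases[OF assms(3), of 0]; use assms in \<open>simp add: refl_map_def pv_Inner\<close>)
    (rule pv_cases[OF assms(3), of 1]; use assms in \<open>simp add: refl_map_def pv_Inner\<close>)

lemma iso_map_refl:
  assumes i: "0 < i" "i < L" and n: "n = 1" and X: "broom_exchange n L eL {LeafU 0, Inner 0 i}"
  shows "iso_map (refl_map i) (swap_edge G eL {LeafU 0, Inner 0 i}) (swap_edge G eL {LeafU 0, Inner 0 i})"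
proof -
  interpret X: broom_exchange n L eL "{LeafU 0, Inner 0 i}" by fact
  note r = refl_map_pv[OF i]
  have rl: "refl_map i (LeafU t) = LeafV t" "refl_map i (LeafV t) = LeafU t" for t by (simp_all add: refl_map_def)
  have vc: "(\<exists>c a. c < 2 \<and> a \<le> L \<and> x = pv c a) \<or> x = LeafU 0 \<or> x = LeafV 0" if "x \<in> verts G" for x
    using that
  proof (cases rule: vert_cases)
    case 1
    then show ?thesis by (intro disjI1 exI[of _ 0]) simp
  next
    case 2
    then show ?thesis by (intro disjI1 exI[of _ 0] exI[of _ L]) simp
  next
    case (3 c a)
    then have "x = pv c a" by (simp add: pv_Inner)
    then show ?thesis using 3 by (metis less_imp_le)
  qed (use n in auto)
  have path: "{pv c a, pv c (Suc a)} \<in> edges X.K" if "c < 2" "a < L" for c a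
  proof -
    have "{pv c a, pv c (Suc a)} \<noteq> eL" using pv_not_leaf by (auto simp: doubleton_eq_iff)
    then show ?thesis using path_edge[OF that] by simp
  qed
  have "{EndV, LeafV 0} \<in> edges G" using n1 by (auto simp: edges_G)
  then have lv: "{EndV, LeafV 0} \<in> edges X.K" by (simp add: doubleton_eq_iff)
  show ?thesis
  proof (rule graph_isoI_involution[OF X.simple_K X.simple_K refl refl])
    fix x assume "x \<in> verts X.K"
    then have x: "(\<exists>c a. c < 2 \<and> a \<le> L \<and> x = pv c a) \<or> x = LeafU 0 \<or> x = LeafV 0" using vc by simp
    then show "refl_map i x \<in> verts X.K"
    proof (elim disjE exE conjE)
      fix c a assume "c < 2" "a \<le> L" "x = pv c a"
      then show ?thesis using r[of a] i by (cases "c = 0") (auto simp: less_2 intro!: pv_in_verts)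
    qed (use rl n1 in \<open>auto simp: verts_G\<close>)
    from x show "refl_map i (refl_map i x) = x"
    proof (elim disjE exE conjE)
      fix c a assume c: "c < 2" "a \<le> L" "x = pv c a"
      show ?thesis
      proof (cases "c = 0")
        case True
        show ?thesis
        proof (cases "a \<le> i")
          case True
          then have "refl_map i x = pv 1 (L - i + a)" using r(1)[OF c(2)] c(3) \<open>c = 0\<close> by simp
          moreover have "L - i + a \<le> L" "L \<le> L - i + a + i" "L - i + a + i - L = a" using True i by simp_all
          ultimately show ?thesis using r(2)[of "L - i + a"] c(3) \<open>c = 0\<close> by simp
        next
          case False
          then have ri: "refl_map i x = pv 0 (L + i - a)" using r(1)[OF c(2)] c(3) \<open>c = 0\<close> by simp
          show ?thesis
          proof (cases "a = L")
            case True
            then show ?thesis using ri r(1)[of i] c(3) i by simp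
          next
            case False
            then have "L + i - a \<le> L" "\<not> L + i - a \<le> i" "L + i - (L + i - a) = a"
              using \<open>\<not> a \<le> i\<close> c(2) by simp_all
            then show ?thesis using ri r(1)[of "L + i - a"] c(3) \<open>c = 0\<close> by simp
          qed
        qed
      next
        case False
        then have c1: "c = 1" using c(1) by simp
        show ?thesis
        proof (cases "L \<le> a + i")
          case True
          then have "refl_map i x = pv 0 (a + i - L)" using r(2)[OF c(2)] c(3) c1 by simp
          moreover have "a + i - L \<le> L" "a + i - L \<le> i" "L - i + (a + i - L) = a" using True i c(2) by simp_all
          ultimately show ?thesis using r(1)[of "a + i - L"] c(3) c1 by simp
        next
          case False
          then have ri: "refl_map i x = pv 1 (L - a - i)" using r(2)[OF c(2)] c(3) c1 by simp
          show ?thesis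
          proof (cases "a = 0")
            case True
            then show ?thesis using ri r(2)[of "L - i"] c(3) i by simp
          next
            case nz: False
            then have "L - a - i \<le> L" "\<not> L \<le> L - a - i + i" "L - (L - a - i) - i = a" "\<not> L \<le> L - a"
              using False L2 by simp_all
            then show ?thesis using ri r(2)[of "L - a - i"] c(3) c1 by simp
          qed
        qed
      qed
    qed (use rl in auto)
  next
    fix h assume h: "h \<in> edges X.K"
    have im: "refl_map i ` {x, y} = {refl_map i x, refl_map i y}" for x y by simp
    show "refl_map i ` h \<in> edges X.K"
    proof (cases "h = {LeafU 0, Inner 0 i}")
      case True
      have "refl_map i (Inner 0 i) = EndV" using r(1)[of i] i by (simp add: pv_Inner)
      then show ?thesis using True lv rl by (simp add: insert_commute)
    next
      case False
      then have "h \<in> edges G" "h \<noteq> eL" using h by auto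
      from this(1) show ?thesis
      proof (cases rule: edge_cases)
        case (1 c a)
        have a: "a \<le> L" "Suc a \<le> L" using 1(3) by simp_all
        \<comment> \<open>Images leave one path and enter the other at the preimages of the ends,
          \<open>pv 0 i\<close> for \<open>EndV\<close> and \<open>pv 1 (L - i)\<close> for
          \<open>EndU\<close>. The edges beside these vertices, a = i and L = a + i + 1, have cases
          of their own.\<close>
        consider "c = 0" "Suc a \<le> i" | "c = 0" "a = i" | "c = 0" "i < a"
          | "c = 1" "L \<le> a + i" | "c = 1" "L = Suc (a + i)" | "c = 1" "Suc (a + i) < L"
          using 1(2) by (auto simp: less_2) linarith+
        then show ?thesis
        proof cases
          case 1
          then have "refl_map i ` h = {pv 1 (L - i + a), pv 1 (Suc (L - i + a))}"
            using r(1)[OF a(1)] r(1)[OF a(2)] \<open>h = _\<close> by simp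
          then show ?thesis using path[of 1 "L - i + a"] 1 i by simp
        next
          case 2
          have s: "L + i - Suc a = L - 1" "L - i + a = L" "Suc (L - 1) = L" using 2 i by simp_all
          have "refl_map i (pv c a) = pv 1 L" using r(1)[OF a(1)] 2 s by simp
          moreover have "refl_map i (pv c (Suc a)) = pv 0 (L - 1)" using r(1)[OF a(2)] 2 s by simp
          ultimately have "refl_map i ` h = {EndV, pv 0 (L - 1)}" using \<open>h = _\<close> by simp
          moreover have "{pv 0 (L - 1), pv 0 (Suc (L - 1))} \<in> edges X.K" using path[of 0 "L - 1"] L2 by simp
          ultimately show ?thesis unfolding s(3) pv_L by (simp add: insert_commute)
        next
          case 3
          have s: "L + i - a = Suc (L + i - Suc a)" "L + i - Suc a < L" using 3 a by simp_all
          have "refl_map i (pv c a) = pv 0 (Suc (L + i - Suc a))" using r(1)[OF a(1)] 3 s(1) by simp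
          moreover have "refl_map i (pv c (Suc a)) = pv 0 (L + i - Suc a)" using r(1)[OF a(2)] 3 by simp
          ultimately show ?thesis using \<open>h = _\<close> path[of 0 "L + i - Suc a"] s(2) by (simp add: insert_commute)
        next
          case 4
          have s: "Suc a + i - L = Suc (a + i - L)" "a + i - L < L" using 4 a i by simp_all
          have "refl_map i (pv c a) = pv 0 (a + i - L)" using r(2)[OF a(1)] 4 by simp
          moreover have "refl_map i (pv c (Suc a)) = pv 0 (Suc (a + i - L))" using r(2)[OF a(2)] 4 s(1) by simp
          ultimately show ?thesis using \<open>h = _\<close> path[of 0 "a + i - L"] s(2) by simp
        next
          case 5
          have s: "L - a - i = Suc 0" "L \<le> Suc a + i" "Suc a + i - L = 0" "\<not> L \<le> a + i" using 5 by simp_all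
          have "refl_map i (pv c a) = pv 1 (Suc 0)" using r(2)[OF a(1)] 5(1) s by simp
          moreover have "refl_map i (pv c (Suc a)) = pv 1 0" using r(2)[OF a(2)] 5(1) s by simp
          ultimately show ?thesis using \<open>h = _\<close> path[of 1 0] L2 by (simp add: insert_commute)
        next
          case 6
          have s: "L - a - i = Suc (L - Suc a - i)" "L - Suc a - i < L" "\<not> L \<le> a + i" "\<not> L \<le> Suc a + i" using 6 by simp_all
          have "refl_map i (pv c a) = pv 1 (Suc (L - Suc a - i))" using r(2)[OF a(1)] 6(1) s by simp
          moreover have "refl_map i (pv c (Suc a)) = pv 1 (L - Suc a - i)" using r(2)[OF a(2)] 6(1) s by simp
          ultimately show ?thesis using \<open>h = _\<close> path[of 1 "L - Suc a - i"] s(2) by (simp add: insert_commute)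
        qed
      next
        case (2 t)
        then show ?thesis using \<open>h \<noteq> eL\<close> n by simp
      next
        case (3 t)
        then have "h = {EndV, LeafV 0}" using n by simp
        then have "refl_map i ` h = {Inner 0 i, LeafU 0}" using rl by (simp add: refl_map_def)
        then show ?thesis by (simp add: insert_commute)
      qed
    qed
  qed
qed

text \<open>For n = 1 a leaf moved from \<open>EndU\<close> to \<open>Inner 0 i\<close> keeps the
  edge degree 2, but the two branch vertices are then only L - i apart.\<close>

lemma pendant_exchange:
  assumes i: "0 < i" "i < L" and n: "n = 1"
  shows "broom_exchange n L eL {LeafU 0, Inner 0 i}" "\<not> graph_iso G (swap_edge G eL {LeafU 0, Inner 0 i})"
proof -
  let ?f = "{LeafU 0, Inner 0 i}"
  have ab: "LeafU 0 \<noteq> Inner 0 i" "LeafU 0 \<in> verts G" "Inner 0 i \<in> verts G" "?f \<notin> edges G"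
    using n1 i leaf_not_adjacent[of 0 "Inner 0 i"] by (auto simp: verts_G)
  note d = deg_exchange[OF eL_edge ab]
  have dG: "deg G (LeafU 0) = 1" "deg G (Inner 0 i) = 2" "deg G EndV = n + 2" using n1 i by (simp_all add: deg_G)
  have dK: "deg (swap_edge G eL ?f) (LeafU 0) = 1" "deg (swap_edge G eL ?f) (Inner 0 i) = 3"
    "deg (swap_edge G eL ?f) EndV = n + 2"
    using d[of "LeafU 0"] d[of "Inner 0 i"] d[of EndV] dG by simp_all
  show X: "broom_exchange n L eL ?f"
    by (rule broom_exchangeI[OF eL_edge ab]) (use dK edge_degree_eL n in simp)
  interpret X: broom_exchange n L eL ?f by fact
  have EV: "EndV \<in> verts G" by (simp add: verts_G)
  have "walk X.K (L - i) ((\<lambda>t. pv 0 (i + t)) 0) ((\<lambda>t. pv 0 (i + t)) (L - i))"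
  proof (rule walk_along)
    fix t assume "t < L - i"
    then have "{pv 0 (i + t), pv 0 (Suc (i + t))} \<in> edges G" by (intro path_edge) auto
    moreover have "{pv 0 (i + t), pv 0 (Suc (i + t))} \<noteq> eL" using pv_not_leaf by (auto simp: doubleton_eq_iff)
    ultimately show "pv 0 (i + Suc t) \<in> nb X.K (pv 0 (i + t))" by (simp add: nb_def)
  qed
  then have w: "walk X.K (L - i) (Inner 0 i) EndV" using i by (simp add: pv_Inner)
  show "\<not> graph_iso G X.K"
    by (rule not_iso_if_close_hubs[OF X.simple_K _ _ _ _ _ w]) (use ab(3) EV dK i n1 in simp_all)
qed

text \<open>The reflection interchanges the two pendant edges of the new graph, as
  \<open>flip\<close> does those of \<open>G\<close>, so each graph has the common leaf card
  twice.\<close>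

lemma pendant_cards:
  assumes i: "0 < i" "i < L" and n: "n = 1"
  shows "{EndV, LeafV 0} \<in> edges (swap_edge G eL {LeafU 0, Inner 0 i})"
    "da_ecard (swap_edge G eL {LeafU 0, Inner 0 i}) {LeafU 0, Inner 0 i} = da_ecard G eL"
    "da_ecard (swap_edge G eL {LeafU 0, Inner 0 i}) {EndV, LeafV 0} = da_ecard G eL"
    "{EndV, LeafV 0} \<in> edges G" "da_ecard G {EndV, LeafV 0} = da_ecard G eL"
proof -
  note X = pendant_exchange(1)[OF i n]
  interpret X: broom_exchange n L eL "{LeafU 0, Inner 0 i}" by (rule X)
  have r: "refl_map i ` {LeafU 0, Inner 0 i} = {EndV, LeafV 0}"
    using refl_map_pv(1)[OF i, of i] i by (auto simp: refl_map_def)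
  show "{EndV, LeafV 0} \<in> edges X.K" using iso_map_edge[OF iso_map_refl[OF i n X] X.f_in_K] unfolding r .
  show 1: "da_ecard X.K {LeafU 0, Inner 0 i} = da_ecard G eL" by (rule X.da_ecard_f)
  show "da_ecard X.K {EndV, LeafV 0} = da_ecard G eL"
    using iso_map_da_ecard[OF X.simple_K X.simple_K iso_map_refl[OF i n X] X.f_in_K] unfolding r 1 .
  have f: "flip ` eL = {EndV, LeafV 0}" by simp
  show "{EndV, LeafV 0} \<in> edges G" using iso_map_edge[OF iso_map_flip eL_edge] unfolding f .
  show "da_ecard G {EndV, LeafV 0} = da_ecard G eL" using da_ecard_symmetric[OF iso_map_flip eL_edge] unfolding f .
qed

text \<open>The two pendant edges suffice here, and i = 1 is available already for L = 2.\<close>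

lemma sharing_n1_L2:
  assumes n: "n = 1"
  shows "sharing 2"
proof -
  let ?f = "{LeafU 0, Inner 0 1}"
  have i: "0 < (1 :: nat)" "1 < L" using L2 by simp_all
  note X = pendant_exchange[OF i n] and c = pendant_cards[OF i n]
  interpret X: broom_exchange n L eL ?f by (rule X(1))
  obtain S where "S \<subseteq># da_edeck G" "S \<subseteq># da_edeck X.K" "size S = length [eL, {EndV, LeafV 0}]"
  proof (rule common_subset_of_edges[OF simple_G X.simple_K, of "[eL, {EndV, LeafV 0}]" "[?f, {EndV, LeafV 0}]"])
    show "distinct [eL, {EndV, LeafV 0}]" "distinct [?f, {EndV, LeafV 0}]" by (auto simp: doubleton_eq_iff)
    show "set [eL, {EndV, LeafV 0}] \<subseteq> edges G" using eL_edge c(4) by simp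
    show "set [?f, {EndV, LeafV 0}] \<subseteq> edges X.K" using c(1) X.f_in_K by (simp only: list.set insert_subset empty_subsetI simp_thms)
    show "map (da_ecard G) [eL, {EndV, LeafV 0}] = map (da_ecard X.K) [?f, {EndV, LeafV 0}]"
      using c by (simp only: list.map)
  qed
  then show ?thesis using X.simple_K X(2) by (intro exI[of _ S] exI[of _ X.K]) simp
qed

text \<open>With i = 2 the graph also arises by removing \<open>ep 0\<close>, by
  \<open>iso_map_twist\<close>. This gives a third shared card, at the edge from
  \<open>Inner 0 1\<close> to \<open>Inner 0 2\<close>, and the reflection gives a fourth. In
  \<open>G\<close> the matching end edges are \<open>ep 0\<close> and its copy on the other
  path.\<close>

lemma sharing_n1:
  assumes n: "n = 1" and L: "3 \<le> L"
  shows "sharing 4"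
proof -
  let ?f = "{LeafU 0, Inner 0 2}"
  have i: "0 < (2 :: nat)" "2 < L" using L by simp_all
  note X = pendant_exchange[OF i n] and c = pendant_cards[OF i n]
  interpret X: broom_exchange n L eL ?f by (rule X(1))
  have ab: "LeafU 0 \<noteq> Inner 0 2" "LeafU 0 \<in> verts G" "Inner 0 2 \<in> verts G" "?f \<notin> edges G"
    using n1 i leaf_not_adjacent[of 0 "Inner 0 2"] by (auto simp: verts_G)
  have j: "0 \<le> L - 2" by simp
  note d = deg_exchange[OF ep_edge[OF j] ab]
  have "broom_exchange n L (ep 0) ?f"
  proof (rule broom_exchangeI[OF ep_edge[OF j] ab])
    have "deg G (LeafU 0) = 1" "deg G (Inner 0 2) = 2" using n1 i by (simp_all add: deg_G)
    then show "deg (swap_edge G (ep 0) ?f) (LeafU 0) + deg (swap_edge G (ep 0) ?f) (Inner 0 2) = edge_degree G (ep 0) + 2"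
      using d[of "LeafU 0"] d[of "Inner 0 2"] ep_mem[OF j] edge_degree_ep[OF j] n by simp
  qed
  then interpret Y: broom_exchange n L "ep 0" ?f .
  let ?t = "transpose (LeafU 0) (Inner 0 1)"
  let ?g = "{Inner 0 1, Inner 0 2}" and ?h = "{Inner 1 (L - 1), EndV}"
  have tf: "?t ` ?f = ?g" by simp
  have g: "?g \<in> edges X.K" using iso_map_edge[OF iso_map_twist[OF L] Y.f_in_K] unfolding tf .
  have cg: "da_ecard X.K ?g = da_ecard G (ep 0)"
    using iso_map_da_ecard[OF Y.simple_K X.simple_K iso_map_twist[OF L] Y.f_in_K] unfolding tf Y.da_ecard_f .
  have s: "L - 2 + 1 = L - 1" "0 < L - 1" "L - 1 < L" "L - 2 + 2 = L" using L by simp_all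
  have "refl_map 2 (Inner 0 1) = pv 1 (L - 2 + 1)" by (simp add: refl_map_def)
  then have "refl_map 2 (Inner 0 1) = Inner 1 (L - 1)" unfolding s(1) using pv_Inner[OF s(2,3), of 1] by simp
  moreover have "refl_map 2 (Inner 0 2) = pv 1 (L - 2 + 2)" by (simp add: refl_map_def)
  then have "refl_map 2 (Inner 0 2) = EndV" unfolding s(4) by simp
  ultimately have rg: "refl_map 2 ` ?g = ?h" by simp
  have h: "?h \<in> edges X.K" using iso_map_edge[OF iso_map_refl[OF i n X(1)] g] unfolding rg .
  have ch: "da_ecard X.K ?h = da_ecard G (ep 0)"
    using iso_map_da_ecard[OF X.simple_K X.simple_K iso_map_refl[OF i n X(1)] g] unfolding rg cg .
  have e0: "ep 0 = {EndU, Inner 0 1}" using L by (simp add: ep_def pv_Inner)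
  have se: "swp ` ep 0 = {EndU, Inner 1 1}" by (simp add: e0)
  have e1: "{EndU, Inner 1 1} \<in> edges G" using iso_map_edge[OF iso_map_swp ep_edge[OF j]] unfolding se .
  have c1: "da_ecard G {EndU, Inner 1 1} = da_ecard G (ep 0)" using da_ecard_symmetric[OF iso_map_swp ep_edge[OF j]] unfolding se .
  let ?es = "[eL, {EndV, LeafV 0}, ep 0, {EndU, Inner 1 1}]" and ?gs = "[?f, {EndV, LeafV 0}, ?g, ?h]"
  obtain S where "S \<subseteq># da_edeck G" "S \<subseteq># da_edeck X.K" "size S = length ?es"
  proof (rule common_subset_of_edges[OF simple_G X.simple_K, of ?es ?gs])
    show "distinct ?es" "distinct ?gs" unfolding e0 by (auto simp: doubleton_eq_iff)
    show "set ?es \<subseteq> edges G" using eL_edge c(4) ep_edge[OF j] e1 by simp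
    show "set ?gs \<subseteq> edges X.K" using c(1) g h X.f_in_K by (simp only: list.set insert_subset empty_subsetI simp_thms)
    show "map (da_ecard G) ?es = map (da_ecard X.K) ?gs"
      using c cg ch c1 by (simp only: list.map)
  qed
  then show ?thesis using X.simple_K X(2) by (intro exI[of _ S] exI[of _ X.K]) simp
qed

text \<open>The empty multiset lies in every deck, so any graph that is not \<open>G\<close>, such
  as the empty one, keeps \<open>adern\<close> from being 0.\<close>

lemma sharing_0:
  "sharing 0"
proof -
  have "simple_graph ({}, {})" by (simp add: simple_graph_def verts_def edges_def)
  moreover have "EndU \<in> verts G" by (simp add: verts_G)
  then have "\<not> graph_iso G ({}, {})" by (auto simp: graph_iso_def verts_def bij_betw_def)
  ultimately show ?thesis by (intro exI[of _ "{#}"] exI[of _ "({}, {})"]) simp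
qed

lemma adern_G: "adern G = max_common + 1"
proof -
  have "sharing max_common"
  proof -
    consider "n = 1" "3 \<le> L" | "n = 1" "L = 2" | "n = 2 \<or> n = 3" "L = 2" | "4 \<le> n" "L = 2"
      | "n = 2" "3 \<le> L" | "3 \<le> n" "L = 3" | "3 \<le> n" "4 \<le> L"
    proof -
      have "L = 2 \<or> 3 \<le> L" "L = 2 \<or> L = 3 \<or> 4 \<le> L" "n = 1 \<or> n = 2 \<or> 3 \<le> n" "n = 1 \<or> n = 2 \<or> n = 3 \<or> 4 \<le> n"
        using n1 L2 by auto
      then show thesis using that by blast
    qed
    then show ?thesis
    proof cases
      case 1
      then have "max_common = 4" unfolding max_common_def by auto
      then show ?thesis using sharing_n1[OF 1] by simp
    next
      case 2
      then have "max_common = 2" unfolding max_common_def by auto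
      then show ?thesis using sharing_n1_L2[OF 2(1)] by simp
    next
      case 3
      then have "max_common = 1" unfolding max_common_def by auto
      then show ?thesis using sharing_L2[OF 3(2,1)] by simp
    next
      case 4
      then have "max_common = 0" unfolding max_common_def by auto
      then show ?thesis using sharing_0 by simp
    next
      case 5
      then have "max_common = 2" unfolding max_common_def by auto
      then show ?thesis using sharing_n2[OF 5(2,1)] by simp
    next
      case 6
      then have "max_common = 1" unfolding max_common_def by auto
      then show ?thesis using sharing_L3[OF 6(2,1)] by simp
    next
      case 7
      then have "max_common = 2" "2 \<le> n" unfolding max_common_def by auto
      then show ?thesis using sharing_L4[OF 7(2)] by simp
    qed
  qed
  then obtain S and K :: "broom_vertex ugraph" where "simple_graph K" "\<not> graph_iso G K" "S \<subseteq># da_edeck G" "S \<subseteq># da_edeck K"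
    "size S = max_common" by blast
  from adern_eqI[OF simple_G this card_goods_le] show ?thesis by simp
qed

end

theorem theorem3p1:
  fixes n k :: nat
  assumes "n \<ge> 1" and "k \<ge> 3"
  shows "adern (strong_double_broom n n 2 k) =
    (if n = 1 \<and> k \<ge> 4 then 5
     else if (n \<in> {2, 3} \<and> k = 3) \<or> (n \<ge> 3 \<and> k = 4) then 2
     else if n \<ge> 4 \<and> k = 3 then 1
     else 3)"
proof -
  obtain L where k: "k = Suc L" using assms(2) by (cases k) auto
  interpret broom n L by unfold_locales (use assms k in auto)
  show ?thesis using adern_G assms unfolding k max_common_def by auto
qed

end
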